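(* Let $T>0$, $Q=[0,T]\times\mathbb{R}$, and let the flux $A=A(x,u)$ satisfy assumptions (A-1), (A-2), (A-3) listed in the context. Let $u,v\in C([0,T];L^1_{loc}(\mathbb{R}))\cap L^\infty(Q)$ be adapted entropy solutions (defined in the context) of $u_t+A(x,u)_x=0$ with initial data $u_0,v_0\in L^\infty(\mathbb{R})$ respectively. Then for every $t\in[0,T]$ and all $-\infty\le a<b\le\infty$, $$\int_a^b|u(t,x)-v(t,x)|\,dx\le\int_{a-Mt}^{b+Mt}|u_0(x)-v_0(x)|\,dx,$$ where $M:=\sup\{|A_u(x,u(t,x))|:\ x\in\mathbb{R},\ 0\le t\le T\}$ and $A_u=\partial A/\partial u$.
   Context: Assumptions on $A:\mathbb{R}\times\mathbb{R}\to\mathbb{R}$, $(x,u)\mapsto A(x,u)$: (A-1) $A$ is continuous on $(\mathbb{R}\setminus\Omega)\times\mathbb{R}$, where $\Omega\subset\mathbb{R}$ is a closed set of measure zero. (A-2) There is a locally bounded function $q:\mathbb{R}\to\mathbb{R}$ such that $|A(x,u)-A(x,v)|\le q(R)|u-v|$ for a.e. $x\in\mathbb{R}$ and all $u,v\in[-R,R]$, $R>0$. (A-3) There are functions $u_M^\pm:\mathbb{R}\to\mathbb{R}$, continuous on $\mathbb{R}\setminus\Omega$, with $u_M^-(x)\le u_M^+(x)$ for $x\in\mathbb{R}\setminus\Omega$, such that $A(x,\cdot)$ is (strictly) decreasing on $(-\infty,u_M^-(x)]$, (strictly) increasing on $[u_M^+(x),\infty)$, and $A(x,z)=0$ for all $u_M^-(x)\le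 z\le u_M^+(x)$. Stationary states: for $\alpha\ge0$, $k_\alpha^-(x)\le u_M^-(x)$ and $k_\alpha^+(x)\ge u_M^+(x)$ are defined by $A(x,k_\alpha^\pm(x))=\alpha$ (it is implicit that these exist for every $\alpha\ge0$). For $\alpha>0$ let $\mathscr S_\alpha=\{k_\alpha^+,k_\alpha^-\}$; for $\alpha=0$ let $\mathscr S_0$ be the set of all (measurable) functions $k$ with $u_M^-(x)\le k(x)\le u_M^+(x)$ for all $x$. Adapted entropy solution: $u\in L^\infty(Q)\cap C([0,T];L^1_{loc}(\mathbb{R}))$ is an adapted entropy solution with initial data $u_0$ if for all $\alpha\ge0$, all $k_\alpha\in\mathscr S_\alpha$ and all $0\le\phi\in C_c^\infty([0,T)\times\mathbb{R})$, $$\int_Q\Big(|u(t,x)-k_\alpha(x)|\,\phi_t(t,x)+\operatorname{sgn}(u(t,x)-k_\alpha(x))\,(A(x,u(t,x))-\alpha)\,\phi_x(t,x)\Big)\,dx\,dt+\int_{\mathbb{R}}|u_0(x)-k_\alpha(x)|\,\phi(0,x)\,dx\ge0.$$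
   Formalization: The printed M, using only the states u(t,x), makes the claim false (A=u²/2, u=0, v a shock from 1 to 0). Here M is the essential supremum over Q of |A_u(x,w)| for all w between u(t,x) and v(t,x), counting only derivatives that exist. *)

theory Defs
  imports "HOL-Analysis.Analysis"
begin

section \<open>The flux\<close>

text \<open>The flux is curried: \<open>A x w\<close> is $A(x,w)$. The exceptional set \<open>\<Omega>\<close>, the local Lipschitz
  bound \<open>q\<close> and the two ends \<open>um\<close>, \<open>up\<close> of the zero plateau ($u_M^-$ and $u_M^+$) are parameters.\<close>

definition flux_A1 :: "(real \<Rightarrow> real \<Rightarrow> real) \<Rightarrow> real set \<Rightarrow> bool" where
  "flux_A1 A \<Omega> \<longleftrightarrow> closed \<Omega> \<and> negligible \<Omega> \<and> continuous_on ((-\<Omega>) \<times> UNIV) (\<lambda>(x, w). A x w)"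

definition flux_A2 :: "(real \<Rightarrow> real \<Rightarrow> real) \<Rightarrow> (real \<Rightarrow> real) \<Rightarrow> bool" where
  "flux_A2 A q \<longleftrightarrow>
     (\<forall>c d. bounded (q ` {c..d})) \<and>
     (AE x in lebesgue. \<forall>R>0. \<forall>w\<in>{-R..R}. \<forall>z\<in>{-R..R}. \<bar>A x w - A x z\<bar> \<le> q R * \<bar>w - z\<bar>)"

text \<open>Nothing is required on the null set \<open>\<Omega>\<close>, where the ordering of \<open>um\<close> and \<open>up\<close> is not
  available.\<close>

definition flux_A3 :: "(real \<Rightarrow> real \<Rightarrow> real) \<Rightarrow> real set \<Rightarrow> (real \<Rightarrow> real) \<Rightarrow> (real \<Rightarrow> real) \<Rightarrow> bool" where
  "flux_A3 A \<Omega> um up \<longleftrightarrow>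
     continuous_on (-\<Omega>) um \<and> continuous_on (-\<Omega>) up \<and>
     (\<forall>x\<in>-\<Omega>. um x \<le> up x \<and>
        strict_antimono_on {..um x} (A x) \<and>
        strict_mono_on {up x..} (A x) \<and>
        (\<forall>z\<in>{um x..up x}. A x z = 0))"


section \<open>Stationary states\<close>

definition is_k_minus ::
  "(real \<Rightarrow> real \<Rightarrow> real) \<Rightarrow> real set \<Rightarrow> (real \<Rightarrow> real) \<Rightarrow> real \<Rightarrow> (real \<Rightarrow> real) \<Rightarrow> bool" where
  "is_k_minus A \<Omega> um \<alpha> k \<longleftrightarrow> (\<forall>x\<in>-\<Omega>. k x \<le> um x \<and> A x (k x) = \<alpha>)"

definition is_k_plus ::
  "(real \<Rightarrow> real \<Rightarrow> real) \<Rightarrow> real set \<Rightarrow> (real \<Rightarrow> real) \<Rightarrow> real \<Rightarrow> (real \<Rightarrow> real) \<Rightarrow> bool" where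
  "is_k_plus A \<Omega> up \<alpha> k \<longleftrightarrow> (\<forall>x\<in>-\<Omega>. up x \<le> k x \<and> A x (k x) = \<alpha>)"

text \<open>The standing requirement that $k_\alpha^\pm$ exist for every $\alpha \ge 0$. Under
  \<open>flux_A3\<close> each is then unique off \<open>\<Omega>\<close>.\<close>

definition stationary_states_exist ::
  "(real \<Rightarrow> real \<Rightarrow> real) \<Rightarrow> real set \<Rightarrow> (real \<Rightarrow> real) \<Rightarrow> (real \<Rightarrow> real) \<Rightarrow> bool" where
  "stationary_states_exist A \<Omega> um up \<longleftrightarrow>
     (\<forall>\<alpha>\<ge>0. (\<exists>k. is_k_minus A \<Omega> um \<alpha> k) \<and> (\<exists>k. is_k_plus A \<Omega> up \<alpha> k))"

definition stationary_states ::
  "(real \<Rightarrow> real \<Rightarrow> real) \<Rightarrow> real set \<Rightarrow> (real \<Rightarrow> real) \<Rightarrow> (real \<Rightarrow> real) \<Rightarrow> real \<Rightarrow> (real \<Rightarrow> real) set" where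
  "stationary_states A \<Omega> um up \<alpha> =
     (if \<alpha> = 0
      then {k \<in> borel_measurable lebesgue. \<forall>x\<in>-\<Omega>. um x \<le> k x \<and> k x \<le> up x}
      else {k. is_k_minus A \<Omega> um \<alpha> k \<or> is_k_plus A \<Omega> up \<alpha> k})"


section \<open>Test functions\<close>

definition pd_t :: "(real \<Rightarrow> real \<Rightarrow> real) \<Rightarrow> real \<Rightarrow> real \<Rightarrow> real" where
  "pd_t \<phi> = (\<lambda>t x. deriv (\<lambda>s. \<phi> s x) t)"

definition pd_x :: "(real \<Rightarrow> real \<Rightarrow> real) \<Rightarrow> real \<Rightarrow> real \<Rightarrow> real" where
  "pd_x \<phi> = (\<lambda>t x. deriv (\<phi> t) x)"

text \<open>If all $\partial_t^i \partial_x^j \varphi$ are (Frechet) differentiable, then mixed partial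
  derivatives commute and $\varphi$ is $C^\infty$.\<close>

definition smooth2 :: "(real \<Rightarrow> real \<Rightarrow> real) \<Rightarrow> bool" where
  "smooth2 \<phi> \<longleftrightarrow> (\<forall>i j. (\<lambda>(t, x). (pd_t ^^ i) ((pd_x ^^ j) \<phi>) t x) differentiable_on UNIV)"

text \<open>$C_c^\infty([0,T)\times\mathbb{R})$ consists of the restrictions to $t \ge 0$ of functions in
  $C_c^\infty((-\infty,T)\times\mathbb{R})$; in particular $\varphi(0,\cdot)$ need not vanish, and the
  sign condition concerns $t \ge 0$ only.\<close>

definition test_function :: "real \<Rightarrow> (real \<Rightarrow> real \<Rightarrow> real) \<Rightarrow> bool" where
  "test_function T \<phi> \<longleftrightarrow>
     smooth2 \<phi> \<and>
     (\<exists>K. compact K \<and> K \<subseteq> {..<T} \<times> UNIV \<and> (\<forall>t x. (t, x) \<notin> K \<longrightarrow> \<phi> t x = 0)) \<and>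
     (\<forall>t\<ge>0. \<forall>x. 0 \<le> \<phi> t x)"


section \<open>Function spaces\<close>

definition Linf :: "(real \<Rightarrow> real) \<Rightarrow> bool" where
  "Linf f \<longleftrightarrow> f \<in> borel_measurable lebesgue \<and> (\<exists>C. AE x in lebesgue. \<bar>f x\<bar> \<le> C)"

abbreviation Q_dom :: "real \<Rightarrow> (real \<times> real) set" where
  "Q_dom T \<equiv> {0..T} \<times> UNIV"

definition Linf_Q :: "real \<Rightarrow> (real \<Rightarrow> real \<Rightarrow> real) \<Rightarrow> bool" where
  "Linf_Q T u \<longleftrightarrow>
     (\<lambda>(t, x). u t x) \<in> borel_measurable (lebesgue_on (Q_dom T)) \<and>
     (\<exists>C. AE (t, x) in lebesgue_on (Q_dom T). \<bar>u t x\<bar> \<le> C)"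

definition continuous_L1loc :: "real \<Rightarrow> (real \<Rightarrow> real \<Rightarrow> real) \<Rightarrow> bool" where
  "continuous_L1loc T u \<longleftrightarrow>
     (\<forall>t\<in>{0..T}. \<forall>r. set_integrable lebesgue {-r..r} (u t)) \<and>
     (\<forall>s\<in>{0..T}. \<forall>r.
        ((\<lambda>t. LINT x:{-r..r}|lebesgue. \<bar>u t x - u s x\<bar>) \<longlongrightarrow> 0) (at s within {0..T}))"


section \<open>Adapted entropy solutions\<close>

definition entropy_integrand ::
  "(real \<Rightarrow> real \<Rightarrow> real) \<Rightarrow> (real \<Rightarrow> real \<Rightarrow> real) \<Rightarrow> real \<Rightarrow> (real \<Rightarrow> real)
     \<Rightarrow> (real \<Rightarrow> real \<Rightarrow> real) \<Rightarrow> real \<times> real \<Rightarrow> real" where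
  "entropy_integrand A u \<alpha> k \<phi> = (\<lambda>(t, x).
     \<bar>u t x - k x\<bar> * pd_t \<phi> t x + sgn (u t x - k x) * (A x (u t x) - \<alpha>) * pd_x \<phi> t x)"

text \<open>Integrability is stated explicitly because the Bochner integral of a non-integrable function
  is \<open>0\<close> by convention, whereas the inequality presupposes that both integrals exist.\<close>

definition adapted_entropy_solution ::
  "(real \<Rightarrow> real \<Rightarrow> real) \<Rightarrow> real set \<Rightarrow> (real \<Rightarrow> real) \<Rightarrow> (real \<Rightarrow> real) \<Rightarrow> real
     \<Rightarrow> (real \<Rightarrow> real) \<Rightarrow> (real \<Rightarrow> real \<Rightarrow> real) \<Rightarrow> bool" where
  "adapted_entropy_solution A \<Omega> um up T u0 u \<longleftrightarrow>
     Linf_Q T u \<and> continuous_L1loc T u \<and>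
     (\<forall>\<alpha>\<ge>0. \<forall>k\<in>stationary_states A \<Omega> um up \<alpha>. \<forall>\<phi>. test_function T \<phi> \<longrightarrow>
        set_integrable lebesgue (Q_dom T) (entropy_integrand A u \<alpha> k \<phi>) \<and>
        integrable lebesgue (\<lambda>x. \<bar>u0 x - k x\<bar> * \<phi> 0 x) \<and>
        (LINT z:Q_dom T|lebesgue. entropy_integrand A u \<alpha> k \<phi> z)
          + (LINT x|lebesgue. \<bar>u0 x - k x\<bar> * \<phi> 0 x) \<ge> 0)"


section \<open>Maximal speed of propagation\<close>

text \<open>The essential supremum over \<open>Q\<close> of $|A_u(x,w)|$, where \<open>w\<close> ranges over the states between
  $u(t,x)$ and $v(t,x)$, both included. Two points need care.

  \<^item> The flux is only locally Lipschitz in its second argument, so $A_u$ need not exist at a given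
    state; only existing derivatives are counted. By Lipschitz continuity they determine the
    Lipschitz constant of $A(x,\cdot)$ on the segment.

  \<^item> The states $w = u(t,x)$ alone do not suffice. For $A(x,w) = w^2/2$ and $u = 0$ they give speed
    \<open>0\<close>, yet the shock \<open>v\<close> with left state \<open>1\<close> and right state \<open>0\<close> started at the origin enters
    $(0,1)$ at once, so that the stability estimate fails. Nor do the values of \<open>u\<close> and \<open>v\<close>
    suffice without the states in between when the flux is discontinuous in \<open>x\<close>.\<close>

definition max_speed ::
  "(real \<Rightarrow> real \<Rightarrow> real) \<Rightarrow> real \<Rightarrow> (real \<Rightarrow> real \<Rightarrow> real) \<Rightarrow> (real \<Rightarrow> real \<Rightarrow> real) \<Rightarrow> real" where
  "max_speed A T u v = Inf {m. 0 \<le> m \<and>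
     (AE (t, x) in lebesgue_on (Q_dom T). \<forall>w\<in>closed_segment (u t x) (v t x).
        \<forall>d. (A x has_real_derivative d) (at w) \<longrightarrow> \<bar>d\<bar> \<le> m)}"

end

theory Submission
  imports Defs
begin

text \<open>Kruzkov's doubling of variables with the stationary states as entropies. The signed flux
  \<open>P x w\<close>, which is \<open>A x w\<close> to the right of the plateau and \<open>- A x w\<close> to the left of it, is
  nondecreasing in \<open>w\<close>. Through a state \<open>c\<close> at \<open>y\<close> there passes a stationary state \<open>K x y c\<close> with
  \<open>P x (K x y c) = P y c\<close> and \<open>K y y c = c\<close>, continuous at \<open>x = y\<close>. With this entropy the flux term is
  a symmetric function of \<open>P x (u t x)\<close> and \<open>P y (v s y)\<close>, so the derivatives of the kernels cancel
  in the sum of the two doubled inequalities, except for the derivative of the time kernel. Its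
  factor \<open>\<bar>u - K\<bar> - \<bar>v - K\<bar>\<close> (with two different \<open>K\<close>) vanishes when the width of the space kernel
  tends to \<open>0\<close> first. Kato's inequality results, and it is tested with a function on
  the trapezoid of slope \<open>M\<close>; on it the flux is at most \<open>M \<bar>u - v\<bar>\<close>, since a Lipschitz function is
  controlled by the values of its derivative at the points where it exists.\<close>


section \<open>Smooth test functions\<close>

text \<open>With constants as entropies, doubling leaves A(x,c) - A(y,c) times the derivative of the
  space kernel, which is out of control for a flux that is irregular in x. Stationary states remove
  this term exactly, but they depend on x: \<open>K x y c\<close> tends to \<open>c\<close> without
  any rate, so its deviation from \<open>c\<close> may only meet factors whose mass stays bounded
  while the space kernel shrinks. Near \<Omega> the assumptions bound neither the flux along a
  bounded state nor \<open>K\<close>. Integrability of the flux is therefore extracted from the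
  entropy inequality itself, and the entropy is renormalised to |u - K| - |K|. The datum enters only
  through the entropy inequalities, so that u(0,.) = u0 has to be proved; a second doubling, in the
  space variable alone, does this. That a Lipschitz function g is the integral of its derivative is
  obtained by splitting Lebesgue measure into the two measures with distribution functions x/2 +
  g(x) and x/2 - g(x).\<close>

coinductive smooth1 :: "(real \<Rightarrow> real) \<Rightarrow> bool" where
  "(\<And>x. (f has_real_derivative f' x) (at x)) \<Longrightarrow> smooth1 f' \<Longrightarrow> smooth1 f"

lemma smooth1_deriv:
  assumes "smooth1 f"
  shows "(f has_real_derivative deriv f x) (at x)" "smooth1 (deriv f)"
proof -
  obtain f' where f': "\<And>x. (f has_real_derivative f' x) (at x)" "smooth1 f'"
    using assms by (cases rule: smooth1.cases) auto
  then have "deriv f = f'"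
    by (auto intro!: ext DERIV_imp_deriv)
  then show "(f has_real_derivative deriv f x) (at x)" "smooth1 (deriv f)"
    using f' by auto
qed

lemma smooth1_const: "smooth1 (\<lambda>x. c)"
proof (coinduction arbitrary: c)
  case smooth1
  then show ?case
    by (intro exI[of _ "\<lambda>x. c"] exI[of _ "\<lambda>x. 0"]) auto
qed

lemma smooth1_exp: "smooth1 exp"
proof (coinduction)
  case smooth1
  then show ?case
    by (intro exI[of _ exp]) (auto intro!: derivative_eq_intros)
qed

text \<open>A coinduction on products alone would not close, since the derivative of a product is a
  sum of two products. The algebra generated by smooth functions and their affine reparametrisations
  is stable under differentiation, so a single coinduction gives all closure properties.\<close>

inductive smooth1_alg :: "(real \<Rightarrow> real) \<Rightarrow> bool" where
  base: "smooth1 f \<Longrightarrow> smooth1_alg f"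
| affine: "smooth1 f \<Longrightarrow> smooth1_alg (\<lambda>x. f (c * x + d))"
| add: "smooth1_alg f \<Longrightarrow> smooth1_alg g \<Longrightarrow> smooth1_alg (\<lambda>x. f x + g x)"
| mult: "smooth1_alg f \<Longrightarrow> smooth1_alg g \<Longrightarrow> smooth1_alg (\<lambda>x. f x * g x)"

lemma smooth1_alg_deriv:
  "smooth1_alg f \<Longrightarrow> \<exists>f'. (\<forall>x. (f has_real_derivative f' x) (at x)) \<and> smooth1_alg f'"
proof (induction rule: smooth1_alg.induct)
  case (base f)
  then show ?case using smooth1_deriv smooth1_alg.base by blast
next
  case (affine f c d)
  have "((\<lambda>x. f (c * x + d)) has_real_derivative deriv f (c * x + d) * c) (at x)" for x
    by (rule DERIV_chain2[OF smooth1_deriv(1)[OF affine]]) (auto intro!: derivative_eq_intros)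
  then have "\<forall>x. ((\<lambda>x. f (c * x + d)) has_real_derivative deriv f (c * x + d) * c) (at x)" ..
  moreover have "smooth1_alg (\<lambda>x. deriv f (c * x + d) * c)"
    by (rule smooth1_alg.mult[OF smooth1_alg.affine smooth1_alg.base[OF smooth1_const]])
      (rule smooth1_deriv(2)[OF affine])
  ultimately show ?case by (intro exI[of _ "\<lambda>x. deriv f (c * x + d) * c"] conjI)
next
  case (add f g)
  then obtain f' g' where *: "\<And>x. (f has_real_derivative f' x) (at x)" "smooth1_alg f'"
    "\<And>x. (g has_real_derivative g' x) (at x)" "smooth1_alg g'" by blast
  then have "((\<lambda>x. f x + g x) has_real_derivative f' x + g' x) (at x)" for x
    by (auto intro!: derivative_eq_intros)
  moreover have "smooth1_alg (\<lambda>x. f' x + g' x)" by (rule smooth1_alg.add[OF *(2) *(4)])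
  ultimately show ?case by (intro exI[of _ "\<lambda>x. f' x + g' x"] conjI) simp_all
next
  case (mult f g)
  then obtain f' g' where *: "\<And>x. (f has_real_derivative f' x) (at x)" "smooth1_alg f'"
    "\<And>x. (g has_real_derivative g' x) (at x)" "smooth1_alg g'" by blast
  have "((\<lambda>x. f x * g x) has_real_derivative (f' x * g x + g' x * f x)) (at x)" for x
    by (rule DERIV_mult[OF *(1) *(3)])
  moreover have "smooth1_alg (\<lambda>x. f' x * g x + g' x * f x)"
    by (rule smooth1_alg.add[OF smooth1_alg.mult[OF *(2) mult.hyps(2)] smooth1_alg.mult[OF *(4) mult.hyps(1)]])
  ultimately show ?case
    by (intro exI[of _ "\<lambda>x. f' x * g x + g' x * f x"] conjI) simp_all
qed

lemma smooth1_alg_smooth1: "smooth1_alg f \<Longrightarrow> smooth1 f"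
proof (coinduction arbitrary: f)
  case (smooth1 f)
  then show ?case using smooth1_alg_deriv by blast
qed

lemma smooth1_mult: "smooth1 f \<Longrightarrow> smooth1 g \<Longrightarrow> smooth1 (\<lambda>x. f x * g x)"
  by (rule smooth1_alg_smooth1[OF smooth1_alg.mult[OF smooth1_alg.base smooth1_alg.base]])

lemma smooth1_affine: "smooth1 f \<Longrightarrow> smooth1 (\<lambda>x. f (c * x + d))"
  by (rule smooth1_alg_smooth1[OF smooth1_alg.affine])

section \<open>A smooth step and its derivative\<close>

definition flat_exp :: "real poly \<Rightarrow> real \<Rightarrow> real" where
  "flat_exp p x = (if x > 0 then poly p (1 / x) * exp (- (1 / x)) else 0)"

text \<open>The free power \<open>k\<close> carries the induction: \<open>pCons a p\<close> splits
  into \<open>a * y ^ k * exp (- y)\<close> and the induction hypothesis at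
  \<open>Suc k\<close>.\<close>

lemma tendsto_poly_exp_neg:
  fixes p :: "real poly"
  shows "((\<lambda>y. y ^ k * (poly p y * exp (- y))) \<longlongrightarrow> 0) at_top"
proof (induction p arbitrary: k)
  case 0
  then show ?case by simp
next
  case (pCons a p)
  have "((\<lambda>y. a * (y ^ k / exp y) + y ^ Suc k * (poly p y * exp (- y))) \<longlongrightarrow> a * 0 + 0) at_top"
    by (intro tendsto_add tendsto_mult tendsto_const tendsto_power_div_exp_0 pCons.IH)
  then show ?case
    by (simp add: algebra_simps exp_minus divide_inverse)
qed

text \<open>With y = 1/x the chain rule produces the factor y^2 and replaces p by p - p'. The family
  is thus closed under differentiation, and smoothness across 0 is one coinduction. At 0 the
  difference quotient is y p(y) exp(-y) with y = 1/h, which tends to 0 from the right.\<close>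

lemma DERIV_flat_exp:
  "(flat_exp p has_real_derivative flat_exp (monom 1 2 * (p - pderiv p)) x) (at x)"
proof (cases x "0::real" rule: linorder_cases)
  case less
  have ev: "\<forall>\<^sub>F y in nhds x. flat_exp p y = 0"
    using eventually_nhds_in_open[of "{..<0}" x] less
    by (auto elim!: eventually_mono simp: flat_exp_def)
  then show ?thesis
    using less by (subst DERIV_cong_ev[OF refl ev refl]) (auto simp: flat_exp_def)
next
  case greater
  have ev: "\<forall>\<^sub>F y in nhds x. flat_exp p y = poly p (1 / y) * exp (- (1 / y))"
    using eventually_nhds_in_open[of "{0<..}" x] greater
    by (auto elim!: eventually_mono simp: flat_exp_def)
  have "((\<lambda>y. poly p (1 / y) * exp (- (1 / y))) has_real_derivative
     poly (pderiv p) (1 / x) * (- (1 / x\<^sup>2)) * exp (- (1 / x))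
       + exp (- (1 / x)) * (1 / x\<^sup>2) * poly p (1 / x)) (at x)"
    using greater
    by (auto intro!: derivative_eq_intros DERIV_chain2[OF poly_DERIV] simp: power2_eq_square)
  also have "poly (pderiv p) (1 / x) * (- (1 / x\<^sup>2)) * exp (- (1 / x))
       + exp (- (1 / x)) * (1 / x\<^sup>2) * poly p (1 / x) = flat_exp (monom 1 2 * (p - pderiv p)) x"
    using greater by (simp add: flat_exp_def poly_monom algebra_simps power_one_over)
  finally show ?thesis
    by (subst DERIV_cong_ev[OF refl ev refl])
next
  case equal
  have r: "((\<lambda>h. flat_exp p h / h) \<longlongrightarrow> 0) (at_right 0)"
  proof -
    have "((\<lambda>y. flat_exp p (inverse y) / inverse y) \<longlongrightarrow> 0) at_top"
    proof (rule Lim_transform_eventually)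
      show "((\<lambda>y. y ^ 1 * (poly p y * exp (- y))) \<longlongrightarrow> 0) at_top"
        by (rule tendsto_poly_exp_neg)
      show "\<forall>\<^sub>F y in at_top. y ^ 1 * (poly p y * exp (- y)) = flat_exp p (inverse y) / inverse y"
        using eventually_gt_at_top[of 0] by eventually_elim (simp add: flat_exp_def divide_inverse)
    qed
    then show ?thesis by (simp add: filterlim_at_right_to_top)
  qed
  have l: "((\<lambda>h. flat_exp p h / h) \<longlongrightarrow> 0) (at_left 0)"
  proof (rule Lim_transform_eventually)
    show "((\<lambda>h::real. 0::real) \<longlongrightarrow> 0) (at_left 0)" by simp
    show "\<forall>\<^sub>F h in at_left 0. 0 = flat_exp p h / h"
      by (auto simp: eventually_at_filter flat_exp_def)
  qed
  have "((\<lambda>h. flat_exp p h / h) \<longlongrightarrow> 0) (at 0)"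
    using l r by (simp add: filterlim_at_split)
  moreover have "flat_exp q 0 = 0" for q by (simp add: flat_exp_def)
  ultimately show ?thesis
    using equal by (simp add: DERIV_def)
qed

lemma smooth1_flat_exp: "smooth1 (flat_exp p)"
proof (coinduction arbitrary: p)
  case smooth1
  then show ?case using DERIV_flat_exp by blast
qed

text \<open>The step is an antiderivative of exp(-1/x) exp(-1/(1-x)), extended by 0 outside (0,1),
  divided by its total increment. The increment is positive by the mean value theorem.\<close>

lemma smooth_step_exists:
  "\<exists>S. smooth1 S \<and> (\<forall>x\<le>0. S x = 0) \<and> (\<forall>x\<ge>1. S x = 1) \<and> (\<forall>x. 0 \<le> deriv S x)"
proof -
  define g where "g x = flat_exp 1 x * flat_exp 1 (- 1 * x + 1)" for x
  have sg: "smooth1 g"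
    unfolding g_def by (intro smooth1_mult smooth1_affine smooth1_flat_exp)
  have g0: "g x = 0" if "x \<le> 0 \<or> x \<ge> 1" for x
    using that by (auto simp: g_def flat_exp_def)
  have gpos: "g x > 0" if "0 < x" "x < 1" for x
    using that by (auto simp: g_def flat_exp_def)
  have gnn: "g x \<ge> 0" for x
    using g0[of x] gpos[of x] by linarith
  have "isCont g x" for x
    using smooth1_deriv(1)[OF sg] DERIV_isCont by blast
  then obtain F where "\<And>x. (F has_vector_derivative g x) (at x)"
    using einterval_antiderivative[of "-\<infinity>" "\<infinity>" g] by auto
  then have F: "(F has_real_derivative g x) (at x)" for x
    by (simp add: has_real_derivative_iff_has_vector_derivative)
  have F0: "F x = F 0" if "x \<le> 0" for x
  proof (rule ccontr)
    assume "F x \<noteq> F 0"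
    then have "x < 0" using that by (cases "x = 0") auto
    then obtain z where "z < 0" "F 0 - F x = (0 - x) * g z"
      using MVT2[of x 0 F g] F by blast
    then show False using g0[of z] \<open>F x \<noteq> F 0\<close> by simp
  qed
  have F1: "F x = F 1" if "x \<ge> 1" for x
  proof (rule ccontr)
    assume "F x \<noteq> F 1"
    then have "x > 1" using that by (cases "x = 1") auto
    then obtain z where "z > 1" "F x - F 1 = (x - 1) * g z"
      using MVT2[of 1 x F g] F by blast
    then show False using g0[of z] \<open>F x \<noteq> F 1\<close> by simp
  qed
  obtain z where z: "0 < z" "z < 1" "F 1 - F 0 = (1 - 0) * g z"
    using MVT2[of 0 1 F g] F by auto
  then have I: "F 1 - F 0 > 0" using gpos[of z] by simp
  define I where "I = F 1 - F 0"
  define S where "S x = (F x - F 0) / I" for x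
  have dS: "(S has_real_derivative g x * (1 / I)) (at x)" for x
    unfolding S_def using F I by (auto intro!: derivative_eq_intros simp: I_def)
  have "smooth1 (\<lambda>x. g x * (1 / I))" by (intro smooth1_mult sg smooth1_const)
  then have "smooth1 S" using smooth1.intros[OF dS] by simp
  moreover have "deriv S x = g x * (1 / I)" for x using dS by (rule DERIV_imp_deriv)
  then have "0 \<le> deriv S x" for x using I gnn[of x] by (simp add: I_def)
  moreover have "S x = 0" if "x \<le> 0" for x unfolding S_def F0[OF that] by simp
  moreover have "S x = 1" if "x \<ge> 1" for x
    unfolding S_def F1[OF that] using I by (simp add: I_def)
  ultimately show ?thesis by blast
qed

definition smooth_step :: "real \<Rightarrow> real" where
  "smooth_step = (SOME S. smooth1 S \<and> (\<forall>x\<le>0. S x = 0) \<and> (\<forall>x\<ge>1. S x = 1) \<and> (\<forall>x. 0 \<le> deriv S x))"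

definition bump :: "real \<Rightarrow> real" where
  "bump = deriv smooth_step"

lemma smooth1_step: "smooth1 smooth_step"
  and smooth_step_0: "x \<le> 0 \<Longrightarrow> smooth_step x = 0"
  and smooth_step_1: "x \<ge> 1 \<Longrightarrow> smooth_step x = 1"
  and bump_nonneg: "0 \<le> bump x"
  using someI_ex[OF smooth_step_exists] by (auto simp: smooth_step_def bump_def)

lemma DERIV_smooth_step: "(smooth_step has_real_derivative bump x) (at x)"
  using smooth1_deriv[OF smooth1_step] by (simp add: bump_def)

lemma smooth1_bump: "smooth1 bump"
  using smooth1_deriv[OF smooth1_step] by (simp add: bump_def)

text \<open>At the endpoints 0 and 1 the step is locally constant on one side only; there
  \<open>bump\<close> vanishes as a limit of zeros, by continuity.\<close>

lemma bump_0: "x \<le> 0 \<Longrightarrow> bump x = 0" and bump_1: "x \<ge> 1 \<Longrightarrow> bump x = 0"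
proof -
  have c: "isCont bump x" for x
    using smooth1_deriv(1)[OF smooth1_bump] DERIV_isCont by blast
  have l: "bump x = 0" if "x < 0" for x
  proof -
    have ev: "\<forall>\<^sub>F y in nhds x. smooth_step y = 0"
      using eventually_nhds_in_open[of "{..<0}" x] that
      by (auto elim!: eventually_mono simp: smooth_step_0)
    have "(smooth_step has_real_derivative 0) (at x)"
      by (subst DERIV_cong_ev[OF refl ev refl]) simp
    then show ?thesis unfolding bump_def by (rule DERIV_imp_deriv)
  qed
  have r: "bump x = 0" if "x > 1" for x
  proof -
    have ev: "\<forall>\<^sub>F y in nhds x. smooth_step y = 1"
      using eventually_nhds_in_open[of "{1<..}" x] that
      by (auto elim!: eventually_mono simp: smooth_step_1)
    have "(smooth_step has_real_derivative 0) (at x)"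
      by (subst DERIV_cong_ev[OF refl ev refl]) simp
    then show ?thesis unfolding bump_def by (rule DERIV_imp_deriv)
  qed
  have "(bump \<longlongrightarrow> bump 0) (at_left 0)"
    using c[of 0] by (simp add: isCont_def filterlim_at_split)
  moreover have "(bump \<longlongrightarrow> 0) (at_left 0)"
    by (rule tendsto_eventually) (auto simp: eventually_at_filter l)
  ultimately have b0: "bump 0 = 0"
    using tendsto_unique trivial_limit_at_left_real by blast
  have "(bump \<longlongrightarrow> bump 1) (at_right 1)"
    using c[of 1] by (simp add: isCont_def filterlim_at_split)
  moreover have "(bump \<longlongrightarrow> 0) (at_right 1)"
    by (rule tendsto_eventually) (auto simp: eventually_at_filter r)
  ultimately have b1: "bump 1 = 0"
    using tendsto_unique trivial_limit_at_right_real by blast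
  show "x \<le> 0 \<Longrightarrow> bump x = 0" using l b0 by force
  show "x \<ge> 1 \<Longrightarrow> bump x = 0" using r b1 by force
qed

lemma smooth_step_mono: "x \<le> y \<Longrightarrow> smooth_step x \<le> smooth_step y"
  by (rule DERIV_nonneg_imp_nondecreasing) (use DERIV_smooth_step bump_nonneg in auto)

lemma smooth_step_bounds: "0 \<le> smooth_step x" "smooth_step x \<le> 1"
  using smooth_step_mono[of x "max 1 x"] smooth_step_mono[of "min 0 x" x]
  by (auto simp: smooth_step_0 smooth_step_1)

lemma continuous_on_smooth1: "smooth1 f \<Longrightarrow> continuous_on S f"
  using smooth1_deriv(1) DERIV_continuous_on has_field_derivative_at_within by metis

lemma borel_measurable_smooth1: "smooth1 f \<Longrightarrow> f \<in> borel_measurable borel"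
  by (intro borel_measurable_continuous_onI continuous_on_smooth1)

lemma has_bochner_integral_bump: "has_bochner_integral lborel bump 1"
proof -
  have "has_bochner_integral lborel (\<lambda>x. bump x * indicator {0..1} x) (smooth_step 1 - smooth_step 0)"
    by (rule has_bochner_integral_FTC_Icc_nonneg)
      (auto intro: DERIV_smooth_step bump_nonneg continuous_on_smooth1 smooth1_bump
         borel_measurable_smooth1 has_field_derivative_at_within DERIV_isCont smooth1_deriv)
  moreover have "(\<lambda>x. bump x * indicator {0..1} x) = bump"
    
  proof
    fix x show "bump x * indicator {0..1} x = bump x"
      using bump_0[of x] bump_1[of x] by (cases "x \<in> {0..1}") auto
  qed
  ultimately show ?thesis by (simp add: smooth_step_0 smooth_step_1)
qed

section \<open>Smooth functions of two variables\<close>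

coinductive smoothC :: "(real \<Rightarrow> real \<Rightarrow> real) \<Rightarrow> bool" where
  "(\<And>z. (\<lambda>(t, x). \<phi> t x) differentiable at z) \<Longrightarrow> smoothC (pd_t \<phi>) \<Longrightarrow> smoothC (pd_x \<phi>) \<Longrightarrow> smoothC \<phi>"

lemma smoothC_D:
  assumes "smoothC \<phi>"
  shows "(\<lambda>(t, x). \<phi> t x) differentiable at z" "smoothC (pd_t \<phi>)" "smoothC (pd_x \<phi>)"
  using assms by (auto elim: smoothC.cases)

lemma smoothC_imp_smooth2:
  assumes "smoothC \<phi>" shows "smooth2 \<phi>"
proof -
  have x: "smoothC ((pd_x ^^ j) \<phi>)" for j
    by (induction j) (auto intro: assms smoothC_D)
  have "smoothC ((pd_t ^^ i) ((pd_x ^^ j) \<phi>))" for i j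
    by (induction i) (auto intro: x smoothC_D)
  then show ?thesis
    by (auto simp: smooth2_def differentiable_on_def intro: differentiable_at_withinI smoothC_D(1))
qed

lemma differentiable_imp_pd:
  assumes "\<And>z. (\<lambda>(t, x). \<phi> t x) differentiable at z"
  shows "((\<lambda>s. \<phi> s x) has_real_derivative pd_t \<phi> t x) (at t)"
    and "(\<phi> t has_real_derivative pd_x \<phi> t x) (at x)"
proof -
  have "((\<lambda>(t, x). \<phi> t x) \<circ> (\<lambda>s. (s, x))) differentiable at t"
    by (intro differentiable_chain_at assms) (auto intro!: derivative_intros simp: differentiable_def)
  then show "((\<lambda>s. \<phi> s x) has_real_derivative pd_t \<phi> t x) (at t)"
    by (simp add: pd_t_def DERIV_deriv_iff_real_differentiable o_def)
  have "((\<lambda>(t, x). \<phi> t x) \<circ> (\<lambda>y. (t, y))) differentiable at x"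
    by (intro differentiable_chain_at assms) (auto intro!: derivative_intros simp: differentiable_def)
  then show "(\<phi> t has_real_derivative pd_x \<phi> t x) (at x)"
    by (simp add: pd_x_def DERIV_deriv_iff_real_differentiable o_def)
qed

lemmas smoothC_pd = differentiable_imp_pd[OF smoothC_D(1)]

text \<open>The factor \<open>c\<close> absorbs the inner derivatives \<open>a\<close> and
  \<open>b\<close>, so that both partial derivatives have the same form again and the coinduction
  closes.\<close>

lemma smoothC_comp_scale:
  assumes "smooth1 f" shows "smoothC (\<lambda>t x. c * f (a * t + b * x + d))"
  using assms
proof (coinduction arbitrary: f c)
  case (smoothC f c)
  have d: "(f has_real_derivative deriv f x) (at x)" for x
    by (rule smooth1_deriv(1)[OF smoothC])
  have t: "((\<lambda>t. c * f (a * t + b * x + d)) has_real_derivative (c * a) * deriv f (a * t + b * x + d)) (at t)" for t x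
    by (auto intro!: derivative_eq_intros DERIV_chain2[OF d])
  have x: "((\<lambda>x. c * f (a * t + b * x + d)) has_real_derivative (c * b) * deriv f (a * t + b * x + d)) (at x)" for t x
    by (auto intro!: derivative_eq_intros DERIV_chain2[OF d])
  have pt: "pd_t (\<lambda>t x. c * f (a * t + b * x + d)) = (\<lambda>t x. (c * a) * deriv f (a * t + b * x + d))"
    unfolding pd_t_def using t by (intro ext DERIV_imp_deriv) auto
  have px: "pd_x (\<lambda>t x. c * f (a * t + b * x + d)) = (\<lambda>t x. (c * b) * deriv f (a * t + b * x + d))"
    unfolding pd_x_def using x by (intro ext DERIV_imp_deriv) auto
  have df: "f differentiable at y" for y
    using d real_differentiable_def by blast
  have "(\<lambda>z. c * (f \<circ> (\<lambda>z. a * fst z + b * snd z + d)) z) differentiable at z" for z :: "real \<times> real"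
    by (intro differentiable_mult differentiable_const differentiable_chain_at df)
       (intro differentiable_add differentiable_mult differentiable_const
          bounded_linear_imp_differentiable bounded_linear_fst bounded_linear_snd)
  then have "(\<lambda>(t, x). c * f (a * t + b * x + d)) differentiable at z" for z
    by (simp only: o_def case_prod_unfold)
  then show ?case
    using pt px smooth1_deriv(2)[OF smoothC] by blast
qed

lemma smoothC_comp: "smooth1 f \<Longrightarrow> smoothC (\<lambda>t x. f (a * t + b * x + d))"
  using smoothC_comp_scale[of f 1] by simp

lemma smoothC_fst: "smooth1 f \<Longrightarrow> smoothC (\<lambda>t x. f t)"
  using smoothC_comp[of f 1 0 0] by simp

lemma smoothC_snd: "smooth1 f \<Longrightarrow> smoothC (\<lambda>t x. f x)"
  using smoothC_comp[of f 0 1 0] by simp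

text \<open>The same device as \<open>smooth1_alg\<close>: the generated algebra is stable under
  both partial derivatives, whereas the set of products is not.\<close>

inductive smoothC_alg :: "(real \<Rightarrow> real \<Rightarrow> real) \<Rightarrow> bool" where
  base: "smoothC f \<Longrightarrow> smoothC_alg f"
| add: "smoothC_alg f \<Longrightarrow> smoothC_alg g \<Longrightarrow> smoothC_alg (\<lambda>t x. f t x + g t x)"
| mult: "smoothC_alg f \<Longrightarrow> smoothC_alg g \<Longrightarrow> smoothC_alg (\<lambda>t x. f t x * g t x)"

lemma pd_add:
  assumes "\<And>z. (\<lambda>(t, x). f t x) differentiable at z" "\<And>z. (\<lambda>(t, x). g t x) differentiable at z"
  shows "pd_t (\<lambda>t x. f t x + g t x) = (\<lambda>t x. pd_t f t x + pd_t g t x)"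
    and "pd_x (\<lambda>t x. f t x + g t x) = (\<lambda>t x. pd_x f t x + pd_x g t x)"
  unfolding pd_t_def[of "\<lambda>t x. f t x + g t x"] pd_x_def[of "\<lambda>t x. f t x + g t x"]
  by (intro ext DERIV_imp_deriv DERIV_add differentiable_imp_pd assms)+

lemma pd_mult:
  assumes "\<And>z. (\<lambda>(t, x). f t x) differentiable at z" "\<And>z. (\<lambda>(t, x). g t x) differentiable at z"
  shows "pd_t (\<lambda>t x. f t x * g t x) = (\<lambda>t x. pd_t f t x * g t x + pd_t g t x * f t x)"
    and "pd_x (\<lambda>t x. f t x * g t x) = (\<lambda>t x. pd_x f t x * g t x + pd_x g t x * f t x)"
  unfolding pd_t_def[of "\<lambda>t x. f t x * g t x"] pd_x_def[of "\<lambda>t x. f t x * g t x"]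
  by (intro ext DERIV_imp_deriv DERIV_mult differentiable_imp_pd assms)+

lemma smoothC_alg_D:
  "smoothC_alg \<phi> \<Longrightarrow> (\<forall>z. (\<lambda>(t, x). \<phi> t x) differentiable at z) \<and> smoothC_alg (pd_t \<phi>) \<and> smoothC_alg (pd_x \<phi>)"
proof (induction rule: smoothC_alg.induct)
  case (base f)
  then show ?case using smoothC_D smoothC_alg.base by blast
next
  case (add f g)
  then have "(\<lambda>z. (case z of (t, x) \<Rightarrow> f t x) + (case z of (t, x) \<Rightarrow> g t x)) differentiable at z" for z
    using add.IH by (intro differentiable_add) blast+
  moreover have "(\<lambda>z. (case z of (t, x) \<Rightarrow> f t x) + (case z of (t, x) \<Rightarrow> g t x)) = (\<lambda>(t, x). f t x + g t x)"
    by auto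
  ultimately show ?case
    using add pd_add[of f g] by (auto intro: smoothC_alg.intros)
next
  case (mult f g)
  then have "(\<lambda>z. (case z of (t, x) \<Rightarrow> f t x) * (case z of (t, x) \<Rightarrow> g t x)) differentiable at z" for z
    using mult.IH by (intro differentiable_mult) blast+
  moreover have "(\<lambda>z. (case z of (t, x) \<Rightarrow> f t x) * (case z of (t, x) \<Rightarrow> g t x)) = (\<lambda>(t, x). f t x * g t x)"
    by auto
  ultimately show ?case
    using mult pd_mult[of f g] by (auto intro!: smoothC_alg.intros(2,3))
qed

lemma smoothC_alg_smoothC: "smoothC_alg f \<Longrightarrow> smoothC f"
proof (coinduction arbitrary: f)
  case (smoothC f)
  then show ?case using smoothC_alg_D by blast
qed

lemma smoothC_mult: "smoothC f \<Longrightarrow> smoothC g \<Longrightarrow> smoothC (\<lambda>t x. f t x * g t x)"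
  by (rule smoothC_alg_smoothC[OF smoothC_alg.mult[OF smoothC_alg.base smoothC_alg.base]])

lemma continuous_on_smoothC:
  assumes "smoothC \<phi>" shows "continuous_on S (\<lambda>z. \<phi> (fst z) (snd z))"
proof -
  have "continuous_on UNIV (\<lambda>(t, x). \<phi> t x)"
    using smoothC_D(1)[OF assms] differentiable_imp_continuous_within
    by (metis continuous_at_imp_continuous_on)
  then show ?thesis
    by (auto simp: case_prod_beta intro: continuous_on_subset)
qed

lemma borel_measurable_smoothC:
  assumes "smoothC \<phi>" shows "(\<lambda>z. \<phi> (fst z) (snd z)) \<in> borel_measurable borel"
  by (intro borel_measurable_continuous_onI continuous_on_smoothC assms)

lemma pd_zero_outside:
  assumes "\<And>t x. (t, x) \<notin> {a..b} \<times> {c..d} \<Longrightarrow> \<phi> t x = 0"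
    and "(t, x) \<notin> {a..b} \<times> {c..d}"
  shows "pd_t \<phi> t x = 0" "pd_x \<phi> t x = 0"
proof -
  have "\<forall>\<^sub>F s in nhds t. \<phi> s x = 0"
  proof (cases "x \<in> {c..d}")
    case True
    then have "t \<in> - {a..b}" using assms by auto
    then show ?thesis
      by (intro eventually_mono[OF eventually_nhds_in_open[of "- {a..b}" t]])
        (auto intro!: assms(1))
  next
    case False
    then show ?thesis using assms(1) by auto
  qed
  then have "((\<lambda>s. \<phi> s x) has_real_derivative 0) (at t)"
    by (subst DERIV_cong_ev[OF refl _ refl, where g="\<lambda>s. 0"]) auto
  then show "pd_t \<phi> t x = 0" by (simp add: pd_t_def DERIV_imp_deriv)
  have "\<forall>\<^sub>F y in nhds x. \<phi> t y = 0"
  proof (cases "t \<in> {a..b}")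
    case True
    then have "x \<in> - {c..d}" using assms by auto
    then show ?thesis
      by (intro eventually_mono[OF eventually_nhds_in_open[of "- {c..d}" x]])
        (auto intro!: assms(1))
  next
    case False
    then show ?thesis using assms(1) by auto
  qed
  then have "(\<phi> t has_real_derivative 0) (at x)"
    by (subst DERIV_cong_ev[OF refl _ refl, where g="\<lambda>s. 0"]) auto
  then show "pd_x \<phi> t x = 0" by (simp add: pd_x_def DERIV_imp_deriv)
qed

lemma smoothC_bounded:
  assumes "smoothC \<phi>" and z: "\<And>t x. (t, x) \<notin> {a..b} \<times> {c..d} \<Longrightarrow> \<phi> t x = 0"
  shows "\<exists>C\<ge>0. \<forall>t x. \<bar>\<phi> t x\<bar> \<le> C"
proof -
  have "compact ((\<lambda>z. \<phi> (fst z) (snd z)) ` ({a..b} \<times> {c..d}))"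
    by (intro compact_continuous_image continuous_on_smoothC assms compact_Times compact_Icc)
  then obtain C where C: "\<And>z. z \<in> {a..b} \<times> {c..d} \<Longrightarrow> \<bar>\<phi> (fst z) (snd z)\<bar> \<le> C"
    by (force dest: compact_imp_bounded simp: bounded_iff)
  have "\<bar>\<phi> t x\<bar> \<le> max C 0" for t x
    using C[of "(t, x)"] z[of t x] by (cases "(t, x) \<in> {a..b} \<times> {c..d}") (auto simp: max_def)
  then show ?thesis by (intro exI[of _ "max C 0"]) auto
qed

lemma test_functionI:
  assumes "smoothC \<phi>" "\<And>t x. (t, x) \<notin> {a..b} \<times> {c..d} \<Longrightarrow> \<phi> t x = 0" "b < T"
    and "\<And>t x. 0 \<le> t \<Longrightarrow> 0 \<le> \<phi> t x"
  shows "test_function T \<phi>"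
  unfolding test_function_def
proof (intro conjI)
  have "compact ({a..b} \<times> {c..d})" "{a..b} \<times> {c..d} \<subseteq> {..<T} \<times> (UNIV :: real set)"
    using assms(3) by (auto intro: compact_Times)
  then show "\<exists>K. compact K \<and> K \<subseteq> {..<T} \<times> UNIV \<and> (\<forall>t x. (t, x) \<notin> K \<longrightarrow> \<phi> t x = 0)"
    using assms(2) by blast
  show "smooth2 \<phi>" by (rule smoothC_imp_smooth2[OF assms(1)])
  show "\<forall>t\<ge>0. \<forall>x. 0 \<le> \<phi> t x" using assms(4) by simp
qed

section \<open>Integration on Euclidean spaces\<close>

lemma lipschitz_half_has_density:
  fixes g :: "real \<Rightarrow> real"
  assumes lip: "\<And>x y. \<bar>g x - g y\<bar> \<le> \<bar>x - y\<bar> / 2"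
  shows "\<exists>d. \<forall>x y. x \<le> y \<longrightarrow> (d has_integral (g y - g x)) {x..y}"
proof -
  \<comment> \<open>The constant 1/2 makes \<open>F 1\<close> and \<open>F (-1)\<close> both
    nondecreasing, and their sum is the identity. The two interval measures therefore add up to
    Lebesgue measure, so each is absolutely continuous; the Radon-Nikodym density of the first,
    minus 1/2, is a density for \<open>g\<close>.\<close>
  define F where "F s x = x / 2 + s * g x" for s x
  have mono: "F s x \<le> F s y" if "x \<le> y" "s = 1 \<or> s = -1" for s x y
    using lip[of x y] that by (auto simp: F_def abs_if split: if_splits)
  have "continuous_on UNIV g"
    unfolding continuous_on_iff dist_real_def
  proof (intro ballI allI impI)
    fix x e :: real assume "e > 0"
    moreover have "\<bar>g x' - g x\<bar> < e" if "\<bar>x' - x\<bar> < e" for x'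
    proof -
      have "\<bar>x' - x\<bar> / 2 \<le> \<bar>x' - x\<bar>" by simp
      with lip[of x' x] that show ?thesis by (meson le_less_trans)
    qed
    ultimately show "\<exists>d>0. \<forall>x'\<in>UNIV. \<bar>x' - x\<bar> < d \<longrightarrow> \<bar>g x' - g x\<bar> < e"
      by blast
  qed
  then have cont: "continuous_on UNIV (F s)" for s
    unfolding F_def by (intro continuous_intros) simp_all
  have rc: "continuous (at_right a) (F s)" for a s
    using cont[of s] continuous_on_eq_continuous_at[of UNIV "F s"] continuous_at_imp_continuous_within
    by blast
  define \<mu> where "\<mu> s = interval_measure (F s)" for s
  have Icc: "emeasure (\<mu> s) {x..y} = ennreal (F s y - F s x)" if "x \<le> y" "s = 1 \<or> s = -1" for s x y
    unfolding \<mu>_def using that by (intro emeasure_interval_measure_Icc mono cont) auto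
  have sets: "sets (\<mu> s) = sets borel" for s by (simp add: \<mu>_def)
  have Ioo: "emeasure (\<mu> s) {x<..<y} = ennreal (F s y - F s x)" if "x \<le> y" "s = 1 \<or> s = -1" for s x y
  proof -
    have pt: "{z} \<in> null_sets (\<mu> s)" for z
      using Icc[of z z s] that by (auto simp: null_sets_def sets)
    have "{x, y} \<in> null_sets (\<mu> s)"
      using null_sets.Un[OF pt[of x] pt[of y]] by (simp add: insert_commute)
    then have "emeasure (\<mu> s) ({x<..<y} \<union> {x, y}) = emeasure (\<mu> s) {x<..<y}"
      by (intro emeasure_Un_null_set) (auto simp: sets)
    moreover have "{x<..<y} \<union> {x, y} = {x..y}" using that by auto
    ultimately show ?thesis using Icc[OF that] by simp
  qed
  define \<nu> where "\<nu> = measure_of UNIV (sets borel) (\<lambda>A. emeasure (\<mu> 1) A + emeasure (\<mu> (-1)) A)"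
  have em: "emeasure \<nu> A = emeasure (\<mu> 1) A + emeasure (\<mu> (-1)) A" if "A \<in> sets borel" for A
  proof (rule emeasure_measure_of[OF \<nu>_def])
    show "positive (sets \<nu>) (\<lambda>A. emeasure (\<mu> 1) A + emeasure (\<mu> (-1)) A)"
      by (auto simp: positive_def)
    have sn: "sets \<nu> = sets borel" by (simp add: \<nu>_def sets.sigma_sets_eq[of borel, simplified])
    show "countably_additive (sets \<nu>) (\<lambda>A. emeasure (\<mu> 1) A + emeasure (\<mu> (-1)) A)"
      unfolding sn
    proof (rule countably_additiveI)
      fix A :: "nat \<Rightarrow> real set" assume A: "range A \<subseteq> sets borel" "disjoint_family A"
      have "(\<Sum>i. emeasure (\<mu> s) (A i)) = emeasure (\<mu> s) (\<Union>i. A i)" for s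
        using A by (intro suminf_emeasure) (auto simp: sets)
      then show "(\<Sum>i. emeasure (\<mu> 1) (A i) + emeasure (\<mu> (-1)) (A i)) =
          emeasure (\<mu> 1) (\<Union>i. A i) + emeasure (\<mu> (-1)) (\<Union>i. A i)"
        by (subst suminf_add[symmetric]) auto
    qed
  qed (use that in \<open>auto simp: \<nu>_def sets.sigma_sets_eq[of borel, simplified]\<close>)
  have "lborel = \<nu>"
  proof (rule lborel_eqI)
    fix l u :: real assume "\<And>b. b \<in> Basis \<Longrightarrow> l \<bullet> b \<le> u \<bullet> b"
    then have lu: "l \<le> u" by simp
    then have "emeasure \<nu> {l<..<u} = ennreal (F 1 u - F 1 l) + ennreal (F (-1) u - F (-1) l)"
      by (simp add: em Ioo)
    also have "\<dots> = ennreal (u - l)"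
      using lu mono[OF lu, of 1] mono[OF lu, of "-1"]
      by (subst ennreal_plus[symmetric]) (auto simp: F_def)
    finally show "emeasure \<nu> (box l u) = (\<Prod>b\<in>Basis. (u - l) \<bullet> b)"
      by (simp add: box_real)
  qed (simp add: \<nu>_def sets.sigma_sets_eq[of borel, simplified])
  then have "absolutely_continuous lborel (\<mu> 1)"
    using em by (auto simp: absolutely_continuous_def null_sets_def sets)
  then obtain D where D[measurable]: "D \<in> borel_measurable lborel" and dD: "density lborel D = \<mu> 1"
    using sigma_finite_measure.Radon_Nikodym[OF sigma_finite_lborel, of "\<mu> 1"] by (auto simp: sets)
  define d where "d x = enn2real (D x)" for x
  have d: "(d has_integral (F 1 y - F 1 x)) {x..y}" if "x \<le> y" for x y
  proof -
    have I: "(\<integral>\<^sup>+z. D z * indicator {x..y} z \<partial>lborel) = ennreal (F 1 y - F 1 x)"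
      using Icc[OF that, of 1] by (simp add: dD[symmetric] emeasure_density)
    then have "AE z in lborel. D z * indicator {x..y} z \<noteq> \<infinity>"
      by (intro nn_integral_PInf_AE) auto
    then have "AE z in lborel. ennreal (d z * indicator {x..y} z) = D z * indicator {x..y} z"
      by eventually_elim (auto simp: d_def indicator_def ennreal_enn2real_if)
    then have "(\<integral>\<^sup>+z. ennreal (d z * indicator {x..y} z) \<partial>lborel) = ennreal (F 1 y - F 1 x)"
      by (subst I[symmetric]) (intro nn_integral_cong_AE)
    then have "((\<lambda>z. d z * indicator {x..y} z) has_integral (F 1 y - F 1 x)) UNIV"
      using mono[OF that, of 1] by (intro nn_integral_has_integral) (auto simp: d_def)
    moreover have "(\<lambda>z. d z * indicator {x..y} z) = (\<lambda>z. if z \<in> {x..y} then d z else 0)"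
      by (auto simp: indicator_def)
    ultimately show ?thesis by (simp only: has_integral_restrict_UNIV)
  qed
  have "((\<lambda>z. d z - 1 / 2) has_integral (g y - g x)) {x..y}" if "x \<le> y" for x y
  proof -
    have "((\<lambda>z. d z - 1 / 2) has_integral (F 1 y - F 1 x - (y - x) *\<^sub>R (1 / 2))) {x..y}"
      using has_integral_const_real[of "1/2::real" x y] that
      by (intro has_integral_diff d) auto
    moreover have "F 1 y - F 1 x - (y - x) *\<^sub>R (1 / 2) = g y - g x"
      by (simp add: F_def field_simps)
    ultimately show ?thesis by (simp only:)
  qed
  then show ?thesis by blast
qed

text \<open>Lebesgue differentiation over the intervals from x to x + h gives the right derivative
  almost everywhere. Applied to the reflected function \<open>\<lambda>x. d (- x)\<close> it gives
  the left derivative.\<close>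

lemma indefinite_integral_has_derivative:
  fixes g d :: "real \<Rightarrow> real"
  assumes d: "\<And>x y. x \<le> y \<Longrightarrow> (d has_integral (g y - g x)) {x..y}"
  shows "\<exists>N. negligible N \<and> (\<forall>x. x \<notin> N \<longrightarrow> (g has_real_derivative d x) (at x))"
proof -
  have i1: "d integrable_on cbox a b" for a b
    using d[of a b] by (cases "a \<le> b") (auto intro: has_integral_integrable)
  have refl: "((\<lambda>x. d (- x)) has_integral (g (- x) - g (- y))) {x..y}" if "x \<le> y" for x y
    using d[of "-y" "-x"] that has_integral_reflect_real[of d "g (- x) - g (- y)" "-x" "-y"] by simp
  have i2: "(\<lambda>x. d (- x)) integrable_on cbox a b" for a b
    using refl[of a b] by (cases "a \<le> b") (auto intro: has_integral_integrable)
  obtain N where N: "negligible N" and R: "\<And>x e. \<lbrakk>x \<notin> N; 0 < e\<rbrakk> \<Longrightarrow>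
     \<exists>\<delta>>0. \<forall>h. 0 < h \<and> h < \<delta> \<longrightarrow> norm (integral (cbox x (x + h *\<^sub>R One)) d /\<^sub>R h ^ DIM(real) - d x) < e"
    using integrable_ccontinuous_explicit[OF i1] by blast
  obtain N' where N': "negligible N'" and L: "\<And>x e. \<lbrakk>x \<notin> N'; 0 < e\<rbrakk> \<Longrightarrow>
     \<exists>\<delta>>0. \<forall>h. 0 < h \<and> h < \<delta> \<longrightarrow>
        norm (integral (cbox x (x + h *\<^sub>R One)) (\<lambda>x. d (- x)) /\<^sub>R h ^ DIM(real) - d (- x)) < e"
    using integrable_ccontinuous_explicit[OF i2] by blast
  have "negligible (uminus ` N')"
    using N' by (intro negligible_differentiable_image_negligible)
      (auto intro!: derivative_intros simp: differentiable_on_def)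
  moreover have "(g has_real_derivative d x) (at x)" if x: "x \<notin> N \<union> uminus ` N'" for x
    unfolding DERIV_def
  proof (rule LIM_I)
    fix e :: real assume e: "0 < e"
    obtain \<delta>1 where \<delta>1: "\<delta>1 > 0" "\<And>h. 0 < h \<Longrightarrow> h < \<delta>1 \<Longrightarrow> \<bar>(g (x + h) - g x) / h - d x\<bar> < e"
    proof -
      obtain \<delta> where \<delta>: "\<delta> > 0" "\<And>h. 0 < h \<and> h < \<delta> \<Longrightarrow>
        norm (integral (cbox x (x + h *\<^sub>R One)) d /\<^sub>R h ^ DIM(real) - d x) < e"
        using R[of x e] x e by blast
      have "integral {x..x + h} d = g (x + h) - g x" if "h > 0" for h
        using d[of x "x + h"] that by (intro integral_unique) simp
      with \<delta> that show ?thesis by (force simp: divide_inverse mult.commute)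
    qed
    obtain \<delta>2 where \<delta>2: "\<delta>2 > 0" "\<And>h. 0 < h \<Longrightarrow> h < \<delta>2 \<Longrightarrow> \<bar>(g x - g (x - h)) / h - d x\<bar> < e"
    proof -
      have "- x \<notin> N'" using x by force
      then obtain \<delta> where \<delta>: "\<delta> > 0" "\<And>h. 0 < h \<and> h < \<delta> \<Longrightarrow>
        norm (integral (cbox (- x) (- x + h *\<^sub>R One)) (\<lambda>x. d (- x)) /\<^sub>R h ^ DIM(real) - d (- (- x))) < e"
        using L[of "-x" e] e by blast
      have "integral {- x..- x + h} (\<lambda>x. d (- x)) = g x - g (x - h)" if "h > 0" for h
        using refl[of "- x" "- x + h"] that by (intro integral_unique) (simp add: add.commute)
      with \<delta> that show ?thesis by (force simp: divide_inverse mult.commute)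
    qed
    show "\<exists>s>0. \<forall>h. h \<noteq> 0 \<and> norm (h - 0) < s \<longrightarrow> norm ((g (x + h) - g x) / h - d x) < e"
    proof (intro exI[of _ "min \<delta>1 \<delta>2"] conjI allI impI)
      fix h :: real assume h: "h \<noteq> 0 \<and> norm (h - 0) < min \<delta>1 \<delta>2"
      show "norm ((g (x + h) - g x) / h - d x) < e"
      proof (cases "h > 0")
        case True
        then show ?thesis using \<delta>1(2)[of h] h by simp
      next
        case False
        then have "\<bar>(g x - g (x - (- h))) / (- h) - d x\<bar> < e" using \<delta>2(2)[of "- h"] h by auto
        moreover have "(g x - g (x - (- h))) / (- h) = (g (x + h) - g x) / h"
          using h by (simp add: field_simps)
        ultimately show ?thesis by simp
      qed
    qed (use \<delta>1 \<delta>2 in auto)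
  qed
  ultimately show ?thesis
    using N by (intro exI[of _ "N \<union> uminus ` N'"]) (simp add: negligible_Un)
qed

text \<open>This is why a speed that counts only existing derivatives controls the flux: the density
  of a Lipschitz function agrees with its derivative off a null set, so a bound at the points of
  differentiability bounds the density and hence the increment.\<close>

lemma lipschitz_increment_bound_by_derivative:
  fixes f :: "real \<Rightarrow> real"
  assumes ab: "a \<le> b" and lip: "\<And>x y. x \<in> {a..b} \<Longrightarrow> y \<in> {a..b} \<Longrightarrow> \<bar>f x - f y\<bar> \<le> L * \<bar>x - y\<bar>"
    and der: "\<And>w d. w \<in> {a..b} \<Longrightarrow> (f has_real_derivative d) (at w) \<Longrightarrow> \<bar>d\<bar> \<le> M"
    and M: "0 \<le> M"
  shows "\<bar>f b - f a\<bar> \<le> M * (b - a)"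
proof -
  \<comment> \<open>Division by \<open>K\<close> produces the Lipschitz constant 1/2 demanded by the
    density lemma; \<open>max\<close> and \<open>+ 1\<close> keep \<open>K\<close> positive whatever
    the sign of \<open>L\<close>. Clamping the argument to [a,b] extends the function to the whole
    line without increasing the constant.\<close>
  define K where "K = 2 * (max L 0 + 1)"
  have K: "K > 0" by (simp add: K_def)
  define g where "g x = f (max a (min b x)) / K" for x
  have cl: "max a (min b x) \<in> {a..b}" for x using ab by auto
  have "\<bar>g x - g y\<bar> \<le> \<bar>x - y\<bar> / 2" for x y
  proof -
    let ?x = "max a (min b x)" and ?y = "max a (min b y)"
    have "\<bar>f ?x - f ?y\<bar> \<le> L * \<bar>?x - ?y\<bar>" by (rule lip[OF cl cl])
    also have "\<dots> \<le> (max L 0 + 1) * \<bar>x - y\<bar>" by (intro mult_mono) auto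
    finally have "\<bar>f ?x - f ?y\<bar> \<le> (max L 0 + 1) * \<bar>x - y\<bar>" .
    moreover have "\<bar>g x - g y\<bar> = \<bar>f ?x - f ?y\<bar> / K"
      using K by (simp add: g_def abs_divide flip: diff_divide_distrib)
    moreover have "(max L 0 + 1) * \<bar>x - y\<bar> / K = \<bar>x - y\<bar> / 2"
      using K by (simp add: K_def divide_simps)
    moreover have "\<bar>f ?x - f ?y\<bar> / K \<le> (max L 0 + 1) * \<bar>x - y\<bar> / K"
      using K calculation(1) by (intro divide_right_mono) auto
    ultimately show ?thesis by linarith
  qed
  then obtain d where d: "\<And>x y. x \<le> y \<Longrightarrow> (d has_integral (g y - g x)) {x..y}"
    using lipschitz_half_has_density[of g] by metis
  then obtain N where N: "negligible N" "\<And>x. x \<notin> N \<Longrightarrow> (g has_real_derivative d x) (at x)"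
    using indefinite_integral_has_derivative[of d g] by metis
  have bd: "\<bar>d x\<bar> \<le> M / K" if x: "x \<in> {a..b} - (N \<union> {a, b})" for x
  proof -
    have x': "x \<notin> N" "x \<in> {a<..<b}" using x by auto
    have ev: "\<forall>\<^sub>F y in nhds x. K * g y = f y"
    proof (rule eventually_mono[OF eventually_nhds_in_open[of "{a<..<b}" x]])
      fix y assume "y \<in> {a<..<b}"
      then have "max a (min b y) = y" by simp
      then show "K * g y = f y" using K by (simp add: g_def)
    qed (use x' in auto)
    have "((\<lambda>y. K * g y) has_real_derivative K * d x) (at x)"
      by (rule DERIV_cmult[OF N(2)[OF x'(1)]])
    then have "(f has_real_derivative K * d x) (at x)"
      by (subst (asm) DERIV_cong_ev[OF refl ev refl])
    then have "\<bar>K * d x\<bar> \<le> M" using der x by auto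
    then show ?thesis using K by (simp add: abs_mult field_simps)
  qed
  \<comment> \<open>The density is set to 0 on the exceptional null set, so that the bound M / K
    holds at every point of the interval.\<close>
  define d' where "d' x = (if x \<in> N \<union> {a, b} then 0 else d x)" for x
  have "(d' has_integral (g b - g a)) {a..b}"
    by (rule has_integral_spike[OF _ _ d[OF ab], of "N \<union> {a, b}"])
      (use N(1) in \<open>auto simp: d'_def negligible_Un\<close>)
  then have "norm (g b - g a) \<le> M / K * measure lborel {a..b}"
    by (intro has_integral_bound_real[of "M / K" "{}" d']) (use M K bd in \<open>auto simp: d'_def\<close>)
  then show ?thesis
    using K ab by (simp add: g_def field_simps abs_divide flip: diff_divide_distrib)
qed

section \<open>Continuity of translations in L1\<close>

lemma integrable_lborel_translation:
  fixes f :: "'a::euclidean_space \<Rightarrow> real"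
  assumes "integrable lborel f"
  shows "integrable lborel (\<lambda>x. f (x + h))" "(\<integral>x. f (x + h) \<partial>lborel) = (\<integral>x. f x \<partial>lborel)"
proof -
  have [measurable]: "f \<in> borel_measurable borel" using assms by simp
  have "integrable (distr lborel borel ((+) h)) f" using assms by (simp add: lborel_distr_plus)
  then show "integrable lborel (\<lambda>x. f (x + h))"
    by (subst (asm) integrable_distr_eq) (auto simp: add.commute)
  have "(\<integral>x. f x \<partial>lborel) = (\<integral>x. f x \<partial>distr lborel borel ((+) h))" by (simp add: lborel_distr_plus)
  also have "\<dots> = (\<integral>x. f (x + h) \<partial>lborel)"
    by (subst integral_distr) (auto simp: add.commute)
  finally show "(\<integral>x. f (x + h) \<partial>lborel) = (\<integral>x. f x \<partial>lborel)" ..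
qed

definition L1_shift_continuous :: "('a::euclidean_space \<Rightarrow> real) \<Rightarrow> bool" where
  "L1_shift_continuous f \<longleftrightarrow> (\<forall>e>0. \<exists>d>0. \<forall>h. norm h < d \<longrightarrow> (\<integral>x. \<bar>f (x + h) - f x\<bar> \<partial>lborel) < e)"

text \<open>Three epsilons: by translation invariance the shifted and the unshifted approximation
  errors are equal, so the property is closed under L1 limits.\<close>

lemma L1_shift_continuous_approx:
  fixes f :: "'a::euclidean_space \<Rightarrow> real"
  assumes f: "integrable lborel f"
    and s: "\<And>e. e > 0 \<Longrightarrow> \<exists>g. integrable lborel g \<and> L1_shift_continuous g \<and> (\<integral>x. \<bar>f x - g x\<bar> \<partial>lborel) < e"
  shows "L1_shift_continuous f"
  unfolding L1_shift_continuous_def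
proof (intro allI impI)
  fix e :: real assume e: "e > 0"
  then obtain g where g: "integrable lborel g" "L1_shift_continuous g" "(\<integral>x. \<bar>f x - g x\<bar> \<partial>lborel) < e / 3"
    using s[of "e / 3"] by auto
  then obtain d where d: "d > 0" "\<And>h. norm h < d \<Longrightarrow> (\<integral>x. \<bar>g (x + h) - g x\<bar> \<partial>lborel) < e / 3"
    using e unfolding L1_shift_continuous_def by (metis divide_pos_pos zero_less_numeral)
  have "(\<integral>x. \<bar>f (x + h) - f x\<bar> \<partial>lborel) < e" if h: "norm h < d" for h
  proof -
    have fg: "integrable lborel (\<lambda>x. \<bar>f x - g x\<bar>)" using f g(1) by auto
    note sh = integrable_lborel_translation[where h=h]
    have "(\<integral>x. \<bar>f (x + h) - f x\<bar> \<partial>lborel)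
        \<le> (\<integral>x. \<bar>f (x + h) - g (x + h)\<bar> + \<bar>g (x + h) - g x\<bar> + \<bar>f x - g x\<bar> \<partial>lborel)"
      by (intro integral_mono)
        (auto intro!: Bochner_Integration.integrable_add Bochner_Integration.integrable_diff integrable_abs
           sh(1) f g(1))
    also have "\<dots> = (\<integral>x. \<bar>f (x + h) - g (x + h)\<bar> \<partial>lborel) + (\<integral>x. \<bar>g (x + h) - g x\<bar> \<partial>lborel)
        + (\<integral>x. \<bar>f x - g x\<bar> \<partial>lborel)"
      by (subst Bochner_Integration.integral_add Bochner_Integration.integral_add;
          auto intro!: Bochner_Integration.integrable_add Bochner_Integration.integrable_diff integrable_abs
           sh(1) f g(1))+
    also have "(\<integral>x. \<bar>f (x + h) - g (x + h)\<bar> \<partial>lborel) = (\<integral>x. \<bar>f x - g x\<bar> \<partial>lborel)"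
      by (rule sh(2)[OF fg])
    finally show ?thesis using g(3) d(2)[OF h] by linarith
  qed
  then show "\<exists>d>0. \<forall>h. norm h < d \<longrightarrow> (\<integral>x. \<bar>f (x + h) - f x\<bar> \<partial>lborel) < e"
    using d(1) by blast
qed

text \<open>The bound \<open>2 * \<bar>f x\<bar>\<close> is the one that
  \<open>integrable_induct\<close> provides for its approximating sequence; it makes 3 |f| a
  dominating function for the differences.\<close>

lemma L1_shift_continuous_lim:
  fixes f :: "'a::euclidean_space \<Rightarrow> real"
  assumes "\<And>i. integrable lborel (s i)" "\<And>i. L1_shift_continuous (s i)"
    and lim: "\<And>x. (\<lambda>i. s i x) \<longlonglongrightarrow> f x" and bd: "\<And>i x. \<bar>s i x\<bar> \<le> 2 * \<bar>f x\<bar>"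
    and f: "integrable lborel f"
  shows "L1_shift_continuous f"
proof (rule L1_shift_continuous_approx[OF f])
  fix e :: real assume e: "e > 0"
  have "(\<lambda>i. (\<integral>x. \<bar>f x - s i x\<bar> \<partial>lborel)) \<longlonglongrightarrow> (\<integral>x. 0 \<partial>(lborel :: 'a measure))"
  proof (rule integral_dominated_convergence[where w="\<lambda>x. 3 * \<bar>f x\<bar>"])
    show "AE x in lborel. (\<lambda>i. \<bar>f x - s i x\<bar>) \<longlonglongrightarrow> 0"
    proof (rule AE_I2)
      fix x show "(\<lambda>i. \<bar>f x - s i x\<bar>) \<longlonglongrightarrow> 0"
        using tendsto_rabs[OF tendsto_diff[OF tendsto_const[of "f x"] lim[of x]]] by simp
    qed
    have "\<bar>f x - s i x\<bar> \<le> 3 * \<bar>f x\<bar>" for x i using bd[of i x] by linarith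
    then show "AE x in lborel. norm \<bar>f x - s i x\<bar> \<le> 3 * \<bar>f x\<bar>" for i by simp
  qed (use f assms(1) in \<open>auto simp: borel_measurable_integrable\<close>)
  then have "\<forall>\<^sub>F i in sequentially. (\<integral>x. \<bar>f x - s i x\<bar> \<partial>lborel) < e"
    using e by (intro order_tendstoD(2)) auto
  then obtain i where "(\<integral>x. \<bar>f x - s i x\<bar> \<partial>lborel) < e"
    using eventually_happens by fastforce
  then show "\<exists>g. integrable lborel g \<and> L1_shift_continuous g \<and> (\<integral>x. \<bar>f x - g x\<bar> \<partial>lborel) < e"
    using assms(1,2) by blast
qed

text \<open>\<open>A\<close> is enclosed between a compact \<open>T\<close> and an open
  \<open>U\<close> that differ from it by little measure. \<open>T\<close> has positive distance d
  from the complement of \<open>U\<close>, so a shift by less than d keeps \<open>T\<close> inside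
  \<open>U\<close>. Hence the indicator can change only if x or x + h lies in \<open>A - T\<close>
  or \<open>U - A\<close>.\<close>

lemma L1_shift_continuous_indicator:
  fixes A :: "'a::euclidean_space set"
  assumes A: "A \<in> sets borel" "A \<subseteq> cball 0 r"
  shows "L1_shift_continuous (indicator A)"
  unfolding L1_shift_continuous_def
proof (intro allI impI)
  fix e :: real assume e: "e > 0"
  obtain U where U: "open U" "A \<subseteq> U" "(U - A) \<in> lmeasurable" "emeasure lebesgue (U - A) < ennreal (e / 4)"
    using sets_lebesgue_outer_open[of A "e / 4"] A e by auto
  obtain T where T: "closed T" "T \<subseteq> A" "(A - T) \<in> lmeasurable" "emeasure lebesgue (A - T) < ennreal (e / 4)"
    using sets_lebesgue_inner_closed[of A "e / 4"] A e by auto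
  have [measurable]: "A \<in> sets borel" "U \<in> sets borel" "T \<in> sets borel"
    using A U T by auto
  have mU: "emeasure lborel (U - A) < ennreal (e / 4)" and mT: "emeasure lborel (A - T) < ennreal (e / 4)"
    using U(4) T(4) by simp_all
  have fin: "emeasure lborel (U - A) < \<infinity>" "emeasure lborel (A - T) < \<infinity>"
    using mU mT by (auto intro: less_trans simp: less_top)
  have mU': "measure lborel (U - A) < e / 4" and mT': "measure lborel (A - T) < e / 4"
    using mU mT fin e by (auto simp: emeasure_eq_ennreal_measure less_top[symmetric] ennreal_less_iff)
  have iU: "integrable lborel (indicat_real (U - A))" and iT: "integrable lborel (indicat_real (A - T))"
    using fin by auto
  have "T \<subseteq> cball 0 r" using T(2) A(2) by blast
  then have "compact T" using T(1) bounded_subset[OF bounded_cball] by (auto simp: compact_eq_bounded_closed)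
  moreover have "closed (- U)" "T \<inter> (- U) = {}" using U T by auto
  ultimately obtain d where d: "d > 0" "\<And>x y. x \<in> T \<Longrightarrow> y \<in> - U \<Longrightarrow> d \<le> dist x y"
    by (metis separate_compact_closed[of T "- U"])
  have "(\<integral>x. \<bar>indicator A (x + h) - indicator A x\<bar> \<partial>lborel) < e" if h: "norm h < d" for h
  proof -
    have TU: "x \<in> T \<Longrightarrow> x + h \<in> U" "x + h \<in> T \<Longrightarrow> x \<in> U" for x
      using d(2)[of x "x + h"] d(2)[of "x + h" x] h by (auto simp: dist_norm)
    let ?k = "\<lambda>x. indicat_real (A - T) (x + h) + indicat_real (U - A) x
        + (indicat_real (A - T) x + indicat_real (U - A) (x + h))"
    note sh = integrable_lborel_translation[where h=h]
    have ik: "integrable lborel ?k"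
      by (intro Bochner_Integration.integrable_add iU iT sh(1)[OF iU] sh(1)[OF iT])
    have "(\<integral>x. \<bar>indicator A (x + h) - indicator A x\<bar> \<partial>lborel) \<le> integral\<^sup>L lborel ?k"
    proof (rule integral_mono'[OF ik])
      fix x show "\<bar>indicat_real A (x + h) - indicator A x\<bar> \<le> ?k x"
        using TU[of x] T(2) U(2) by (auto simp: indicator_def)
    qed auto
    also have "\<dots> = 2 * measure lborel (A - T) + 2 * measure lborel (U - A)"
      using sh(2)[OF iU] sh(2)[OF iT] iU iT sh(1)[OF iU] sh(1)[OF iT] by simp
    also have "\<dots> < e" using mU' mT' by simp
    finally show ?thesis .
  qed
  then show "\<exists>d>0. \<forall>h. norm h < d \<longrightarrow> (\<integral>x. \<bar>indicat_real A (x + h) - indicator A x\<bar> \<partial>lborel) < e"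
    using d(1) by blast
qed

theorem integrable_imp_L1_shift_continuous:
  fixes f :: "'a::euclidean_space \<Rightarrow> real"
  assumes "integrable lborel f"
  shows "L1_shift_continuous f"
  using assms
proof (induction rule: integrable_induct)
  case (base A c)
  have [measurable]: "A \<in> sets borel" using base by simp
  \<comment> \<open>\<open>A\<close> has finite measure but may be unbounded, while the argument for
    indicators rests on compactness; truncation by balls fills the gap.\<close>
  let ?B = "\<lambda>n::nat. A \<inter> cball 0 (real n)"
  have ind: "L1_shift_continuous (indicat_real A)"
  proof (rule L1_shift_continuous_lim[of "\<lambda>n. indicator (?B n)"])
    show "integrable lborel (indicat_real A)" using base by auto
    show "integrable lborel (indicat_real (?B n))" for n
      using base by (intro integrable_real_indicator)
        (auto intro: le_less_trans[OF emeasure_mono[of _ A]])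
    show "L1_shift_continuous (indicat_real (?B n))" for n
      by (rule L1_shift_continuous_indicator[of _ "real n"]) auto
    show "(\<lambda>n. indicat_real (?B n) x) \<longlonglongrightarrow> indicat_real A x" for x
    proof (rule tendsto_eventually)
      obtain m :: nat where "norm x \<le> real m" using real_arch_simple by blast
      then show "\<forall>\<^sub>F n in sequentially. indicat_real (?B n) x = indicat_real A x"
        by (intro eventually_sequentiallyI[of m]) (auto simp: indicator_def)
    qed
    show "\<bar>indicat_real (?B n) x\<bar> \<le> 2 * \<bar>indicat_real A x\<bar>" for n x by (auto simp: indicator_def)
  qed
  show ?case
    unfolding L1_shift_continuous_def
  proof (intro allI impI)
    fix e :: real assume e: "e > 0"
    then have "e / (\<bar>c\<bar> + 1) > 0" by simp
    then obtain d where d: "d > 0"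
      "\<And>h. norm h < d \<Longrightarrow> (\<integral>x. \<bar>indicat_real A (x + h) - indicator A x\<bar> \<partial>lborel) < e / (\<bar>c\<bar> + 1)"
      using ind unfolding L1_shift_continuous_def by meson
    have "(\<integral>x. \<bar>indicator A (x + h) *\<^sub>R c - indicator A x *\<^sub>R c\<bar> \<partial>lborel) < e" if "norm h < d" for h
    proof -
      have "(\<integral>x. \<bar>indicator A (x + h) *\<^sub>R c - indicator A x *\<^sub>R c\<bar> \<partial>lborel)
        = (\<integral>x. \<bar>indicat_real A (x + h) - indicator A x\<bar> * \<bar>c\<bar> \<partial>lborel)"
        by (intro Bochner_Integration.integral_cong) (auto simp: abs_mult[symmetric] algebra_simps)
      also have "\<dots> = (\<integral>x. \<bar>indicat_real A (x + h) - indicator A x\<bar> \<partial>lborel) * \<bar>c\<bar>" by simp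
      also have "\<dots> \<le> e / (\<bar>c\<bar> + 1) * \<bar>c\<bar>" using d(2)[OF that] by (intro mult_right_mono) auto
      also have "\<dots> < e" using e by (simp add: field_simps)
      finally show ?thesis .
    qed
    then show "\<exists>d>0. \<forall>h. norm h < d \<longrightarrow>
        (\<integral>x. \<bar>indicator A (x + h) *\<^sub>R c - indicator A x *\<^sub>R c\<bar> \<partial>lborel) < e"
      using d(1) by blast
  qed
next
  case (add f g)
  show ?case
    unfolding L1_shift_continuous_def
  proof (intro allI impI)
    fix e :: real assume "e > 0"
    then have e: "e / 2 > 0" by simp
    obtain d1 where d1: "d1 > 0" "\<And>h. norm h < d1 \<Longrightarrow> (\<integral>x. \<bar>f (x + h) - f x\<bar> \<partial>lborel) < e / 2"
      using add.IH(1) e unfolding L1_shift_continuous_def by meson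
    obtain d2 where d2: "d2 > 0" "\<And>h. norm h < d2 \<Longrightarrow> (\<integral>x. \<bar>g (x + h) - g x\<bar> \<partial>lborel) < e / 2"
      using add.IH(2) e unfolding L1_shift_continuous_def by meson
    have "(\<integral>x. \<bar>f (x + h) + g (x + h) - (f x + g x)\<bar> \<partial>lborel) < e" if h: "norm h < min d1 d2" for h
    proof -
      note sh = integrable_lborel_translation(1)[where h=h]
      have i: "integrable lborel (\<lambda>x. \<bar>f (x + h) - f x\<bar>)" "integrable lborel (\<lambda>x. \<bar>g (x + h) - g x\<bar>)"
        by (intro integrable_abs Bochner_Integration.integrable_diff sh add.hyps)+
      have "(\<integral>x. \<bar>f (x + h) + g (x + h) - (f x + g x)\<bar> \<partial>lborel)
        \<le> (\<integral>x. \<bar>f (x + h) - f x\<bar> + \<bar>g (x + h) - g x\<bar> \<partial>lborel)"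
        by (rule integral_mono') (use i in auto)
      also have "\<dots> < e" using d1(2)[of h] d2(2)[of h] h i by simp
      finally show ?thesis .
    qed
    then show "\<exists>d>0. \<forall>h. norm h < d \<longrightarrow> (\<integral>x. \<bar>f (x + h) + g (x + h) - (f x + g x)\<bar> \<partial>lborel) < e"
      using d1(1) d2(1) by (intro exI[of _ "min d1 d2"]) auto
  qed
next
  case (lim f s)
  then show ?case by (intro L1_shift_continuous_lim[of s f]) auto
qed

section \<open>Fubini, concentrating kernels and mollification\<close>

lemma integrable_dominated:
  fixes f g :: "'a \<Rightarrow> real"
  assumes "integrable N g" "f \<in> borel_measurable N" "\<And>x. \<bar>f x\<bar> \<le> g x"
  shows "integrable N f"
proof (rule Bochner_Integration.integrable_bound[OF assms(1,2)])
  show "AE x in N. norm (f x) \<le> norm (g x)"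
    using assms(3) by (intro AE_I2) (simp add: order_trans[OF _ abs_ge_self])
qed

lemma integrable_lborel_bounded_support:
  fixes f :: "'a::euclidean_space \<Rightarrow> real"
  assumes [measurable]: "f \<in> borel_measurable borel"
    and bd: "\<And>x. \<bar>f x\<bar> \<le> C" and S: "bounded S" "\<And>x. x \<notin> S \<Longrightarrow> f x = 0"
  shows "integrable lborel f"
proof -
  obtain r where r: "\<forall>x\<in>S. norm x \<le> r" using S(1) unfolding bounded_iff ..
  have "integrable lborel (\<lambda>x. C * indicat_real (cball 0 r) x)"
    by (intro integrable_mult_right integrable_real_indicator) (auto simp: emeasure_lborel_cball_finite[unfolded infinity_ennreal_def])
  then show ?thesis
  proof (rule integrable_dominated)
    show "\<bar>f x\<bar> \<le> C * indicat_real (cball 0 r) x" for x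
      using bd[of x] S(2)[of x] r by (cases "x \<in> cball 0 r") (auto simp: dist_norm)
  qed simp
qed

lemma lborel_Fubini:
  fixes f :: "'a::euclidean_space \<times> 'b::euclidean_space \<Rightarrow> real"
  assumes "integrable lborel f"
  shows "AE x in lborel. integrable lborel (\<lambda>y. f (x, y))" "AE y in lborel. integrable lborel (\<lambda>x. f (x, y))"
    "integrable lborel (\<lambda>x. \<integral>y. f (x, y) \<partial>lborel)" "integrable lborel (\<lambda>y. \<integral>x. f (x, y) \<partial>lborel)"
    "(\<integral>x. (\<integral>y. f (x, y) \<partial>lborel) \<partial>lborel) = integral\<^sup>L lborel f"
    "(\<integral>y. (\<integral>x. f (x, y) \<partial>lborel) \<partial>lborel) = integral\<^sup>L lborel f"
proof -
  have i: "integrable (lborel \<Otimes>\<^sub>M lborel) f" using assms by (simp add: lborel_prod)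
  then have i': "integrable (lborel \<Otimes>\<^sub>M lborel) (case_prod (\<lambda>x y. f (x, y)))" by simp
  show "AE x in lborel. integrable lborel (\<lambda>y. f (x, y))"
    "integrable lborel (\<lambda>x. \<integral>y. f (x, y) \<partial>lborel)"
    "(\<integral>x. (\<integral>y. f (x, y) \<partial>lborel) \<partial>lborel) = integral\<^sup>L lborel f"
    using lborel_pair.AE_integrable_fst'[OF i] lborel_pair.integrable_fst'[OF i] lborel_pair.integral_fst'[OF i]
    by (simp_all add: lborel_prod)
  show "AE y in lborel. integrable lborel (\<lambda>x. f (x, y))"
    "integrable lborel (\<lambda>y. \<integral>x. f (x, y) \<partial>lborel)"
    "(\<integral>y. (\<integral>x. f (x, y) \<partial>lborel) \<partial>lborel) = integral\<^sup>L lborel f"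
    using lborel_pair.AE_integrable_snd[OF i'] lborel_pair.integrable_snd[OF i'] lborel_pair.integral_snd[OF i']
    by (simp_all add: lborel_prod)
qed

lemma integral_lborel_swap:
  fixes f :: "'a::euclidean_space \<times> 'b::euclidean_space \<Rightarrow> real"
  assumes [measurable]: "f \<in> borel_measurable borel"
  shows "(\<integral>z. f (snd z, fst z) \<partial>lborel) = integral\<^sup>L lborel f"
    and "integrable lborel (\<lambda>z. f (snd z, fst z)) \<longleftrightarrow> integrable lborel f"
proof -
  have [measurable]: "f \<in> borel_measurable (lborel \<Otimes>\<^sub>M lborel)" by (simp add: lborel_prod)
  have "(\<integral>(x, y). f (y, x) \<partial>(lborel \<Otimes>\<^sub>M lborel)) = integral\<^sup>L (lborel \<Otimes>\<^sub>M lborel) f"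
    by (rule lborel_pair.integral_product_swap) simp
  then show "(\<integral>z. f (snd z, fst z) \<partial>lborel) = integral\<^sup>L lborel f"
    by (simp add: lborel_prod case_prod_unfold)
  show "integrable lborel (\<lambda>z. f (snd z, fst z)) \<longleftrightarrow> integrable lborel f"
    using lborel_pair.integrable_product_swap_iff[of f] by (simp add: lborel_prod case_prod_unfold)
qed

lemma integral_lborel_times:
  fixes f :: "'a::euclidean_space \<Rightarrow> real" and g :: "'b::euclidean_space \<Rightarrow> real"
  assumes f: "integrable lborel f" and g: "integrable lborel g"
  shows "integrable lborel (\<lambda>z. f (fst z) * g (snd z))"
    and "(\<integral>z. f (fst z) * g (snd z) \<partial>lborel) = (\<integral>x. f x \<partial>lborel) * (\<integral>y. g y \<partial>lborel)"
proof -
  have [measurable]: "f \<in> borel_measurable borel" "g \<in> borel_measurable borel" using f g by auto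
  have "integrable (lborel \<Otimes>\<^sub>M lborel) (\<lambda>z. f (fst z) * g (snd z))"
    by (rule lborel_pair.Fubini_integrable) (use f g in \<open>auto simp: abs_mult\<close>)
  then show i: "integrable lborel (\<lambda>z. f (fst z) * g (snd z))" by (simp add: lborel_prod)
  show "(\<integral>z. f (fst z) * g (snd z) \<partial>lborel) = (\<integral>x. f x \<partial>lborel) * (\<integral>y. g y \<partial>lborel)"
    using lborel_Fubini(5)[OF i] by simp
qed

text \<open>This disposes of the errors caused by replacing \<open>K\<close> by its value on the
  diagonal. For fixed w the kernel eventually sees only points where \<open>G\<close> is small and
  has mass at most \<open>C1\<close>; dominated convergence then passes to the integral over w.
  Smallness is asked pointwise for almost every w, which is what \<open>K_tendsto\<close> delivers.
  The maps \<open>\<pi>\<close> and \<open>\<sigma>\<close> select the coordinates in which the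
  kernel concentrates.\<close>

lemma concentrating_kernel_tendsto_0:
  fixes G :: "'a::euclidean_space \<times> 'b::euclidean_space \<Rightarrow> real"
    and \<kappa> :: "nat \<Rightarrow> 'a \<times> 'b \<Rightarrow> real" and \<pi> :: "'a \<Rightarrow> real" and \<sigma> :: "'b \<Rightarrow> real"
  assumes G: "\<And>q. 0 \<le> G q" "\<And>q. G q \<le> C"
    and k0: "\<And>n q. 0 \<le> \<kappa> n q" and kI: "\<And>n. integrable lborel (\<kappa> n)"
    and ki: "\<And>n w. integrable lborel (\<lambda>x. \<kappa> n (x, w))"
    and kb: "\<And>n w. (\<integral>x. \<kappa> n (x, w) \<partial>lborel) \<le> C1 * indicator B w"
    and B: "emeasure lborel B < \<infinity>" "B \<in> sets borel"
    and supp: "\<And>n x w. \<kappa> n (x, w) \<noteq> 0 \<Longrightarrow> \<bar>\<pi> x - \<sigma> w\<bar> \<le> 1 / real (Suc n)"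
    and Gm[measurable]: "G \<in> borel_measurable borel"
    and lim: "AE w in lborel. \<forall>e>0. \<exists>d>0. \<forall>x. \<bar>\<pi> x - \<sigma> w\<bar> < d \<longrightarrow> G (x, w) < e"
  shows "(\<lambda>n. \<integral>q. G q * \<kappa> n q \<partial>lborel) \<longlonglongrightarrow> 0" "integrable lborel (\<lambda>q. G q * \<kappa> n q)"
proof -
  have km[measurable]: "\<kappa> n \<in> borel_measurable borel" for n using kI[of n] by simp
  have C0: "C \<ge> 0" using order_trans[OF G(1) G(2)] by blast
  have i: "integrable lborel (\<lambda>q. G q * \<kappa> n q)" for n
    by (rule Bochner_Integration.integrable_bound[OF integrable_mult_right[OF kI[of n], of C]])
      (use G k0 C0 in \<open>auto simp: abs_mult intro!: mult_mono\<close>)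
  then show "integrable lborel (\<lambda>q. G q * \<kappa> n q)" .
  have [measurable]: "(\<lambda>w. \<integral>x. G (x, w) * \<kappa> n (x, w) \<partial>lborel) \<in> borel_measurable borel" for n
    using lborel_Fubini(4)[OF i[of n]] by simp
  have iw: "integrable lborel (\<lambda>x. G (x, w) * \<kappa> n (x, w))" for n w
    by (rule Bochner_Integration.integrable_bound[OF integrable_mult_right[OF ki[of n w], of C]])
      (use G k0 C0 in \<open>auto simp: abs_mult intro!: mult_mono\<close>)
  have bound: "0 \<le> (\<integral>x. G (x, w) * \<kappa> n (x, w) \<partial>lborel) \<and>
     (\<integral>x. G (x, w) * \<kappa> n (x, w) \<partial>lborel) \<le> e * (C1 * indicator B w)"
    if e: "e \<ge> 0" "\<And>x. \<kappa> n (x, w) \<noteq> 0 \<Longrightarrow> G (x, w) \<le> e" for e n w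
  proof -
    have "(\<integral>x. G (x, w) * \<kappa> n (x, w) \<partial>lborel) \<le> (\<integral>x. e * \<kappa> n (x, w) \<partial>lborel)"
    proof (rule integral_mono[OF iw])
      show "integrable lborel (\<lambda>x. e * \<kappa> n (x, w))" using ki by simp
      fix x show "G (x, w) * \<kappa> n (x, w) \<le> e * \<kappa> n (x, w)"
        using e(2)[of x] k0[of n "(x, w)"] by (cases "\<kappa> n (x, w) = 0") (auto intro: mult_right_mono)
    qed
    also have "\<dots> \<le> e * (C1 * indicator B w)"
      using kb[of n w] e(1) by (auto intro: mult_left_mono)
    finally show ?thesis
      using Bochner_Integration.integral_nonneg[of lborel "\<lambda>x. G (x, w) * \<kappa> n (x, w)"] G(1) k0 by simp
  qed
  have "(\<lambda>n. \<integral>w. (\<integral>x. G (x, w) * \<kappa> n (x, w) \<partial>lborel) \<partial>lborel) \<longlonglongrightarrow> (\<integral>w. 0 \<partial>(lborel :: 'b measure))"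
  proof (rule integral_dominated_convergence[where w="\<lambda>w. C * (C1 * indicator B w)"])
    show "integrable lborel (\<lambda>w. C * (C1 * indicat_real B w))"
      using B by (intro integrable_mult_right integrable_real_indicator) auto
    show "AE w in lborel. norm (\<integral>x. G (x, w) * \<kappa> n (x, w) \<partial>lborel) \<le> C * (C1 * indicator B w)" for n
    proof (rule AE_I2)
      fix w show "norm (\<integral>x. G (x, w) * \<kappa> n (x, w) \<partial>lborel) \<le> C * (C1 * indicator B w)"
        using bound[of C n w] C0 G by auto
    qed
    show "AE w in lborel. (\<lambda>n. \<integral>x. G (x, w) * \<kappa> n (x, w) \<partial>lborel) \<longlonglongrightarrow> 0"
      using lim
    proof eventually_elim
      fix w assume w: "\<forall>e>0. \<exists>d>0. \<forall>x. \<bar>\<pi> x - \<sigma> w\<bar> < d \<longrightarrow> G (x, w) < e"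
      show "(\<lambda>n. \<integral>x. G (x, w) * \<kappa> n (x, w) \<partial>lborel) \<longlonglongrightarrow> 0"
      proof (rule LIMSEQ_I)
        fix r :: real assume r: "r > 0"
        define e where "e = r / (\<bar>C1\<bar> + 1)"
        have e: "e > 0" using r by (simp add: e_def)
        then obtain d where d: "d > 0" "\<And>x. \<bar>\<pi> x - \<sigma> w\<bar> < d \<Longrightarrow> G (x, w) < e" using w by blast
        obtain N where N: "1 / real (Suc N) < d" using d(1) nat_approx_posE by blast
        have "norm ((\<integral>x. G (x, w) * \<kappa> n (x, w) \<partial>lborel) - 0) < r" if n: "n \<ge> N" for n
        proof -
          have "1 / real (Suc n) \<le> 1 / real (Suc N)" using n by (intro divide_left_mono) auto
          then have "G (x, w) \<le> e" if "\<kappa> n (x, w) \<noteq> 0" for x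
            using supp[OF that] N d(2)[of x] by linarith
          then have "0 \<le> (\<integral>x. G (x, w) * \<kappa> n (x, w) \<partial>lborel)"
            "(\<integral>x. G (x, w) * \<kappa> n (x, w) \<partial>lborel) \<le> e * (C1 * indicator B w)"
            using bound[of e n w] e by auto
          moreover have "e * (C1 * indicator B w) \<le> e * \<bar>C1\<bar>"
            using e by (intro mult_left_mono) (auto simp: indicator_def)
          moreover have "e * \<bar>C1\<bar> < r" using r by (simp add: e_def field_simps)
          ultimately show ?thesis by simp
        qed
        then show "\<exists>no. \<forall>n\<ge>no. norm ((\<integral>x. G (x, w) * \<kappa> n (x, w) \<partial>lborel) - 0) < r" by blast
      qed
    qed
  qed auto
  then show "(\<lambda>n. \<integral>q. G q * \<kappa> n q \<partial>lborel) \<longlonglongrightarrow> 0"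
    using lborel_Fubini(6)[OF i] by simp
qed

lemma integrable_lborel_reflect:
  fixes f :: "'a::euclidean_space \<Rightarrow> real"
  assumes "integrable lborel f"
  shows "integrable lborel (\<lambda>x. f (a - x))" "(\<integral>x. f (a - x) \<partial>lborel) = (\<integral>x. f x \<partial>lborel)"
proof -
  have [measurable]: "f \<in> borel_measurable borel" using assms by simp
  have d: "distr lborel borel (\<lambda>x. a + (- 1) *\<^sub>R x) = (lborel :: 'a measure)"
    by (subst (2) lborel_affine[of "- 1" a]) (simp_all add: density_1)
  have "integrable (distr lborel borel (\<lambda>x. a + (- 1) *\<^sub>R x)) f" using assms by (simp only: d)
  then show "integrable lborel (\<lambda>x. f (a - x))"
    by (subst (asm) integrable_distr_eq) auto
  have "(\<integral>x. f x \<partial>lborel) = (\<integral>x. f x \<partial>distr lborel borel (\<lambda>x. a + (- 1) *\<^sub>R x))" by (simp only: d)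
  also have "\<dots> = (\<integral>x. f (a - x) \<partial>lborel)" by (subst integral_distr) auto
  finally show "(\<integral>x. f (a - x) \<partial>lborel) = (\<integral>x. f x \<partial>lborel)" ..
qed

text \<open>Writes a single integral as a double one, so that it can be compared with the doubled
  integrands under one integral sign.\<close>

lemma integral_times_shift_kernel:
  fixes f k :: "'a::euclidean_space \<Rightarrow> real"
  assumes f: "integrable lborel f" and k: "\<And>h. 0 \<le> k h" "integrable lborel k" "(\<integral>h. k h \<partial>lborel) = 1"
  shows "integrable lborel (\<lambda>q. f (fst q) * k (fst q - snd q))"
    and "(\<integral>q. f (fst q) * k (fst q - snd q) \<partial>lborel) = (\<integral>x. f x \<partial>lborel)"
proof -
  have [measurable]: "f \<in> borel_measurable borel" "k \<in> borel_measurable borel" using f k by auto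
  have [measurable]: "(\<lambda>q. f (fst q) * k (fst q - snd q)) \<in> borel_measurable (lborel \<Otimes>\<^sub>M lborel)" by measurable
  note ik = integrable_lborel_reflect[OF k(2)]
  have "integrable (lborel \<Otimes>\<^sub>M lborel) (\<lambda>q. f (fst q) * k (fst q - snd q))"
    by (rule lborel_pair.Fubini_integrable) (use f ik k in \<open>auto simp: abs_mult\<close>)
  then show i: "integrable lborel (\<lambda>q. f (fst q) * k (fst q - snd q))" by (simp add: lborel_prod)
  show "(\<integral>q. f (fst q) * k (fst q - snd q) \<partial>lborel) = (\<integral>x. f x \<partial>lborel)"
    using lborel_Fubini(5)[OF i] ik(2) k(3) by simp
qed

lemma ex_small_index:
  fixes X :: "nat \<Rightarrow> real"
  assumes "X \<longlonglongrightarrow> 0" "0 < e" "0 < d"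
  obtains n where "X n < e" "1 / real (Suc n) < d"
proof -
  have "\<forall>\<^sub>F n in sequentially. X n < e"
    using order_tendstoD(2)[OF assms(1,2)] .
  moreover have "\<forall>\<^sub>F n in sequentially. 1 / real (Suc n) < d"
    using LIMSEQ_inverse_real_of_nat assms(3) by (intro order_tendstoD(2)) (simp_all add: inverse_eq_divide)
  ultimately have "\<forall>\<^sub>F n in sequentially. X n < e \<and> 1 / real (Suc n) < d" by (rule eventually_conj)
  then show thesis using eventually_happens'[OF sequentially_bot] that by blast
qed

text \<open>The substitution w = z - h turns the double integral into the average, with weight
  \<open>k h\<close>, of the L1 distances between \<open>f\<close> and its shift by h. A bound for
  the shifts in the support of the kernel is therefore enough. The same computation with nonnegative
  integrals yields integrability.\<close>

lemma mollifier_L1_bound: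
  fixes f k :: "'a::euclidean_space \<Rightarrow> real"
  assumes f: "integrable lborel f" and k: "integrable lborel k" "\<And>h. 0 \<le> k h"
    and b: "\<And>h. k h \<noteq> 0 \<Longrightarrow> (\<integral>z. \<bar>f (z - h) - f z\<bar> \<partial>lborel) \<le> e" and e: "0 \<le> e"
  shows "integrable lborel (\<lambda>q. \<bar>f (snd q) - f (fst q)\<bar> * k (fst q - snd q))"
    and "(\<integral>q. \<bar>f (snd q) - f (fst q)\<bar> * k (fst q - snd q) \<partial>lborel) \<le> e * (\<integral>h. k h \<partial>lborel)"
proof -
  have [measurable]: "f \<in> borel_measurable borel" "k \<in> borel_measurable borel" using f k by auto
  define g where "g q = \<bar>f (snd q) - f (fst q)\<bar> * k (fst q - snd q)" for q
  have [measurable]: "g \<in> borel_measurable (lborel \<Otimes>\<^sub>M lborel)" unfolding g_def by measurable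
  have g0: "0 \<le> g q" for q using k by (simp add: g_def)
  have refl: "(\<integral>\<^sup>+w. F w \<partial>lborel) = (\<integral>\<^sup>+h. F (z - h) \<partial>lborel)"
    if [measurable]: "F \<in> borel_measurable borel" for F :: "'a \<Rightarrow> ennreal" and z
  proof -
    have d: "distr lborel borel (\<lambda>x. z + (- 1) *\<^sub>R x) = (lborel :: 'a measure)"
      by (subst (2) lborel_affine[of "- 1" z]) (simp_all add: density_1)
    have "(\<integral>\<^sup>+w. F w \<partial>lborel) = (\<integral>\<^sup>+w. F w \<partial>distr lborel borel (\<lambda>x. z + (- 1) *\<^sub>R x))" by (simp only: d)
    also have "\<dots> = (\<integral>\<^sup>+h. F (z - h) \<partial>lborel)" by (subst nn_integral_distr) auto
    finally show ?thesis .
  qed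
  have "(\<integral>\<^sup>+q. ennreal (g q) \<partial>(lborel \<Otimes>\<^sub>M lborel)) = (\<integral>\<^sup>+z. (\<integral>\<^sup>+w. ennreal (g (z, w)) \<partial>lborel) \<partial>lborel)"
    by (rule lborel.nn_integral_fst[symmetric]) simp
  also have "\<dots> = (\<integral>\<^sup>+z. (\<integral>\<^sup>+h. ennreal (g (z, z - h)) \<partial>lborel) \<partial>lborel)"
    by (intro nn_integral_cong refl) (simp add: g_def)
  also have "\<dots> = (\<integral>\<^sup>+h. (\<integral>\<^sup>+z. ennreal (g (z, z - h)) \<partial>lborel) \<partial>lborel)"
    unfolding g_def by (rule lborel_pair.Fubini'[symmetric]) measurable
  also have "\<dots> \<le> (\<integral>\<^sup>+h. ennreal (e * k h) \<partial>lborel)"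
  proof (rule nn_integral_mono)
    fix h
    have i: "integrable lborel (\<lambda>z. \<bar>f (z - h) - f z\<bar>)"
      using integrable_lborel_translation(1)[OF f, of "- h"] f by simp
    have "(\<integral>\<^sup>+z. ennreal (g (z, z - h)) \<partial>lborel) = (\<integral>\<^sup>+z. ennreal (\<bar>f (z - h) - f z\<bar> * k h) \<partial>lborel)"
      by (simp add: g_def)
    also have "\<dots> = ennreal ((\<integral>z. \<bar>f (z - h) - f z\<bar> \<partial>lborel) * k h)"
      by (subst nn_integral_eq_integral) (use i k in auto)
    also have "\<dots> \<le> ennreal (e * k h)"
      using b[of h] k(2)[of h] by (cases "k h = 0") (auto intro!: ennreal_leI mult_right_mono)
    finally show "(\<integral>\<^sup>+z. ennreal (g (z, z - h)) \<partial>lborel) \<le> ennreal (e * k h)" .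
  qed
  also have "\<dots> = ennreal (e * (\<integral>h. k h \<partial>lborel))"
    by (subst nn_integral_eq_integral) (use k e in auto)
  finally have nn: "(\<integral>\<^sup>+q. ennreal (g q) \<partial>(lborel \<Otimes>\<^sub>M lborel)) \<le> ennreal (e * (\<integral>h. k h \<partial>lborel))" .
  have "integrable (lborel \<Otimes>\<^sub>M lborel) g"
    by (rule integrableI_nonneg) (use g0 nn in \<open>auto intro: le_less_trans\<close>)
  moreover have "integral\<^sup>L (lborel \<Otimes>\<^sub>M lborel) g \<le> e * (\<integral>h. k h \<partial>lborel)"
    using nn e k by (intro integral_real_bounded) auto
  ultimately show "integrable lborel (\<lambda>q. \<bar>f (snd q) - f (fst q)\<bar> * k (fst q - snd q))"
    "(\<integral>q. \<bar>f (snd q) - f (fst q)\<bar> * k (fst q - snd q) \<partial>lborel) \<le> e * (\<integral>h. k h \<partial>lborel)"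
    by (simp_all add: lborel_prod g_def[abs_def])
qed

section \<open>The flux and its stationary states\<close>

text \<open>The function sgn(p - r) (|p| - |r|), written with \<open>max\<close> and
  \<open>min\<close> so that its symmetry is visible. The cancellation in the doubling argument
  rests on this symmetry.\<close>

definition kruzkov_flux :: "real \<Rightarrow> real \<Rightarrow> real" where
  "kruzkov_flux p r = \<bar>max p r\<bar> - \<bar>min p r\<bar>"

lemma kruzkov_flux_commute: "kruzkov_flux p r = kruzkov_flux r p"
  by (simp add: kruzkov_flux_def max.commute min.commute)

lemma kruzkov_flux_le: "\<bar>kruzkov_flux p r\<bar> \<le> \<bar>p\<bar> + \<bar>r\<bar>"
  unfolding kruzkov_flux_def max_def min_def by (auto split: if_splits simp: abs_if)

lemma kruzkov_flux_lipschitz: "\<bar>kruzkov_flux p r - kruzkov_flux p r'\<bar> \<le> \<bar>r - r'\<bar>"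
  unfolding kruzkov_flux_def max_def min_def by (auto split: if_splits simp: abs_if)

lemma borel_measurable_kruzkov_flux[measurable (raw)]:
  "f \<in> borel_measurable M \<Longrightarrow> g \<in> borel_measurable M \<Longrightarrow> (\<lambda>x. kruzkov_flux (f x) (g x)) \<in> borel_measurable M"
  unfolding kruzkov_flux_def
  by (intro borel_measurable_diff borel_measurable_abs borel_measurable_max borel_measurable_min)

locale adapted_flux =
  fixes A :: "real \<Rightarrow> real \<Rightarrow> real" and \<Omega> :: "real set" and q um up :: "real \<Rightarrow> real"
  assumes A1: "flux_A1 A \<Omega>" and A2: "flux_A2 A q" and A3: "flux_A3 A \<Omega> um up"
    and states: "stationary_states_exist A \<Omega> um up"
begin

lemma closed_\<Omega>: "closed \<Omega>" and negligible_\<Omega>: "negligible \<Omega>"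
  and A_cont: "continuous_on ((-\<Omega>) \<times> UNIV) (\<lambda>(x, w). A x w)"
  using A1 by (auto simp: flux_A1_def)

lemma um_cont: "continuous_on (-\<Omega>) um" and up_cont: "continuous_on (-\<Omega>) up"
  using A3 by (auto simp: flux_A3_def)

lemma \<Omega>_sets[measurable]: "\<Omega> \<in> sets borel" using closed_\<Omega> by auto

lemma AE_not_\<Omega>: "AE x in lborel. x \<notin> \<Omega>"
proof -
  have "\<Omega> \<in> null_sets lborel"
    using negligible_\<Omega> by (simp add: negligible_iff_null_sets null_sets_completion_iff)
  then show ?thesis by (rule AE_not_in)
qed

lemma
  assumes "x \<notin> \<Omega>"
  shows um_le_up: "um x \<le> up x"
    and A_anti: "\<And>w w'. w < w' \<Longrightarrow> w' \<le> um x \<Longrightarrow> A x w' < A x w"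
    and A_mono: "\<And>w w'. w < w' \<Longrightarrow> up x \<le> w \<Longrightarrow> A x w < A x w'"
    and A_plateau: "\<And>w. um x \<le> w \<Longrightarrow> w \<le> up x \<Longrightarrow> A x w = 0"
proof -
  have *: "um x \<le> up x" "strict_antimono_on {..um x} (A x)" "strict_mono_on {up x..} (A x)"
     "\<forall>z\<in>{um x..up x}. A x z = 0"
    using A3 assms by (auto simp: flux_A3_def)
  show "um x \<le> up x" by (rule *(1))
  show "\<And>w w'. w < w' \<Longrightarrow> w' \<le> um x \<Longrightarrow> A x w' < A x w"
    using *(2) by (auto simp: monotone_on_def)
  show "\<And>w w'. w < w' \<Longrightarrow> up x \<le> w \<Longrightarrow> A x w < A x w'"
    using *(3) by (auto simp: monotone_on_def)
  show "\<And>w. um x \<le> w \<Longrightarrow> w \<le> up x \<Longrightarrow> A x w = 0" using *(4) by auto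
qed

text \<open>Off \<Omega> at most one of the two terms is nonzero, because \<open>A x\<close>
  vanishes at both ends of the plateau. The clamped arguments make joint continuity a matter of
  composition, and the value 0 on \<Omega> makes \<open>P\<close> Borel on the whole plane.\<close>

definition P :: "real \<Rightarrow> real \<Rightarrow> real" where
  "P x w = (if x \<in> \<Omega> then 0 else A x (max w (up x)) - A x (min w (um x)))"

lemma
  assumes x: "x \<notin> \<Omega>"
  shows P_ge_up: "up x \<le> w \<Longrightarrow> P x w = A x w"
    and P_le_um: "w \<le> um x \<Longrightarrow> P x w = - A x w"
    and P_plateau: "um x \<le> w \<Longrightarrow> w \<le> up x \<Longrightarrow> P x w = 0"
  using um_le_up[OF x] A_plateau[OF x] x by (auto simp: P_def max_def min_def)

lemma P_pos: "x \<notin> \<Omega> \<Longrightarrow> up x < w \<Longrightarrow> P x w > 0"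
  using A_mono[of x "up x" w] A_plateau[of x "up x"] um_le_up[of x] P_ge_up[of x w] by simp

lemma P_neg: "x \<notin> \<Omega> \<Longrightarrow> w < um x \<Longrightarrow> P x w < 0"
  using A_anti[of x w "um x"] A_plateau[of x "um x"] um_le_up[of x] P_le_um[of x w] by simp

lemma P_cases:
  assumes "x \<notin> \<Omega>"
  obtains "up x < w" "P x w > 0" "P x w = A x w" | "w < um x" "P x w < 0" "P x w = - A x w"
    | "um x \<le> w" "w \<le> up x" "P x w = 0" "A x w = 0"
proof -
  consider "up x < w" | "w < um x" | "um x \<le> w" "w \<le> up x" by linarith
  then show thesis
  proof cases
    case 1 then show thesis using that(1) P_pos P_ge_up assms by simp
  next
    case 2 then show thesis using that(2) P_neg P_le_um assms by simp
  next
    case 3 then show thesis using that(3) P_plateau A_plateau assms by simp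
  qed
qed

lemma abs_P: "x \<notin> \<Omega> \<Longrightarrow> \<bar>P x w\<bar> = A x w"
  by (cases rule: P_cases[of x w]) auto

text \<open>\<open>P x\<close> is flat only on the plateau, where it vanishes; one nonzero value
  thus excludes that both arguments lie there.\<close>

lemma P_mono_strict:
  assumes x: "x \<notin> \<Omega>" and w: "w < w'" and nz: "P x w \<noteq> 0 \<or> P x w' \<noteq> 0"
  shows "P x w < P x w'"
proof (cases rule: P_cases[OF x, of w])
  case 1
  then show ?thesis using A_mono[OF x w] P_ge_up[OF x, of w'] w by simp
next
  case 2
  note w2 = this
  show ?thesis
  proof (cases rule: P_cases[OF x, of w'])
    case 2
    then show ?thesis using A_anti[OF x w] w2 by simp
  qed (use w2 in auto)
next
  case 3
  note w3 = this
  show ?thesis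
    by (cases rule: P_cases[OF x, of w']) (use w3 nz w um_le_up[OF x] in auto)
qed

lemma P_mono: "x \<notin> \<Omega> \<Longrightarrow> w \<le> w' \<Longrightarrow> P x w \<le> P x w'"
  using P_mono_strict[of x w w'] by (cases "w = w'") (auto, force)

text \<open>The standing existence of stationary states enters here: the sign of \<open>p\<close>
  decides which of the two states of level |p| is used.\<close>

lemma P_surj: assumes "x \<notin> \<Omega>" shows "\<exists>w. P x w = p"
proof -
  obtain k k' where k: "is_k_minus A \<Omega> um \<bar>p\<bar> k" "is_k_plus A \<Omega> up \<bar>p\<bar> k'"
    using states unfolding stationary_states_exist_def by (metis abs_ge_zero)
  show ?thesis
  proof (cases "p \<ge> 0")
    case True
    then show ?thesis
      using k(2) assms P_ge_up[OF assms, of "k' x"] by (auto simp: is_k_plus_def intro!: exI[of _ "k' x"])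
  next
    case False
    then show ?thesis
      using k(1) assms P_le_um[OF assms, of "k x"] by (auto simp: is_k_minus_def intro!: exI[of _ "k x"])
  qed
qed

text \<open>For a nonzero level, \<open>P x w = P y c\<close> determines w. For level 0 every value
  of the plateau at x qualifies, and the projection of \<open>c\<close> onto the plateau is the
  choice that returns \<open>c\<close> at x = y and depends continuously on the ends of the plateau.
  The value 0 on \<Omega> serves measurability.\<close>

definition K :: "real \<Rightarrow> real \<Rightarrow> real \<Rightarrow> real" where
  "K x y c = (if x \<in> \<Omega> then 0 else if P y c = 0 then max (um x) (min c (up x)) else (SOME w. P x w = P y c))"

lemma P_K: assumes x: "x \<notin> \<Omega>" shows "P x (K x y c) = P y c"
proof (cases "P y c = 0")
  case True
  then show ?thesis using P_plateau[OF x, of "K x y c"] um_le_up[OF x] x by (auto simp: K_def)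
next
  case False
  then show ?thesis using someI_ex[OF P_surj[OF x, of "P y c"]] x by (simp add: K_def)
qed

lemma K_plateau: "x \<notin> \<Omega> \<Longrightarrow> P y c = 0 \<Longrightarrow> um x \<le> K x y c \<and> K x y c \<le> up x"
  using um_le_up[of x] by (auto simp: K_def)

text \<open>By monotonicity of \<open>P x\<close>, the sign of w - K can disagree with that of
  \<open>P x w - P y c\<close> only when these two values coincide, and then the other factor
  vanishes because \<open>A x w\<close> is |P x w|. The flux of the entropy with state
  \<open>K\<close> thereby becomes symmetric in the two signed fluxes.\<close>

lemma kruzkov_flux_K:
  assumes x: "x \<notin> \<Omega>"
  shows "sgn (w - K x y c) * (A x w - \<bar>P y c\<bar>) = kruzkov_flux (P x w) (P y c)"
  using P_mono[OF x, of w "K x y c"] P_mono[OF x, of "K x y c" w] P_K[OF x, of y c] abs_P[OF x, of w]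
  by (cases "K x y c" w rule: linorder_cases) (auto simp: kruzkov_flux_def max_def min_def)

lemma um_borel[measurable]: "(\<lambda>x. if x \<in> \<Omega> then 0 else um x) \<in> borel_measurable borel"
  and up_borel[measurable]: "(\<lambda>x. if x \<in> \<Omega> then 0 else up x) \<in> borel_measurable borel"
proof -
  have "(\<lambda>x. indicator (-\<Omega>) x *\<^sub>R um x) \<in> borel_measurable borel"
    "(\<lambda>x. indicator (-\<Omega>) x *\<^sub>R up x) \<in> borel_measurable borel"
    by (rule borel_measurable_continuous_on_indicator, simp, rule um_cont up_cont)+
  moreover have "(\<lambda>x. indicator (-\<Omega>) x *\<^sub>R f x) = (\<lambda>x. if x \<in> \<Omega> then 0 else f x)" for f :: "real \<Rightarrow> real"
    by (auto simp: indicator_def)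
  ultimately show "(\<lambda>x. if x \<in> \<Omega> then 0 else um x) \<in> borel_measurable borel"
    "(\<lambda>x. if x \<in> \<Omega> then 0 else up x) \<in> borel_measurable borel" by simp_all
qed

lemma P_cont: "continuous_on ((-\<Omega>) \<times> UNIV) (\<lambda>z. P (fst z) (snd z))"
proof -
  have c: "continuous_on ((-\<Omega>) \<times> UNIV) (\<lambda>z. up (fst z))" "continuous_on ((-\<Omega>) \<times> UNIV) (\<lambda>z. um (fst z))"
    by (rule continuous_on_compose2[OF up_cont] continuous_on_compose2[OF um_cont]; auto intro: continuous_intros)+
  have A: "continuous_on ((-\<Omega>) \<times> UNIV) (\<lambda>z. A (fst z) (f z))"
    if "continuous_on ((-\<Omega>) \<times> UNIV) f" for f :: "real \<times> real \<Rightarrow> real"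
  proof -
    have "continuous_on ((-\<Omega>) \<times> UNIV) (\<lambda>z. (fst z, f z))" by (intro continuous_intros that)
    moreover have "(\<lambda>z. (fst z, f z)) ` ((-\<Omega>) \<times> UNIV) \<subseteq> (-\<Omega>) \<times> UNIV" by auto
    ultimately show ?thesis using continuous_on_compose2[OF A_cont, of _ "\<lambda>z. (fst z, f z)"] by simp
  qed
  have "continuous_on ((-\<Omega>) \<times> UNIV)
     (\<lambda>z. A (fst z) (max (snd z) (up (fst z))) - A (fst z) (min (snd z) (um (fst z))))"
    by (intro continuous_on_diff A continuous_on_max continuous_on_min c continuous_intros)
  then show ?thesis
    by (rule continuous_on_eq) (auto simp: P_def)
qed

lemma P_borel: "(\<lambda>z. P (fst z) (snd z)) \<in> borel_measurable borel"
proof -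
  have "open ((-\<Omega>) \<times> (UNIV :: real set))" using closed_\<Omega> by (intro open_Times) auto
  then have "(\<lambda>z. indicator ((-\<Omega>) \<times> (UNIV :: real set)) z *\<^sub>R P (fst z) (snd z)) \<in> borel_measurable borel"
    by (intro borel_measurable_continuous_on_indicator P_cont) auto
  moreover have "(\<lambda>z. indicator ((-\<Omega>) \<times> (UNIV :: real set)) z *\<^sub>R P (fst z) (snd z)) = (\<lambda>z. P (fst z) (snd z))"
    by (auto simp: indicator_def P_def fun_eq_iff)
  ultimately show ?thesis by simp
qed

lemma P_measurable[measurable (raw)]:
  assumes [measurable]: "f \<in> borel_measurable M" "g \<in> borel_measurable M"
  shows "(\<lambda>z. P (f z) (g z)) \<in> borel_measurable M"
proof -
  have "(\<lambda>z. (f z, g z)) \<in> measurable M (borel :: (real \<times> real) measure)"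
    unfolding borel_prod[symmetric] by measurable
  from measurable_compose[OF this P_borel] show ?thesis by simp
qed

text \<open>Although \<open>K\<close> is defined by choice, monotonicity of \<open>P\<close>
  describes its sublevel sets by Borel conditions. The joint measurability in x, y and c rests on
  this.\<close>

lemma K_le_iff:
  assumes x: "x \<notin> \<Omega>"
  shows "K x y c \<le> a \<longleftrightarrow> (if P y c = 0 then max (um x) (min c (up x)) \<le> a else P y c \<le> P x a)"
proof (cases "P y c = 0")
  case True
  then show ?thesis using x by (simp add: K_def)
next
  case False
  then show ?thesis
    using P_mono[OF x, of "K x y c" a] P_mono_strict[OF x, of a "K x y c"] P_K[OF x, of y c]
    by (auto simp: not_less[symmetric])
qed

lemma K_measurable[measurable (raw)]:
  assumes [measurable]: "f \<in> borel_measurable M" "g \<in> borel_measurable M" "h \<in> borel_measurable M"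
  shows "(\<lambda>z. K (f z) (g z) (h z)) \<in> borel_measurable M"
  unfolding borel_measurable_iff_le
proof
  fix a
  let ?m = "\<lambda>x. if x \<in> \<Omega> then 0 else um x" and ?p = "\<lambda>x. if x \<in> \<Omega> then 0 else up x"
  have "K (f z) (g z) (h z) \<le> a \<longleftrightarrow>
     (if f z \<in> \<Omega> then 0 \<le> a else if P (g z) (h z) = 0 then max (?m (f z)) (min (h z) (?p (f z))) \<le> a
       else P (g z) (h z) \<le> P (f z) a)" for z
    using K_le_iff[of "f z" "g z" "h z" a] by (simp add: K_def)
  then have "{z \<in> space M. K (f z) (g z) (h z) \<le> a} = {z \<in> space M.
     (if f z \<in> \<Omega> then 0 \<le> a else if P (g z) (h z) = 0 then max (?m (f z)) (min (h z) (?p (f z))) \<le> a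
       else P (g z) (h z) \<le> P (f z) a)}" by simp
  also have "\<dots> \<in> sets M" by measurable
  finally show "{z \<in> space M. K (f z) (g z) (h z) \<le> a} \<in> sets M" .
qed

text \<open>The sign of \<open>P y c\<close> selects the branch. Level 0 is the case in which the
  definition of the states asks for measurability in x, hence the appeal to
  \<open>K_measurable\<close>.\<close>

lemma K_stationary:
  assumes y: "y \<notin> \<Omega>"
  shows "(\<lambda>x. K x y c) \<in> stationary_states A \<Omega> um up \<bar>P y c\<bar>"
proof (cases "P y c = 0")
  case True
  have "(\<lambda>x. K x y c) \<in> borel_measurable borel" by measurable
  then have "(\<lambda>x. K x y c) \<in> borel_measurable lebesgue"
    by (intro measurable_completion) simp
  then show ?thesis using True K_plateau by (auto simp: stationary_states_def)
next
  case False
  have "is_k_plus A \<Omega> up \<bar>P y c\<bar> (\<lambda>x. K x y c)" if "P y c > 0"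
    unfolding is_k_plus_def
  proof (intro ballI)
    fix x assume "x \<in> - \<Omega>"
    then have x: "x \<notin> \<Omega>" by simp
    show "up x \<le> K x y c \<and> A x (K x y c) = \<bar>P y c\<bar>"
      by (cases rule: P_cases[OF x, of "K x y c"]) (use P_K[OF x, of y c] that in auto)
  qed
  moreover have "is_k_minus A \<Omega> um \<bar>P y c\<bar> (\<lambda>x. K x y c)" if "P y c < 0"
    unfolding is_k_minus_def
  proof (intro ballI)
    fix x assume "x \<in> - \<Omega>"
    then have x: "x \<notin> \<Omega>" by simp
    show "K x y c \<le> um x \<and> A x (K x y c) = \<bar>P y c\<bar>"
      by (cases rule: P_cases[OF x, of "K x y c"]) (use P_K[OF x, of y c] that in auto)
  qed
  ultimately show ?thesis using False by (auto simp: stationary_states_def) linarith+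
qed

text \<open>If \<open>c\<close> lies on the plateau at y, continuity of its two ends keeps the
  projection of \<open>c\<close> near \<open>c\<close>. Otherwise \<open>P y c\<close> lies strictly
  between \<open>P y (c - e)\<close> and \<open>P y (c + e)\<close>; these strict inequalities
  persist at nearby x, and monotonicity of \<open>P x\<close> traps \<open>K x y c\<close> between c
  - e and c + e.\<close>

lemma K_tendsto:
  assumes y: "y \<notin> \<Omega>" and e: "e > 0"
  shows "\<exists>d>0. \<forall>x. \<bar>x - y\<bar> < d \<longrightarrow> \<bar>K x y c - c\<bar> < e"
proof -
  have op: "open (- \<Omega>)" using closed_\<Omega> by auto
  have ev\<Omega>: "\<forall>\<^sub>F x in nhds y. x \<notin> \<Omega>"
    using eventually_nhds_in_open[OF op, of y] y by simp
  have Pc: "((\<lambda>x. P x w) \<longlongrightarrow> P y w) (nhds y)" for w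
  proof -
    have "continuous_on (-\<Omega>) (\<lambda>x. P x w)"
    proof -
      have "continuous_on (-\<Omega>) (\<lambda>x. (x, w))" by (intro continuous_intros)
      from continuous_on_compose2[OF P_cont this] show ?thesis by auto
    qed
    then have "isCont (\<lambda>x. P x w) y" using op y by (simp add: continuous_on_eq_continuous_at)
    then show ?thesis
      unfolding isCont_def using tendsto_at_iff_tendsto_nhds[of "\<lambda>x. P x w" y] by simp
  qed
  have uc: "(um \<longlongrightarrow> um y) (nhds y)" "(up \<longlongrightarrow> up y) (nhds y)"
  proof -
    have "isCont um y" "isCont up y"
      using op y um_cont up_cont by (simp_all add: continuous_on_eq_continuous_at)
    then show "(um \<longlongrightarrow> um y) (nhds y)" "(up \<longlongrightarrow> up y) (nhds y)"
      by (simp_all add: isCont_def tendsto_at_iff_tendsto_nhds)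
  qed
  have "\<forall>\<^sub>F x in nhds y. \<bar>K x y c - c\<bar> < e"
  proof (cases "P y c = 0")
    case True
    have c: "um y \<le> c" "c \<le> up y"
      using P_cases[OF y, of c] True by auto
    have "\<forall>\<^sub>F x in nhds y. um x < um y + e" "\<forall>\<^sub>F x in nhds y. up y - e < up x"
      using order_tendstoD[OF uc(1)] order_tendstoD[OF uc(2)] e by auto
    with ev\<Omega> show ?thesis
    proof eventually_elim
      case (elim x)
      then show ?case using True c e um_le_up[of x] by (auto simp: K_def max_def min_def)
    qed
  next
    case False
    have "P y (c - e) < P y c" "P y c < P y (c + e)"
      using P_mono_strict[OF y] e False by auto
    then have "\<forall>\<^sub>F x in nhds y. P x (c - e) < P y c" "\<forall>\<^sub>F x in nhds y. P y c < P x (c + e)"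
      using order_tendstoD[OF Pc] by auto
    with ev\<Omega> show ?thesis
    proof eventually_elim
      case (elim x)
      then have "c - e < K x y c" "K x y c < c + e"
        using P_K[of x y c] P_mono[of x "K x y c" "c - e"] P_mono[of x "c + e" "K x y c"]
        by (auto simp: not_le[symmetric])
      then show ?case by linarith
    qed
  qed
  then show ?thesis by (simp add: eventually_nhds_metric dist_real_def)
qed

text \<open>For a \<le> b, monotonicity of \<open>P x\<close> and
  \<open>\<bar>P x w\<bar> = A x w\<close> reduce the symmetric flux to the increment
  \<open>A x b - A x a\<close>, to which the bound by existing derivatives applies.\<close>

lemma kruzkov_flux_speed:
  assumes x: "x \<notin> \<Omega>" and m: "0 \<le> m"
    and d: "\<And>w d. w \<in> closed_segment a b \<Longrightarrow> (A x has_real_derivative d) (at w) \<Longrightarrow> \<bar>d\<bar> \<le> m"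
    and L: "\<And>w z. w \<in> closed_segment a b \<Longrightarrow> z \<in> closed_segment a b \<Longrightarrow> \<bar>A x w - A x z\<bar> \<le> L * \<bar>w - z\<bar>"
  shows "\<bar>kruzkov_flux (P x a) (P x b)\<bar> \<le> m * \<bar>a - b\<bar>"
proof -
  have *: "\<bar>kruzkov_flux (P x a) (P x b)\<bar> \<le> m * \<bar>a - b\<bar>" if ab: "a \<le> b"
    and d: "\<And>w d. w \<in> {a..b} \<Longrightarrow> (A x has_real_derivative d) (at w) \<Longrightarrow> \<bar>d\<bar> \<le> m"
    and L: "\<And>w z. w \<in> {a..b} \<Longrightarrow> z \<in> {a..b} \<Longrightarrow> \<bar>A x w - A x z\<bar> \<le> L * \<bar>w - z\<bar>" for a b
  proof -
    have "\<bar>A x b - A x a\<bar> \<le> m * (b - a)"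
      by (rule lipschitz_increment_bound_by_derivative[OF ab L d m])
    moreover have "kruzkov_flux (P x a) (P x b) = A x b - A x a"
      using P_mono[OF x ab] abs_P[OF x] by (simp add: kruzkov_flux_def max_def min_def)
    ultimately show ?thesis using ab by (simp add: abs_minus_commute)
  qed
  show ?thesis
  proof (cases "a \<le> b")
    case True
    then show ?thesis using *[OF True] d L by (simp add: closed_segment_eq_real_ivl)
  next
    case False
    then have "b \<le> a" by simp
    then show ?thesis using *[of b a] d L False
      by (simp add: closed_segment_eq_real_ivl kruzkov_flux_commute[of "P x a"] abs_minus_commute)
  qed
qed

end

section \<open>Entropy inequalities for Borel representatives\<close>

lemma fst_borel[measurable]: "fst \<in> borel_measurable (borel :: ('a::euclidean_space \<times> 'b::euclidean_space) measure)"
  and snd_borel[measurable]: "snd \<in> borel_measurable (borel :: ('a::euclidean_space \<times> 'b::euclidean_space) measure)"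
  by (intro borel_measurable_continuous_onI continuous_intros)+

text \<open>The two arguments are (x - a') / (a - a') and (b' - x) / (b' - b), spelled as
  \<open>c * x + d\<close> to fit \<open>smooth1_affine\<close>.\<close>

definition cutoff :: "real \<Rightarrow> real \<Rightarrow> real \<Rightarrow> real \<Rightarrow> real \<Rightarrow> real" where
  "cutoff a' a b b' x = smooth_step (1 / (a - a') * x + - a' / (a - a')) * smooth_step (- 1 / (b' - b) * x + b' / (b' - b))"

lemma smooth1_cutoff: "smooth1 (cutoff a' a b b')"
  unfolding cutoff_def by (intro smooth1_mult smooth1_affine smooth1_step)

lemma cutoff_bounds: "0 \<le> cutoff a' a b b' x" "cutoff a' a b b' x \<le> 1"
  by (simp_all add: cutoff_def smooth_step_bounds mult_le_one)

lemma cutoff_eq_1: "a' < a \<Longrightarrow> b < b' \<Longrightarrow> a \<le> x \<Longrightarrow> x \<le> b \<Longrightarrow> cutoff a' a b b' x = 1"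
  by (simp add: cutoff_def smooth_step_1 divide_simps)

lemma cutoff_eq_0: "a' < a \<Longrightarrow> b < b' \<Longrightarrow> x \<notin> {a'..b'} \<Longrightarrow> cutoff a' a b b' x = 0"
proof -
  assume *: "a' < a" "b < b'" "x \<notin> {a'..b'}"
  then consider "x < a'" | "x > b'" by fastforce
  then show ?thesis
  proof cases
    case 1
    then have "1 / (a - a') * x + - a' / (a - a') \<le> 0" using * by (simp add: divide_simps)
    then show ?thesis by (simp add: cutoff_def smooth_step_0)
  next
    case 2
    then have "- 1 / (b' - b) * x + b' / (b' - b) \<le> 0" using * by (simp add: divide_simps)
    then show ?thesis by (simp add: cutoff_def smooth_step_0)
  qed
qed

lemma deriv_cutoff_0:
  assumes "a' < a" "b < b'" "a < x" "x < b"
  shows "deriv (cutoff a' a b b') x = 0"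
proof (rule DERIV_imp_deriv)
  have "\<forall>\<^sub>F y in nhds x. cutoff a' a b b' y = 1"
    by (rule eventually_mono[OF eventually_nhds_in_open[of "{a<..<b}" x]])
      (use assms in \<open>auto intro: cutoff_eq_1\<close>)
  then show "(cutoff a' a b b' has_real_derivative 0) (at x)"
    by (subst DERIV_cong_ev[OF refl _ refl, where g="\<lambda>s. 1"]) auto
qed

lemma pd_product:
  assumes "smooth1 f" "smooth1 g"
  shows "pd_t (\<lambda>t x. f t * g x) t x = deriv f t * g x" "pd_x (\<lambda>t x. f t * g x) t x = f t * deriv g x"
  unfolding pd_t_def pd_x_def
  by (intro DERIV_imp_deriv DERIV_cmult DERIV_cmult_right smooth1_deriv assms)+

lemma integral_deriv_compact_support:
  fixes f f' :: "real \<Rightarrow> real"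
  assumes d: "\<And>t. (f has_real_derivative f' t) (at t)" and c: "\<And>t. isCont f' t"
    and z: "\<And>t. t \<notin> {a..b} \<Longrightarrow> f t = 0" "\<And>t. t \<notin> {a..b} \<Longrightarrow> f' t = 0"
  shows "(\<integral>t. f' t \<partial>lborel) = 0"
proof (cases "a \<le> b")
  case True
  have "(\<integral>t. f' t * indicator {a - 1..b + 1} t \<partial>lborel) = f (b + 1) - f (a - 1)"
    by (rule integral_FTC_Icc_real) (use True d c in auto)
  moreover have "(\<lambda>t. f' t * indicator {a - 1..b + 1} t) = f'"
  proof
    fix t show "f' t * indicator {a - 1..b + 1} t = f' t"
      using z(2)[of t] by (cases "t \<in> {a..b}") auto
  qed
  ultimately show ?thesis using z(1) by simp
next
  case False
  then have "f' = (\<lambda>t. 0)" using z(2) by auto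
  then show ?thesis by simp
qed

lemma AE_lborel_snd:
  assumes "AE y in lborel. Q y"
  shows "AE z in (lborel :: ('a::euclidean_space \<times> 'b::euclidean_space) measure). Q (snd z)"
proof -
  obtain N where N: "N \<in> null_sets lborel" "{y. \<not> Q y} \<subseteq> N"
    using assms unfolding eventually_ae_filter by auto
  then have "emeasure (lborel \<Otimes>\<^sub>M lborel) ((UNIV :: 'a set) \<times> N) = 0"
    by (subst lborel.emeasure_pair_measure_Times) (auto simp: null_sets_def)
  then have "(UNIV :: 'a set) \<times> N \<in> null_sets lborel"
    using N(1) unfolding lborel_prod[symmetric] by (auto simp: null_sets_def intro!: pair_measureI)
  then show ?thesis by (rule AE_I') (use N(2) in auto)
qed

lemma Icc_Times_borel[measurable]: "{a..b} \<times> {c..d} \<in> sets (borel :: (real \<times> real) measure)"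
  by (intro borel_closed closed_Times closed_atLeastAtMost)

lemma Q_dom_sets[measurable]: "Q_dom T \<in> sets borel"
  by (intro borel_closed closed_Times) auto

lemma clamp_abs_le: "0 \<le> C \<Longrightarrow> \<bar>max (- C) (min C (w::real))\<bar> \<le> C"
  by (auto simp: max_def min_def)

lemma clamp_eq: "\<bar>w\<bar> \<le> C \<Longrightarrow> max (- \<bar>C\<bar>) (min \<bar>C\<bar> (w::real)) = w"
  by linarith

text \<open>A Borel function with a bound at every point can be composed with \<open>P\<close> and
  \<open>K\<close> and restricted to slices without generating further null sets. Lebesgue
  measurability and an essential bound are not stable in this way.\<close>

lemma Linf_Q_borel_representative:
  assumes "Linf_Q T u"
  shows "\<exists>U C. U \<in> borel_measurable borel \<and> 0 \<le> C \<and> (\<forall>z. \<bar>U z\<bar> \<le> C) \<and>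
     (AE z in lborel. z \<in> Q_dom T \<longrightarrow> U z = u (fst z) (snd z))"
proof -
  have Q: "Q_dom T \<in> sets lebesgue" using Q_dom_sets by (intro sets_completionI_sets) simp
  obtain C where m: "(\<lambda>(t, x). u t x) \<in> borel_measurable (lebesgue_on (Q_dom T))"
    and C: "AE z in lebesgue_on (Q_dom T). \<bar>u (fst z) (snd z)\<bar> \<le> C"
    using assms by (auto simp: Linf_Q_def case_prod_unfold)
  have "(\<lambda>z. if z \<in> Q_dom T then (case z of (t, x) \<Rightarrow> u t x) else 0) \<in> borel_measurable lebesgue"
    using m Q by (intro borel_measurable_if_I)
  then obtain g where g: "g \<in> borel_measurable lborel"
    and ge: "AE z in lborel. (if z \<in> Q_dom T then (case z of (t, x) \<Rightarrow> u t x) else 0) = g z"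
    using completion_ex_borel_measurable_real by blast
  have "AE z in lebesgue. z \<in> Q_dom T \<longrightarrow> \<bar>u (fst z) (snd z)\<bar> \<le> C"
    using C Q by (subst (asm) AE_restrict_space_iff) auto
  then have "AE z in lborel. z \<in> Q_dom T \<longrightarrow> \<bar>u (fst z) (snd z)\<bar> \<le> C" by (simp add: AE_completion_iff)
  with ge have "AE z in lborel. z \<in> Q_dom T \<longrightarrow> max (- \<bar>C\<bar>) (min \<bar>C\<bar> (g z)) = u (fst z) (snd z)"
    by eventually_elim (auto simp: clamp_eq)
  moreover have "(\<lambda>z. max (- \<bar>C\<bar>) (min \<bar>C\<bar> (g z))) \<in> borel_measurable borel" using g by simp
  moreover have "\<forall>z. \<bar>max (- \<bar>C\<bar>) (min \<bar>C\<bar> (g z))\<bar> \<le> \<bar>C\<bar>" by (simp add: clamp_abs_le)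
  ultimately show ?thesis
    by (intro exI[of _ "\<lambda>z. max (- \<bar>C\<bar>) (min \<bar>C\<bar> (g z))"] exI[of _ "\<bar>C\<bar>"] conjI) simp_all
qed

lemma Linf_borel_representative:
  assumes "Linf f"
  shows "\<exists>g C. g \<in> borel_measurable borel \<and> 0 \<le> C \<and> (\<forall>x. \<bar>g x\<bar> \<le> C) \<and> (AE x in lborel. g x = f x)"
proof -
  obtain C where m: "f \<in> borel_measurable lebesgue" and C: "AE x in lborel. \<bar>f x\<bar> \<le> C"
    using assms by (auto simp: Linf_def AE_completion_iff)
  obtain g where g: "g \<in> borel_measurable lborel" and ge: "AE x in lborel. f x = g x"
    using completion_ex_borel_measurable_real[OF m] by blast
  from C ge have "AE x in lborel. max (- \<bar>C\<bar>) (min \<bar>C\<bar> (g x)) = f x"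
    by eventually_elim (auto simp: clamp_eq)
  moreover have "(\<lambda>x. max (- \<bar>C\<bar>) (min \<bar>C\<bar> (g x))) \<in> borel_measurable borel" using g by simp
  moreover have "\<forall>x. \<bar>max (- \<bar>C\<bar>) (min \<bar>C\<bar> (g x))\<bar> \<le> \<bar>C\<bar>" by (simp add: clamp_abs_le)
  ultimately show ?thesis
    by (intro exI[of _ "\<lambda>z. max (- \<bar>C\<bar>) (min \<bar>C\<bar> (g z))"] exI[of _ "\<bar>C\<bar>"] conjI) simp_all
qed

section \<open>Entropy inequalities for one solution\<close>

locale adapted_solution = adapted_flux +
  fixes T :: real and u0 :: "real \<Rightarrow> real" and u :: "real \<Rightarrow> real \<Rightarrow> real"
    and U :: "real \<times> real \<Rightarrow> real" and C :: real
  assumes T: "0 < T" and sol: "adapted_entropy_solution A \<Omega> um up T u0 u"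
    and U_borel[measurable]: "U \<in> borel_measurable borel"
    and U_bound: "\<And>z. \<bar>U z\<bar> \<le> C"
    and U_AE: "AE z in lborel. z \<in> Q_dom T \<longrightarrow> U z = u (fst z) (snd z)"
begin

lemma pU_borel[measurable]: "(\<lambda>z. P (snd z) (U z)) \<in> borel_measurable borel"
  by measurable

lemma C_nonneg: "0 \<le> C" using U_bound[of undefined] by linarith

text \<open>The passage from Lebesgue to Borel measure: on \<open>Q_dom T\<close> and off the null
  set over \<Omega> the entropy integrand agrees with \<open>F\<close>, by
  \<open>kruzkov_flux_K\<close>. The integral of the initial datum stays in Lebesgue form, since
  \<open>u0\<close> has no Borel representative at this point.\<close>

lemma entropy_inequality_borel:
  fixes c :: real
  assumes y: "y \<notin> \<Omega>" and \<phi>: "test_function T \<phi>" "smoothC \<phi>"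
  defines "F \<equiv> \<lambda>z. indicator (Q_dom T) z * (\<bar>U z - K (snd z) y c\<bar> * pd_t \<phi> (fst z) (snd z)
      + kruzkov_flux (P (snd z) (U z)) (P y c) * pd_x \<phi> (fst z) (snd z))"
  shows "integrable lborel F" "integrable lebesgue (\<lambda>x. \<bar>u0 x - K x y c\<bar> * \<phi> 0 x)"
    and "0 \<le> (\<integral>z. F z \<partial>lborel) + (\<integral>x. \<bar>u0 x - K x y c\<bar> * \<phi> 0 x \<partial>lebesgue)"
proof -
  let ?E = "entropy_integrand A u \<bar>P y c\<bar> (\<lambda>x. K x y c) \<phi>"
  have E: "set_integrable lebesgue (Q_dom T) ?E"
    "integrable lebesgue (\<lambda>x. \<bar>u0 x - K x y c\<bar> * \<phi> 0 x)"
    "0 \<le> (LINT z:Q_dom T|lebesgue. ?E z) + (LINT x|lebesgue. \<bar>u0 x - K x y c\<bar> * \<phi> 0 x)"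
    using sol[unfolded adapted_entropy_solution_def, THEN conjunct2, THEN conjunct2, rule_format,
        OF abs_ge_zero K_stationary[OF y, of c] \<phi>(1)] by simp_all
  have [measurable]: "(\<lambda>z. pd_t \<phi> (fst z) (snd z)) \<in> borel_measurable borel"
    "(\<lambda>z. pd_x \<phi> (fst z) (snd z)) \<in> borel_measurable borel"
    by (intro borel_measurable_smoothC smoothC_D \<phi>)+
  have F[measurable]: "F \<in> borel_measurable borel" unfolding F_def by measurable
  have Fl: "F \<in> borel_measurable lebesgue" by (intro measurable_completion) simp
  have "AE z in lborel. snd (z :: real \<times> real) \<notin> \<Omega>" by (rule AE_lborel_snd[OF AE_not_\<Omega>])
  with U_AE have "AE z in lborel. indicator (Q_dom T) z *\<^sub>R ?E z = F z"
  proof eventually_elim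
    case (elim z)
    show ?case
    proof (cases "z \<in> Q_dom T")
      case True
      then have "u (fst z) (snd z) = U z" using elim by simp
      then show ?thesis
        using True kruzkov_flux_K[OF elim(2), of "U z" y c]
        by (simp add: F_def entropy_integrand_def case_prod_unfold)
    qed (simp add: F_def)
  qed
  then have ae: "AE z in lebesgue. indicator (Q_dom T) z *\<^sub>R ?E z = F z" by (rule AE_completion)
  have El: "(\<lambda>z. indicator (Q_dom T) z *\<^sub>R ?E z) \<in> borel_measurable lebesgue"
    using E(1) unfolding set_integrable_def by (rule borel_measurable_integrable)
  have "integrable lebesgue F"
    using E(1) unfolding set_integrable_def by (subst (asm) integrable_cong_AE[OF El Fl ae])
  then show "integrable lborel F" by (subst (asm) integrable_completion) simp_all
  have "(LINT z:Q_dom T|lebesgue. ?E z) = integral\<^sup>L lebesgue F"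
    unfolding set_lebesgue_integral_def by (rule integral_cong_AE[OF El Fl ae])
  also have "\<dots> = (\<integral>z. F z \<partial>lborel)" by (rule integral_completion) simp
  finally show "0 \<le> (\<integral>z. F z \<partial>lborel) + (\<integral>x. \<bar>u0 x - K x y c\<bar> * \<phi> 0 x \<partial>lebesgue)"
    using E(3) by simp
  show "integrable lebesgue (\<lambda>x. \<bar>u0 x - K x y c\<bar> * \<phi> 0 x)" by (rule E(2))
qed

lemma ex_not_\<Omega>: "\<exists>y. y \<notin> \<Omega>"
  using negligible_\<Omega> non_negligible_UNIV by (metis UNIV_eq_I)

text \<open>A test function that equals \<open>exp x\<close> on the box singles out the flux term.\<close>

lemma flux_locally_integrable:
  assumes b: "b < T"
  shows "integrable lborel (\<lambda>z. indicator ({0..b} \<times> {c..d}) z * P (snd z) (U z))"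
proof -
  obtain y where y: "y \<notin> \<Omega>" using ex_not_\<Omega> by blast
  \<comment> \<open>A state on the plateau has level 0, and \<open>kruzkov_flux p 0 = p\<close>, so
    the flux term becomes \<open>P\<close> itself.\<close>
  have P0: "P y (um y) = 0" using P_plateau[OF y] um_le_up[OF y] by simp
  \<comment> \<open>Strictly between max 0 b and T: the time cutoff is 1 in a neighbourhood of
    [0,b], so its derivative vanishes there, and its support still ends before T.\<close>
  define b1 where "b1 = (max 0 b + T) / 2"
  define f where "f = cutoff (- 2) (- 1) b1 ((b1 + T) / 2)"
  define g where "g x = exp x * cutoff (c - 2) (c - 1) (d + 1) (d + 2) x" for x
  have b1: "b < b1" "0 < b1" "b1 < T" using b T by (auto simp: b1_def)
  have sf: "smooth1 f" unfolding f_def by (rule smooth1_cutoff)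
  have sg: "smooth1 g" unfolding g_def by (intro smooth1_mult smooth1_exp smooth1_cutoff)
  define \<phi> where "\<phi> t x = f t * g x" for t x
  have s\<phi>: "smoothC \<phi>"
    unfolding \<phi>_def by (intro smoothC_mult smoothC_fst smoothC_snd sf sg)
  have t\<phi>: "test_function T \<phi>"
  proof (rule test_functionI[OF s\<phi>, of "-2" "(b1 + T) / 2" "c - 2" "d + 2"])
    show "(b1 + T) / 2 < T" using b1 by simp
    show "0 \<le> \<phi> t x" for t x by (simp add: \<phi>_def f_def g_def cutoff_bounds)
    show "\<phi> t x = 0" if tx: "(t, x) \<notin> {- 2..(b1 + T) / 2} \<times> {c - 2..d + 2}" for t x
    proof -
      consider "t \<notin> {- 2..(b1 + T) / 2}" | "x \<notin> {c - 2..d + 2}"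
        using tx unfolding mem_Sigma_iff by blast
      then show ?thesis
      proof cases
        case 1
        have "f t = 0" unfolding f_def by (rule cutoff_eq_0) (use 1 b1 in auto)
        then show ?thesis by (simp add: \<phi>_def)
      next
        case 2
        have "cutoff (c - 2) (c - 1) (d + 1) (d + 2) x = 0" by (rule cutoff_eq_0) (use 2 in auto)
        then show ?thesis by (simp add: \<phi>_def g_def)
      qed
    qed
  qed
  define F where "F = (\<lambda>z. indicator (Q_dom T) z * (\<bar>U z - K (snd z) y (um y)\<bar> * pd_t \<phi> (fst z) (snd z)
      + kruzkov_flux (P (snd z) (U z)) (P y (um y)) * pd_x \<phi> (fst z) (snd z)))"
  have iF: "integrable lborel F" unfolding F_def by (rule entropy_inequality_borel(1)[OF y t\<phi> s\<phi>])
  have Fbox: "F (t, x) = P x (U (t, x)) * exp x" if "t \<in> {0..b}" "x \<in> {c..d}" for t x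
  proof -
    have "deriv f t = 0" "f t = 1"
      unfolding f_def using that b1 by (auto intro!: deriv_cutoff_0 cutoff_eq_1)
    moreover have "(g has_real_derivative (exp x * 1 + 0 * exp x)) (at x)"
    proof -
      have "(cutoff (c - 2) (c - 1) (d + 1) (d + 2) has_real_derivative 0) (at x)"
        using smooth1_deriv(1)[OF smooth1_cutoff[of "c - 2" "c - 1" "d + 1" "d + 2"], of x]
          deriv_cutoff_0[of "c - 2" "c - 1" "d + 1" "d + 2" x] that by simp
      from DERIV_mult[OF DERIV_exp this] show ?thesis
        unfolding g_def[abs_def] using cutoff_eq_1[of "c - 2" "c - 1" "d + 1" "d + 2" x] that by simp
    qed
    then have "deriv g x = exp x" using DERIV_imp_deriv by fastforce
    moreover have "kruzkov_flux p 0 = p" for p by (simp add: kruzkov_flux_def max_def min_def)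
    ultimately show ?thesis
      using that b1 unfolding F_def \<phi>_def[abs_def] pd_product[OF sf sg] P0 by simp
  qed
  show ?thesis
  proof (rule Bochner_Integration.integrable_bound[OF integrable_mult_right[OF iF, of "exp (- c)"]])
    have "\<bar>indicator ({0..b} \<times> {c..d}) z * P (snd z) (U z)\<bar> \<le> \<bar>exp (- c) * F z\<bar>" for z
    proof (cases "z \<in> {0..b} \<times> {c..d}")
      case True
      then have z: "fst z \<in> {0..b}" "snd z \<in> {c..d}" by auto
      have "\<bar>exp (- c) * F z\<bar> = \<bar>P (snd z) (U z)\<bar> * exp (snd z - c)"
        using Fbox[OF z] by (simp add: abs_mult exp_diff exp_minus field_simps)
      moreover have "\<bar>P (snd z) (U z)\<bar> * 1 \<le> \<bar>P (snd z) (U z)\<bar> * exp (snd z - c)"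
        using z by (intro mult_left_mono) auto
      ultimately show ?thesis using True by simp
    qed simp
    then show "AE z in lborel. norm (indicator ({0..b} \<times> {c..d}) z * P (snd z) (U z)) \<le> norm (exp (- c) * F z)"
      by (intro AE_I2) simp
    show "(\<lambda>z. indicator ({0..b} \<times> {c..d}) z * P (snd z) (U z)) \<in> borel_measurable lborel"
      by (intro borel_measurable_times borel_measurable_indicator) (simp_all add: pU_borel Icc_Times_borel)
  qed
qed

text \<open>Subtracting \<open>\<bar>K\<bar>\<close>, whose contribution \<open>\<integral> \<bar>K\<bar> \<phi>\<^sub>t\<close> vanishes because \<open>K\<close> does not depend on time,
  makes the first factor bounded by \<open>C\<close> although \<open>K\<close> itself may be unbounded.\<close>

lemma entropy_inequality_interior:
  assumes y: "y \<notin> \<Omega>" and s\<phi>: "smoothC \<phi>" and nn: "\<And>t x. 0 \<le> \<phi> t x"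
    and supp: "\<And>t x. (t, x) \<notin> {a..b} \<times> {l..r} \<Longrightarrow> \<phi> t x = 0" and ab: "0 < a" "b < T"
  shows "0 \<le> (\<integral>z. (\<bar>U z - K (snd z) y c\<bar> - \<bar>K (snd z) y c\<bar>) * pd_t \<phi> (fst z) (snd z)
      + kruzkov_flux (P (snd z) (U z)) (P y c) * pd_x \<phi> (fst z) (snd z) \<partial>lborel)"
proof -
  let ?B = "{a..b} \<times> {l..r}"
  let ?t = "\<lambda>z. pd_t \<phi> (fst z) (snd z)" and ?x = "\<lambda>z. pd_x \<phi> (fst z) (snd z)"
  let ?k = "\<lambda>z :: real \<times> real. K (snd z) y c" and ?f = "\<lambda>z. kruzkov_flux (P (snd z) (U z)) (P y c)"
  have t\<phi>: "test_function T \<phi>" by (rule test_functionI[OF s\<phi> supp ab(2) nn])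
  have st: "smoothC (pd_t \<phi>)" and sx: "smoothC (pd_x \<phi>)" by (rule smoothC_D[OF s\<phi>])+
  have zt: "pd_t \<phi> t x = 0" and zx: "pd_x \<phi> t x = 0" if "(t, x) \<notin> ?B" for t x
    using pd_zero_outside[OF supp that] by auto
  have zt': "?t z = 0" and zx': "?x z = 0" if "z \<notin> ?B" for z
    using zt[of "fst z" "snd z"] zx[of "fst z" "snd z"] that by (simp_all add: mem_Times_iff)
  obtain Ct where Ct: "\<And>t x. \<bar>pd_t \<phi> t x\<bar> \<le> Ct" using smoothC_bounded[OF st, of a b l r] zt by blast
  obtain Cx where Cx: "0 \<le> Cx" "\<And>t x. \<bar>pd_x \<phi> t x\<bar> \<le> Cx" using smoothC_bounded[OF sx, of a b l r] zx by blast
  have [measurable]: "?t \<in> borel_measurable borel" "?x \<in> borel_measurable borel"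
    by (intro borel_measurable_smoothC st sx)+
  have B: "bounded ?B" by (intro bounded_Times) auto
  have it: "integrable lborel ?t"
    by (rule integrable_lborel_bounded_support[OF _ Ct B zt']) measurable
  have ix: "integrable lborel ?x"
    by (rule integrable_lborel_bounded_support[OF _ Cx(2) B zx']) measurable
  let ?F = "\<lambda>z. indicator (Q_dom T) z * (\<bar>U z - ?k z\<bar> * ?t z + ?f z * ?x z)"
  have F: "?F = (\<lambda>z. \<bar>U z - ?k z\<bar> * ?t z + ?f z * ?x z)"
  proof
    fix z show "?F z = \<bar>U z - ?k z\<bar> * ?t z + ?f z * ?x z"
      using zt[of "fst z" "snd z"] zx[of "fst z" "snd z"] ab
      by (cases "z \<in> ?B") (auto simp: indicator_def mem_Times_iff)
  qed
  have \<phi>0: "\<phi> 0 x = 0" for x using supp[of 0 x] ab by auto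
  have iF: "integrable lborel (\<lambda>z. \<bar>U z - ?k z\<bar> * ?t z + ?f z * ?x z)"
    and F0: "0 \<le> (\<integral>z. \<bar>U z - ?k z\<bar> * ?t z + ?f z * ?x z \<partial>lborel)"
    using entropy_inequality_borel(1,3)[OF y t\<phi> s\<phi>, of c] by (simp_all add: F \<phi>0)
  have ifx: "integrable lborel (\<lambda>z. ?f z * ?x z)"
  proof (rule integrable_dominated)
    show "integrable lborel (\<lambda>z. Cx * \<bar>indicator ({0..b} \<times> {l..r}) z * P (snd z) (U z)\<bar> + \<bar>P y c\<bar> * \<bar>?x z\<bar>)"
      by (intro Bochner_Integration.integrable_add integrable_mult_right integrable_abs
         flux_locally_integrable[OF ab(2)] ix)
    show "\<bar>?f z * ?x z\<bar> \<le> Cx * \<bar>indicator ({0..b} \<times> {l..r}) z * P (snd z) (U z)\<bar> + \<bar>P y c\<bar> * \<bar>?x z\<bar>" for z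
    proof (cases "z \<in> ?B")
      case True
      then have z: "z \<in> {0..b} \<times> {l..r}" using ab by (auto simp: mem_Times_iff)
      have "\<bar>?f z * ?x z\<bar> \<le> (\<bar>P (snd z) (U z)\<bar> + \<bar>P y c\<bar>) * \<bar>?x z\<bar>"
        unfolding abs_mult by (intro mult_right_mono kruzkov_flux_le) simp
      also have "\<dots> \<le> \<bar>P (snd z) (U z)\<bar> * Cx + \<bar>P y c\<bar> * \<bar>?x z\<bar>"
        unfolding distrib_right by (intro add_mono mult_left_mono Cx) auto
      finally show ?thesis using z by (simp add: mult.commute)
    next
      case False
      then show ?thesis using zx[of "fst z" "snd z"] Cx by simp
    qed
  qed measurable
  \<comment> \<open>The definition of a solution makes only the sum of the two terms integrable.
    Local integrability of the flux separates them, and |K| \<le> |U - K| + C then passes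
    integrability on to the term with |K|.\<close>
  have iut: "integrable lborel (\<lambda>z. \<bar>U z - ?k z\<bar> * ?t z)"
    using Bochner_Integration.integrable_diff[OF iF ifx] by simp
  have ikt: "integrable lborel (\<lambda>z. \<bar>?k z\<bar> * ?t z)"
  proof (rule integrable_dominated)
    show "integrable lborel (\<lambda>z. \<bar>\<bar>U z - ?k z\<bar> * ?t z\<bar> + C * \<bar>?t z\<bar>)"
      by (intro Bochner_Integration.integrable_add integrable_mult_right integrable_abs iut it)
    show "\<bar>\<bar>?k z\<bar> * ?t z\<bar> \<le> \<bar>\<bar>U z - ?k z\<bar> * ?t z\<bar> + C * \<bar>?t z\<bar>" for z
    proof -
      have "\<bar>?k z\<bar> \<le> \<bar>U z - ?k z\<bar> + C" using U_bound[of z] by linarith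
      from mult_right_mono[OF this abs_ge_zero[of "?t z"]] show ?thesis by (simp add: abs_mult algebra_simps)
    qed
  qed measurable
  have "(\<integral>z. \<bar>?k z\<bar> * ?t z \<partial>lborel) = (\<integral>x. (\<integral>t. \<bar>K x y c\<bar> * pd_t \<phi> t x \<partial>lborel) \<partial>lborel)"
    using lborel_Fubini(6)[OF ikt] by simp
  also have "\<dots> = (\<integral>x. 0 \<partial>(lborel :: real measure))"
  proof (intro Bochner_Integration.integral_cong refl)
    fix x
    have "isCont (\<lambda>t. pd_t \<phi> t x) t" for t
      using smoothC_pd(1)[OF st, of x t] by (rule DERIV_isCont)
    then have "(\<integral>t. pd_t \<phi> t x \<partial>lborel) = 0"
      by (intro integral_deriv_compact_support[OF smoothC_pd(1)[OF s\<phi>], of _ a b]) (use supp zt in auto)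
    then show "(\<integral>t. \<bar>K x y c\<bar> * pd_t \<phi> t x \<partial>lborel) = 0" by simp
  qed
  finally have k0: "(\<integral>z. \<bar>?k z\<bar> * ?t z \<partial>lborel) = 0" by simp
  have "(\<integral>z. (\<bar>U z - ?k z\<bar> - \<bar>?k z\<bar>) * ?t z + ?f z * ?x z \<partial>lborel)
      = (\<integral>z. (\<bar>U z - ?k z\<bar> * ?t z + ?f z * ?x z) - \<bar>?k z\<bar> * ?t z \<partial>lborel)"
    by (intro Bochner_Integration.integral_cong refl) (simp add: algebra_simps)
  also have "\<dots> = (\<integral>z. \<bar>U z - ?k z\<bar> * ?t z + ?f z * ?x z \<partial>lborel) - (\<integral>z. \<bar>?k z\<bar> * ?t z \<partial>lborel)"
    by (rule Bochner_Integration.integral_diff[OF iF ikt])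
  finally show ?thesis using F0 k0 by simp
qed

end

section \<open>Doubling of variables\<close>

definition moll :: "real \<Rightarrow> real \<Rightarrow> real" where
  "moll n r = n * bump (n * r)"

lemma smooth1_moll: "smooth1 (moll n)"
  using smooth1_mult[OF smooth1_const[of n] smooth1_affine[OF smooth1_bump, of n 0]]
  by (simp add: moll_def[abs_def])

lemma smooth1_moll_shift: "smooth1 (\<lambda>t. moll n (t - s))" "smooth1 (\<lambda>s. moll n (t - s))"
  using smooth1_affine[OF smooth1_moll, of n 1 "- s"] smooth1_affine[OF smooth1_moll, of n "- 1" t]
  by (simp_all add: algebra_simps)

lemma deriv_moll_shift:
  "deriv (\<lambda>t. moll n (t - s)) t = deriv (moll n) (t - s)"
  "deriv (\<lambda>s. moll n (t - s)) s = - deriv (moll n) (t - s)"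
proof -
  note d = smooth1_deriv(1)[OF smooth1_moll, of n "t - s"]
  have "((\<lambda>t. moll n (t - s)) has_real_derivative deriv (moll n) (t - s) * 1) (at t)"
    by (rule DERIV_chain2[where f="moll n" and g="\<lambda>t. t - s", OF d]) (auto intro!: derivative_eq_intros)
  then show "deriv (\<lambda>t. moll n (t - s)) t = deriv (moll n) (t - s)" by (auto dest: DERIV_imp_deriv)
  have "((\<lambda>s. moll n (t - s)) has_real_derivative deriv (moll n) (t - s) * - 1) (at s)"
    by (rule DERIV_chain2[where f="moll n" and g="\<lambda>s. t - s", OF d]) (auto intro!: derivative_eq_intros)
  then show "deriv (\<lambda>s. moll n (t - s)) s = - deriv (moll n) (t - s)" by (auto dest: DERIV_imp_deriv)
qed

lemma moll_nonneg: "0 \<le> n \<Longrightarrow> 0 \<le> moll n r"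
  by (simp add: moll_def bump_nonneg)

text \<open>The support lies to the right of 0, so in a kernel in t - s the time s precedes t. A
  support in t that ends before T then bounds s as well, and only the distance to time 0 has to be
  watched.\<close>

lemma moll_support: "0 < n \<Longrightarrow> moll n r \<noteq> 0 \<Longrightarrow> 0 < r \<and> r < 1 / n"
proof -
  assume n: "0 < n" and "moll n r \<noteq> 0"
  then have "\<not> n * r \<le> 0" "\<not> 1 \<le> n * r"
    using bump_0[of "n * r"] bump_1[of "n * r"] by (auto simp: moll_def)
  then show ?thesis using n by (simp add: field_simps zero_less_mult_iff not_le)
qed

lemma deriv_zero_outside:
  fixes f :: "real \<Rightarrow> real"
  assumes "\<And>x. x \<notin> {a..b} \<Longrightarrow> f x = 0" "x \<notin> {a..b}"
  shows "deriv f x = 0"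
proof (rule DERIV_imp_deriv)
  have "\<forall>\<^sub>F y in nhds x. f y = 0"
    by (rule eventually_mono[OF eventually_nhds_in_open[of "- {a..b}" x]]) (use assms in auto)
  then show "(f has_real_derivative 0) (at x)"
    by (subst DERIV_cong_ev[OF refl _ refl, where g="\<lambda>s. 0"]) auto
qed

lemma moll_zero_outside: "0 < n \<Longrightarrow> r \<notin> {0..1 / n} \<Longrightarrow> moll n r = 0"
  using moll_support[of n r] by (cases "moll n r = 0") auto

lemma deriv_moll_support: "0 < n \<Longrightarrow> deriv (moll n) r \<noteq> 0 \<Longrightarrow> 0 \<le> r \<and> r \<le> 1 / n"
  using deriv_zero_outside[of 0 "1 / n" "moll n" r] moll_zero_outside[of n] by auto

lemma smooth1_bounded:
  assumes "smooth1 f" and z: "\<And>x. x \<notin> {a..b} \<Longrightarrow> f x = 0"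
  shows "\<exists>M\<ge>0. \<forall>x. \<bar>f x\<bar> \<le> M"
proof -
  have "compact (f ` {a..b})"
    by (intro compact_continuous_image continuous_on_smooth1 assms compact_Icc)
  then obtain M where M: "\<And>x. x \<in> {a..b} \<Longrightarrow> \<bar>f x\<bar> \<le> M"
    by (force dest: compact_imp_bounded simp: bounded_iff)
  have "\<bar>f x\<bar> \<le> max M 0" for x
    using M[of x] z[of x] by (cases "x \<in> {a..b}") (auto simp: max_def)
  then show ?thesis by (intro exI[of _ "max M 0"]) auto
qed

lemma moll_bounded: "0 < n \<Longrightarrow> \<exists>M\<ge>0. \<forall>r. \<bar>moll n r\<bar> \<le> M"
  by (rule smooth1_bounded[OF smooth1_moll, of 0 "1 / n"]) (rule moll_zero_outside)

lemma deriv_moll_bounded: "0 < n \<Longrightarrow> \<exists>M\<ge>0. \<forall>r. \<bar>deriv (moll n) r\<bar> \<le> M"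
  by (rule smooth1_bounded[OF smooth1_deriv(2)[OF smooth1_moll], of 0 "1 / n"])
    (rule deriv_zero_outside[OF moll_zero_outside])

lemma moll_borel[measurable]: "moll n \<in> borel_measurable borel"
  and deriv_moll_borel[measurable]: "deriv (moll n) \<in> borel_measurable borel"
  by (intro borel_measurable_smooth1 smooth1_moll smooth1_deriv)+

lemma integral_moll:
  assumes "0 < n"
  shows "integrable lborel (moll n)" "(\<integral>r. moll n r \<partial>lborel) = 1"
proof -
  have b: "integrable lborel bump" "(\<integral>r. bump r \<partial>lborel) = 1"
    using has_bochner_integral_bump by (auto simp: has_bochner_integral_iff)
  have "integrable lborel (\<lambda>r. bump (0 + n * r))"
    using b(1) assms by (intro lborel_integrable_real_affine) auto
  then show "integrable lborel (moll n)" unfolding moll_def[abs_def] by simp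
  show "(\<integral>r. moll n r \<partial>lborel) = 1"
    using lborel_integral_real_affine[of n bump 0] b(2) assms by (simp add: moll_def[abs_def])
qed

lemma integral_moll_shift:
  assumes "0 < n"
  shows "integrable lborel (\<lambda>t. moll n (t - s))" "(\<integral>t. moll n (t - s) \<partial>lborel) = 1"
    and "integrable lborel (\<lambda>s. moll n (t - s))" "(\<integral>s. moll n (t - s) \<partial>lborel) = 1"
  using integrable_lborel_translation[OF integral_moll(1)[OF assms], of "- s"]
    integrable_lborel_reflect[OF integral_moll(1)[OF assms], of t] integral_moll(2)[OF assms] by simp_all

lemma integral_pd_t_eq_0:
  assumes s: "smoothC \<phi>" and supp: "\<And>t x. (t, x) \<notin> {a..b} \<times> {l..r} \<Longrightarrow> \<phi> t x = 0"
  shows "(\<integral>z. pd_t \<phi> (fst z) (snd z) \<partial>lborel) = 0"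
proof -
  have st: "smoothC (pd_t \<phi>)" by (rule smoothC_D[OF s])
  have zt: "pd_t \<phi> t x = 0" if "(t, x) \<notin> {a..b} \<times> {l..r}" for t x
    using pd_zero_outside(1)[OF supp that] by auto
  obtain M where M: "\<And>t x. \<bar>pd_t \<phi> t x\<bar> \<le> M" using smoothC_bounded[OF st, of a b l r] zt by blast
  have "integrable lborel (\<lambda>z. pd_t \<phi> (fst z) (snd z))"
  proof (rule integrable_lborel_bounded_support[OF borel_measurable_smoothC[OF st] M])
    show "bounded ({a..b} \<times> {l..r})" by (intro bounded_Times) auto
    show "pd_t \<phi> (fst z) (snd z) = 0" if "z \<notin> {a..b} \<times> {l..r}" for z
      using zt[of "fst z" "snd z"] that by (simp add: mem_Times_iff)
  qed
  from lborel_Fubini(6)[OF this]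
  have "(\<integral>z. pd_t \<phi> (fst z) (snd z) \<partial>lborel) = (\<integral>x. (\<integral>t. pd_t \<phi> t x \<partial>lborel) \<partial>lborel)" by simp
  also have "\<dots> = (\<integral>x. 0 \<partial>(lborel :: real measure))"
  proof (intro Bochner_Integration.integral_cong refl)
    fix x
    have "isCont (\<lambda>t. pd_t \<phi> t x) t" for t
      using smoothC_pd(1)[OF st, of x t] by (rule DERIV_isCont)
    then show "(\<integral>t. pd_t \<phi> t x \<partial>lborel) = 0"
      by (intro integral_deriv_compact_support[OF smoothC_pd(1)[OF s], of _ a b]) (use supp zt in auto)
  qed
  finally show ?thesis by simp
qed

text \<open>Supplies the uniform mass bound required by
  \<open>concentrating_kernel_tendsto_0\<close> for a kernel that concentrates in space only: the
  time variable contributes the length b - a.\<close>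

lemma strip_kernel:
  fixes f :: "real \<Rightarrow> real"
  assumes f: "integrable lborel f" "\<And>x. 0 \<le> f x" "(\<integral>x. f x \<partial>lborel) = 1" and ab: "a \<le> b"
  shows "integrable lborel (\<lambda>z. indicator ({a..b} \<times> {l..r}) z * f (snd z))"
    and "(\<integral>z. indicator ({a..b} \<times> {l..r}) z * f (snd z) \<partial>lborel) \<le> b - a"
proof -
  have [measurable]: "f \<in> borel_measurable borel" using f(1) by simp
  have i1: "integrable lborel (indicat_real {a..b})" by (intro integrable_real_indicator emeasure_bounded_finite) auto
  note i = integral_lborel_times[OF i1 f(1)]
  have le: "indicator ({a..b} \<times> {l..r}) z * f (snd z) \<le> indicat_real {a..b} (fst z) * f (snd z)" for z
    using f(2) by (auto simp: indicator_def mem_Times_iff)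
  have nn: "0 \<le> indicator ({a..b} \<times> {l..r}) z * f (snd z)" for z using f(2) by simp
  show ii: "integrable lborel (\<lambda>z. indicator ({a..b} \<times> {l..r}) z * f (snd z))"
  proof (rule Bochner_Integration.integrable_bound[OF i(1)])
    show "AE z in lborel. norm (indicator ({a..b} \<times> {l..r}) z * f (snd z)) \<le> norm (indicat_real {a..b} (fst z) * f (snd z))"
      using le nn f(2) by (intro AE_I2) (simp add: abs_of_nonneg)
    show "(\<lambda>z. indicator ({a..b} \<times> {l..r}) z * f (snd z)) \<in> borel_measurable lborel"
      by (intro borel_measurable_times borel_measurable_indicator) (simp_all add: Icc_Times_borel)
  qed
  have "(\<integral>z. indicator ({a..b} \<times> {l..r}) z * f (snd z) \<partial>lborel)
     \<le> (\<integral>z. indicat_real {a..b} (fst z) * f (snd z) \<partial>lborel)"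
    by (intro integral_mono ii i(1) le)
  then show "(\<integral>z. indicator ({a..b} \<times> {l..r}) z * f (snd z) \<partial>lborel) \<le> b - a"
    using i(2) f(3) ab by simp
qed

lemma (in adapted_solution) flux_integrable_on_box:
  assumes "0 \<le> a" "b < T"
  shows "integrable lborel (\<lambda>z. indicator ({a..b} \<times> {c..d}) z * P (snd z) (U z))"
proof (rule Bochner_Integration.integrable_bound[OF flux_locally_integrable[OF assms(2), of c d]])
  have "\<bar>indicator ({a..b} \<times> {c..d}) z * P (snd z) (U z)\<bar> \<le> \<bar>indicator ({0..b} \<times> {c..d}) z * P (snd z) (U z)\<bar>" for z
    using assms(1) by (auto simp: indicator_def)
  then show "AE z in lborel. norm (indicator ({a..b} \<times> {c..d}) z * P (snd z) (U z))
      \<le> norm (indicator ({0..b} \<times> {c..d}) z * P (snd z) (U z))" by simp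
  show "(\<lambda>z. indicator ({a..b} \<times> {c..d}) z * P (snd z) (U z)) \<in> borel_measurable lborel"
    by (intro borel_measurable_times borel_measurable_indicator) (simp_all add: pU_borel Icc_Times_borel)
qed

text \<open>The first bound is small when \<open>k\<close> is close to \<open>c\<close>. The second
  holds for every \<open>k\<close>, since each renormalised entropy |w - k| - |k| is at most |w| in
  modulus.\<close>

lemma renormalized_entropy_diff:
  fixes w k c :: real
  assumes "\<bar>w\<bar> \<le> C"
  shows "\<bar>\<bar>w - k\<bar> - \<bar>k\<bar> - (\<bar>w - c\<bar> - \<bar>c\<bar>)\<bar> \<le> min (2 * \<bar>k - c\<bar>) (2 * C)"
proof -
  have "\<bar>\<bar>w - k\<bar> - \<bar>w - c\<bar>\<bar> \<le> \<bar>k - c\<bar>" "\<bar>\<bar>k\<bar> - \<bar>c\<bar>\<bar> \<le> \<bar>k - c\<bar>"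
    using abs_triangle_ineq3[of "w - k" "w - c"] abs_triangle_ineq3[of k c] by (simp_all add: abs_minus_commute)
  moreover have "\<bar>\<bar>w - k\<bar> - \<bar>k\<bar>\<bar> \<le> C" "\<bar>\<bar>w - c\<bar> - \<bar>c\<bar>\<bar> \<le> C"
    using abs_triangle_ineq3[of "w - k" "- k"] abs_triangle_ineq3[of "w - c" "- c"] assms by simp_all
  ultimately show ?thesis by (smt (verit))
qed

section \<open>Two solutions with a common bound\<close>

locale adapted_pair =
  S: adapted_solution A \<Omega> lip um up T u0 u U C + R: adapted_solution A \<Omega> lip um up T v0 v V C
  for A \<Omega> lip um up T u0 u U C v0 v V
begin

abbreviation "p z \<equiv> S.P (snd z) (U z)"
abbreviation "p' w \<equiv> S.P (snd w) (V w)"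

text \<open>The doubled inequality uses kernels of widths \<open>1/m\<close> in time and \<open>1/n\<close> in space. The errors
  \<open>G1\<close>, \<open>G2\<close> are cut off at \<open>2 * C\<close> since \<open>K\<close> may be unbounded. They are multiplied by the derivative
  of the time kernel, so they vanish only if \<open>n \<rightarrow> \<infinity>\<close> for fixed \<open>m\<close>.\<close>

definition G1 :: "(real \<times> real) \<times> (real \<times> real) \<Rightarrow> real" where
  "G1 q = min (2 * \<bar>S.K (snd (fst q)) (snd (snd q)) (V (snd q)) - V (snd q)\<bar>) (2 * C)"
definition G2 :: "(real \<times> real) \<times> (real \<times> real) \<Rightarrow> real" where
  "G2 q = min (2 * \<bar>S.K (snd (snd q)) (snd (fst q)) (U (fst q)) - U (fst q)\<bar>) (2 * C)"

lemma G_borel[measurable]: "G1 \<in> borel_measurable borel" "G2 \<in> borel_measurable borel"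
  unfolding G1_def[abs_def] G2_def[abs_def] by measurable

lemma G_bounds: "0 \<le> G1 q" "G1 q \<le> 2 * C" "0 \<le> G2 q" "G2 q \<le> 2 * C"
  using S.C_nonneg by (auto simp: G1_def G2_def)

text \<open>The inequality for u is used with the state \<open>K x y (V (s, y))\<close> and
  integrated over (s,y), the one for v with the state \<open>K y x (U (t, x))\<close> and integrated
  over (t,x). Since \<open>\<psi>\<close> depends on (t,x) only, the second inequality
  differentiates just the kernels. \<open>G1\<close> accompanies the derivative of
  \<open>\<psi>\<close> and that of the time kernel, \<open>G2\<close> only the latter; hence the
  coefficients \<open>2 * C1 * Mm\<close> and \<open>C1 * Mm\<close>.\<close>

lemma doubling_inequality:
  assumes s\<psi>: "smoothC \<psi>" and nn: "\<And>t x. 0 \<le> \<psi> t x"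
    and supp: "\<And>t x. (t, x) \<notin> {a..b} \<times> {l..r} \<Longrightarrow> \<psi> t x = 0" and ab: "0 < a" "a \<le> b" "b < T"
    and m: "0 < m" "1 / m \<le> a / 2" and n: "1 \<le> n"
    and C1: "0 \<le> C1" "\<And>t x. \<bar>pd_t \<psi> t x\<bar> \<le> C1" "\<And>t x. \<bar>pd_x \<psi> t x\<bar> \<le> C1" "\<And>t x. \<bar>\<psi> t x\<bar> \<le> C1"
    and Mm: "0 \<le> Mm" "\<And>r. \<bar>moll m r\<bar> \<le> Mm" "\<And>r. \<bar>deriv (moll m) r\<bar> \<le> Mm"
  defines "B \<equiv> {a..b} \<times> {l..r}" and "B' \<equiv> {a / 2..b} \<times> {l - 1..r + 1}"
  defines "\<kappa> \<equiv> \<lambda>q. moll m (fst (fst q) - fst (snd q)) * moll n (snd (fst q) - snd (snd q))"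
  defines "ker \<equiv> \<lambda>q. indicator B (fst q) * indicator B' (snd q) * moll n (snd (fst q) - snd (snd q))"
  defines "M1 \<equiv> \<lambda>q. (\<bar>U (fst q) - V (snd q)\<bar> * pd_t \<psi> (fst (fst q)) (snd (fst q))
        + kruzkov_flux (p (fst q)) (p' (snd q)) * pd_x \<psi> (fst (fst q)) (snd (fst q))) * \<kappa> q"
  shows "integrable lborel M1" "integrable lborel ker"
    and "0 \<le> (\<integral>q. M1 q \<partial>lborel) + 2 * C1 * Mm * (\<integral>q. G1 q * ker q \<partial>lborel) + C1 * Mm * (\<integral>q. G2 q * ker q \<partial>lborel)"
proof -
  have n0: "0 < n" using n by simp
  obtain Mn where Mn: "0 \<le> Mn" "\<And>r. \<bar>moll n r\<bar> \<le> Mn" using moll_bounded[OF n0] by blast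
  obtain Mn' where Mn': "0 \<le> Mn'" "\<And>r. \<bar>deriv (moll n) r\<bar> \<le> Mn'" using deriv_moll_bounded[OF n0] by blast
  define t x s y where "t q = fst (fst q)" and "x q = snd (fst q)" and "s q = fst (snd q)" and "y q = snd (snd q)"
    for q :: "(real \<times> real) \<times> (real \<times> real)"
  note txsy = t_def x_def s_def y_def
  have [measurable]: "t \<in> borel_measurable borel" "x \<in> borel_measurable borel"
    "s \<in> borel_measurable borel" "y \<in> borel_measurable borel"
    unfolding txsy[abs_def] by measurable
  define pt px p0 where "pt q = pd_t \<psi> (t q) (x q)" and "px q = pd_x \<psi> (t q) (x q)" and "p0 q = \<psi> (t q) (x q)" for q
  have bm: "(\<lambda>q. f (t q) (x q)) \<in> borel_measurable borel" if "smoothC f" for f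
    using measurable_compose[OF fst_borel borel_measurable_smoothC[OF that]] by (simp add: txsy)
  have [measurable]: "pt \<in> borel_measurable borel" "px \<in> borel_measurable borel" "p0 \<in> borel_measurable borel"
    unfolding pt_def[abs_def] px_def[abs_def] p0_def[abs_def] by (intro bm smoothC_D s\<psi>)+
  \<comment> \<open>\<open>\<theta>\<close> and \<open>\<xi>\<close> collect the derivatives that
    fall on the time kernel and on the space kernel. \<open>\<theta>\<close> has to be estimated,
    \<open>\<xi>\<close> will cancel.\<close>
  define \<theta> where "\<theta> q = p0 q * deriv (moll m) (t q - s q) * moll n (x q - y q)" for q
  define \<xi> where "\<xi> q = p0 q * moll m (t q - s q) * deriv (moll n) (x q - y q)" for q
  have \<kappa>q: "\<kappa> q = moll m (t q - s q) * moll n (x q - y q)" for q by (simp add: \<kappa>_def txsy)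
  have [measurable]: "\<theta> \<in> borel_measurable borel" "\<xi> \<in> borel_measurable borel" "\<kappa> \<in> borel_measurable borel"
    unfolding \<theta>_def[abs_def] \<xi>_def[abs_def] \<kappa>q[abs_def] by measurable
  \<comment> \<open>The one-sided kernels place (s,y) below (t,x) by at most 1/m in time and 1/n in
    space; 1/m \<le> a/2 and 1/n \<le> 1 account for the margins of \<open>B'\<close>.\<close>
  have B'I: "snd q \<in> B'" if "fst q \<in> B" "0 \<le> t q - s q" "t q - s q \<le> 1 / m" "0 \<le> x q - y q" "x q - y q \<le> 1 / n" for q
  proof -
    have "1 / n \<le> 1" using n by simp
    then show ?thesis using that m(2) unfolding B_def B'_def txsy mem_Times_iff atLeastAtMost_iff by linarith
  qed
  have kn: "0 \<le> r \<and> r \<le> 1 / n" if "moll n r \<noteq> 0 \<or> deriv (moll n) r \<noteq> 0" for r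
    using that moll_support[OF n0, of r] deriv_moll_support[OF n0, of r] by auto
  have km: "0 \<le> r \<and> r \<le> 1 / m" if "moll m r \<noteq> 0 \<or> deriv (moll m) r \<noteq> 0" for r
    using that moll_support[OF m(1), of r] deriv_moll_support[OF m(1), of r] by auto
  have zB: "pt q = 0" "px q = 0" "p0 q = 0" if "fst q \<notin> B" for q
  proof -
    have "(t q, x q) \<notin> {a..b} \<times> {l..r}" using that by (auto simp: B_def txsy mem_Times_iff)
    from pd_zero_outside[of a b l r \<psi>, OF supp this] supp[OF this]
    show "pt q = 0" "px q = 0" "p0 q = 0" by (simp_all add: pt_def px_def p0_def)
  qed
  have BB: "bounded (B \<times> B')" unfolding B_def B'_def by (intro bounded_Times) auto
  have suppBB: "pt q * \<kappa> q = 0" "px q * \<kappa> q = 0" "\<theta> q = 0" "\<xi> q = 0" if "q \<notin> B \<times> B'" for q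
  proof -
    have "fst q \<notin> B \<or> (moll m (t q - s q) = 0 \<and> deriv (moll m) (t q - s q) = 0)
       \<or> (moll n (x q - y q) = 0 \<and> deriv (moll n) (x q - y q) = 0)"
      using that B'I[of q] kn[of "x q - y q"] km[of "t q - s q"] by (auto simp: mem_Times_iff)
    then show "pt q * \<kappa> q = 0" "px q * \<kappa> q = 0" "\<theta> q = 0" "\<xi> q = 0"
      using zB[of q] by (auto simp: \<kappa>q \<theta>_def \<xi>_def)
  qed
  have bp: "\<bar>pt q\<bar> \<le> C1" "\<bar>px q\<bar> \<le> C1" "\<bar>p0 q\<bar> \<le> C1" for q using C1 by (auto simp: pt_def px_def p0_def)
  have bk: "\<bar>\<kappa> q\<bar> \<le> Mm * Mn" for q
    unfolding \<kappa>q abs_mult by (intro mult_mono Mm Mn) auto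
  have b\<theta>: "\<bar>\<theta> q\<bar> \<le> C1 * Mm * Mn" "\<bar>\<xi> q\<bar> \<le> C1 * Mm * Mn'" for q
    unfolding \<theta>_def \<xi>_def abs_mult by (intro mult_mono bp Mm Mn Mn' C1 mult_nonneg_nonneg; simp)+
  have bptk: "\<bar>pt q * \<kappa> q\<bar> \<le> C1 * (Mm * Mn)" "\<bar>px q * \<kappa> q\<bar> \<le> C1 * (Mm * Mn)" for q
    unfolding abs_mult by (intro mult_mono bp bk C1; simp)+
  define good where "good f \<longleftrightarrow> f \<in> borel_measurable borel \<and> (\<exists>M. \<forall>q. \<bar>f q\<bar> \<le> M) \<and> (\<forall>q. q \<notin> B \<times> B' \<longrightarrow> f q = 0)"
    for f :: "(real \<times> real) \<times> (real \<times> real) \<Rightarrow> real"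
  have goods: "good (\<lambda>q. pt q * \<kappa> q)" "good (\<lambda>q. px q * \<kappa> q)" "good \<theta>" "good \<xi>"
  proof -
    have goodI: "good f" if "f \<in> borel_measurable borel" "\<And>q. \<bar>f q\<bar> \<le> M" "\<And>q. q \<notin> B \<times> B' \<Longrightarrow> f q = 0" for f M
      using that unfolding good_def by blast
    show "good (\<lambda>q. pt q * \<kappa> q)" by (rule goodI[OF _ bptk(1) suppBB(1)]) measurable
    show "good (\<lambda>q. px q * \<kappa> q)" by (rule goodI[OF _ bptk(2) suppBB(2)]) measurable
    show "good \<theta>" by (rule goodI[OF _ b\<theta>(1) suppBB(3)]) measurable
    show "good \<xi>" by (rule goodI[OF _ b\<theta>(2) suppBB(4)]) measurable
  qed
  have int_good: "integrable lborel f" if "good f" for f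
  proof -
    obtain M where M: "\<And>q. \<bar>f q\<bar> \<le> M" using \<open>good f\<close> unfolding good_def by auto
    show ?thesis
      by (rule integrable_lborel_bounded_support[OF _ M BB]) (use \<open>good f\<close> in \<open>auto simp: good_def\<close>)
  qed
  have int_bdd: "integrable lborel (\<lambda>q. g q * f q)"
    if f: "good f" and g: "g \<in> borel_measurable borel" "\<And>q. \<bar>g q\<bar> \<le> M" for f g M
  proof (rule Bochner_Integration.integrable_bound[OF integrable_mult_right[OF int_good[OF f], of "M"]])
    have "\<bar>g q * f q\<bar> \<le> \<bar>M * f q\<bar>" for q
      unfolding abs_mult using g(2)[of q] by (intro mult_right_mono) auto
    then show "AE q in lborel. norm (g q * f q) \<le> norm (M * f q)" by simp
    show "(\<lambda>q. g q * f q) \<in> borel_measurable lborel"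
      using f g(1) by (intro borel_measurable_times) (simp_all add: good_def)
  qed
  define \<Phi> where "\<Phi> q = kruzkov_flux (p (fst q)) (p' (snd q))" for q
  have [measurable]: "\<Phi> \<in> borel_measurable borel" unfolding \<Phi>_def[abs_def] by measurable
  have ipB: "integrable lborel (\<lambda>z. indicator B z * p z)"
    unfolding B_def using ab by (intro S.flux_integrable_on_box) auto
  have ip'B: "integrable lborel (\<lambda>z. indicator B' z * p' z)"
    unfolding B'_def using ab by (intro R.flux_integrable_on_box) auto
  \<comment> \<open>\<open>\<Phi>\<close> may be unbounded, but |\<open>\<Phi>\<close>| \<le> |p| +
    |p'|. On \<open>B \<times> B'\<close> each summand is a function of one point, integrable on its
    box, times the indicator of the other box.\<close>
  have int_\<Phi>: "integrable lborel (\<lambda>q. \<Phi> q * f q)" if f: "good f" for f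
  proof -
    obtain M where M: "\<And>q. \<bar>f q\<bar> \<le> M" and z: "\<And>q. q \<notin> B \<times> B' \<Longrightarrow> f q = 0"
      using f unfolding good_def by auto
    have M0: "0 \<le> M" using M[of undefined] by linarith
    have iB: "integrable lborel (indicat_real B)" "integrable lborel (indicat_real B')"
      unfolding B_def B'_def
      by (intro integrable_real_indicator emeasure_bounded_finite bounded_Times; simp add: Icc_Times_borel)+
    show ?thesis
    proof (rule integrable_dominated)
      show "integrable lborel (\<lambda>q. M * (\<bar>indicator B (fst q) * p (fst q)\<bar> * indicator B' (snd q)
         + indicator B (fst q) * \<bar>indicator B' (snd q) * p' (snd q)\<bar>))"
        by (intro integrable_mult_right Bochner_Integration.integrable_add integral_lborel_times(1)
            integrable_abs ipB ip'B iB)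
      show "\<bar>\<Phi> q * f q\<bar> \<le> M * (\<bar>indicator B (fst q) * p (fst q)\<bar> * indicator B' (snd q)
         + indicator B (fst q) * \<bar>indicator B' (snd q) * p' (snd q)\<bar>)" for q
      proof (cases "q \<in> B \<times> B'")
        case True
        have "\<bar>\<Phi> q * f q\<bar> \<le> (\<bar>p (fst q)\<bar> + \<bar>p' (snd q)\<bar>) * M"
          unfolding abs_mult \<Phi>_def by (intro mult_mono kruzkov_flux_le M) auto
        then show ?thesis using True by (simp add: mem_Times_iff mult.commute)
      next
        case False
        then show ?thesis using z M0 by simp
      qed
      show "(\<lambda>q. \<Phi> q * f q) \<in> borel_measurable lborel"
        using f \<open>\<Phi> \<in> borel_measurable borel\<close>
        by (intro borel_measurable_times) (simp_all add: good_def)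
    qed
  qed
  define k1 k2 where "k1 q = S.K (x q) (y q) (V (snd q))" and "k2 q = S.K (y q) (x q) (U (fst q))" for q
  define \<alpha> \<beta> where "\<alpha> q = \<bar>U (fst q) - k1 q\<bar> - \<bar>k1 q\<bar>" and "\<beta> q = \<bar>V (snd q) - k2 q\<bar> - \<bar>k2 q\<bar>" for q
  have [measurable]: "k1 \<in> borel_measurable borel" "k2 \<in> borel_measurable borel"
    unfolding k1_def[abs_def] k2_def[abs_def] by measurable
  have [measurable]: "\<alpha> \<in> borel_measurable borel" "\<beta> \<in> borel_measurable borel"
    unfolding \<alpha>_def[abs_def] \<beta>_def[abs_def] by measurable
  have b\<alpha>: "\<bar>\<alpha> q\<bar> \<le> C" "\<bar>\<beta> q\<bar> \<le> C" for q
    using S.U_bound[of "fst q"] R.U_bound[of "snd q"] unfolding \<alpha>_def \<beta>_def by linarith+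
  \<comment> \<open>The integrands of the two entropy inequalities. The derivatives in s and y of a
    kernel in t - s and x - y carry the opposite sign, hence the minus signs in
    \<open>N2\<close>.\<close>
  define N1 where "N1 q = \<alpha> q * (pt q * \<kappa> q + \<theta> q) + \<Phi> q * (px q * \<kappa> q + \<xi> q)" for q
  define N2 where "N2 q = - (\<beta> q * \<theta> q) - \<Phi> q * \<xi> q" for q
  have iN: "integrable lborel N1" "integrable lborel N2"
    unfolding N1_def[abs_def] N2_def[abs_def] distrib_left
    by (intro Bochner_Integration.integrable_add Bochner_Integration.integrable_diff
        Bochner_Integration.integrable_minus int_\<Phi> int_bdd[OF _ _ b\<alpha>(1)] int_bdd[OF _ _ b\<alpha>(2)] goods; measurable)+
  have N1w: "0 \<le> (\<integral>z. N1 (z, w) \<partial>lborel)" if w: "snd w \<notin> \<Omega>" for w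
  proof -
    define \<tau> where "\<tau> t = moll m (t - fst w)" for t
    define \<sigma> where "\<sigma> x = moll n (x - snd w)" for x
    have st: "smooth1 \<tau>" "smooth1 \<sigma>" unfolding \<tau>_def[abs_def] \<sigma>_def[abs_def] by (rule smooth1_moll_shift)+
    have s2: "smoothC (\<lambda>t x. \<tau> t * \<sigma> x)" by (intro smoothC_mult smoothC_fst smoothC_snd st)
    have d: "deriv \<tau> t = deriv (moll m) (t - fst w)" "deriv \<sigma> x = deriv (moll n) (x - snd w)" for t x
      unfolding \<tau>_def[abs_def] \<sigma>_def[abs_def] by (rule deriv_moll_shift)+
    let ?\<phi> = "\<lambda>t x. \<psi> t x * (\<tau> t * \<sigma> x)"
    have s\<phi>: "smoothC ?\<phi>" by (intro smoothC_mult s\<psi> s2)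
    have "0 \<le> (\<integral>z. (\<bar>U z - S.K (snd z) (snd w) (V w)\<bar> - \<bar>S.K (snd z) (snd w) (V w)\<bar>) * pd_t ?\<phi> (fst z) (snd z)
      + kruzkov_flux (p z) (p' w) * pd_x ?\<phi> (fst z) (snd z) \<partial>lborel)"
      by (rule S.entropy_inequality_interior[OF w s\<phi> _ _ ab(1) ab(3), of l r])
        (use nn supp m n in \<open>auto simp: \<tau>_def \<sigma>_def moll_nonneg\<close>)
    also have "\<dots> = (\<integral>z. N1 (z, w) \<partial>lborel)"
    proof (intro Bochner_Integration.integral_cong refl)
      fix z
      show "(\<bar>U z - S.K (snd z) (snd w) (V w)\<bar> - \<bar>S.K (snd z) (snd w) (V w)\<bar>) * pd_t ?\<phi> (fst z) (snd z)
        + kruzkov_flux (p z) (p' w) * pd_x ?\<phi> (fst z) (snd z) = N1 (z, w)"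
        unfolding pd_mult[OF smoothC_D(1)[OF s\<psi>] smoothC_D(1)[OF s2]] pd_product[OF st] d
        by (simp add: N1_def \<alpha>_def k1_def \<Phi>_def pt_def px_def p0_def \<kappa>q \<theta>_def \<xi>_def txsy \<tau>_def \<sigma>_def algebra_simps)
    qed
    finally show ?thesis .
  qed
  \<comment> \<open>For z in \<open>B\<close> the time support [t - 1/m, t] of the test function
    lies inside (0,T), as the interior inequality demands. For other z the factor
    \<open>\<psi>\<close> makes \<open>N2\<close> vanish.\<close>
  have N2z: "0 \<le> (\<integral>w. N2 (z, w) \<partial>lborel)" if z: "snd z \<notin> \<Omega>" for z
  proof (cases "z \<in> B")
    case False
    then have "N2 (z, w) = 0" for w using zB(3)[of "(z, w)"] by (simp add: N2_def \<theta>_def \<xi>_def)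
    then show ?thesis by simp
  next
    case True
    define c where "c = \<psi> (fst z) (snd z)"
    define \<tau> where "\<tau> s = c * moll m (fst z - s)" for s
    define \<sigma> where "\<sigma> y = moll n (snd z - y)" for y
    have st: "smooth1 \<tau>" "smooth1 \<sigma>" unfolding \<tau>_def[abs_def] \<sigma>_def[abs_def]
      by (intro smooth1_mult smooth1_const smooth1_moll_shift)+
    have s2: "smoothC (\<lambda>t x. \<tau> t * \<sigma> x)" by (intro smoothC_mult smoothC_fst smoothC_snd st)
    have d: "deriv \<tau> s = - (c * deriv (moll m) (fst z - s))" "deriv \<sigma> y = - deriv (moll n) (snd z - y)" for s y
    proof -
      show "deriv \<sigma> y = - deriv (moll n) (snd z - y)" unfolding \<sigma>_def[abs_def] by (rule deriv_moll_shift)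
      have "(\<tau> has_real_derivative c * - deriv (moll m) (fst z - s)) (at s)"
        unfolding \<tau>_def[abs_def]
        using DERIV_cmult[OF smooth1_deriv(1)[OF smooth1_moll_shift(2)[of m "fst z"], of s], of c]
        by (simp add: deriv_moll_shift)
      then show "deriv \<tau> s = - (c * deriv (moll m) (fst z - s))" by (auto dest: DERIV_imp_deriv)
    qed
    have tz: "fst z - 1 / m > 0" "fst z < T" using True m ab unfolding B_def mem_Times_iff by auto
    have "0 \<le> (\<integral>w. (\<bar>V w - S.K (snd w) (snd z) (U z)\<bar> - \<bar>S.K (snd w) (snd z) (U z)\<bar>) * pd_t (\<lambda>t x. \<tau> t * \<sigma> x) (fst w) (snd w)
      + kruzkov_flux (p' w) (p z) * pd_x (\<lambda>t x. \<tau> t * \<sigma> x) (fst w) (snd w) \<partial>lborel)"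
    proof (rule R.entropy_inequality_interior[OF z s2 _ _ tz, of "snd z - 1 / n" "snd z"])
      show "0 \<le> \<tau> s * \<sigma> y" for s y using nn m n by (simp add: \<tau>_def \<sigma>_def c_def moll_nonneg)
      fix s y assume sy: "(s, y) \<notin> {fst z - 1 / m..fst z} \<times> {snd z - 1 / n..snd z}"
      have "s \<notin> {fst z - 1 / m..fst z} \<or> y \<notin> {snd z - 1 / n..snd z}" using sy by blast
      then show "\<tau> s * \<sigma> y = 0"
        using moll_zero_outside[OF m(1), of "fst z - s"] moll_zero_outside[OF n0, of "snd z - y"]
        by (auto simp: \<tau>_def \<sigma>_def)
    qed
    also have "\<dots> = (\<integral>w. N2 (z, w) \<partial>lborel)"
    proof (intro Bochner_Integration.integral_cong refl)
      fix w
      show "(\<bar>V w - S.K (snd w) (snd z) (U z)\<bar> - \<bar>S.K (snd w) (snd z) (U z)\<bar>) * pd_t (\<lambda>t x. \<tau> t * \<sigma> x) (fst w) (snd w)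
        + kruzkov_flux (p' w) (p z) * pd_x (\<lambda>t x. \<tau> t * \<sigma> x) (fst w) (snd w) = N2 (z, w)"
        unfolding pd_product[OF st] d kruzkov_flux_commute[of "p' w"]
        by (simp add: N2_def \<beta>_def k2_def \<Phi>_def p0_def c_def \<theta>_def \<xi>_def txsy \<tau>_def \<sigma>_def algebra_simps)
    qed
    finally show ?thesis .
  qed
  have "0 \<le> (\<integral>w. (\<integral>z. N1 (z, w) \<partial>lborel) \<partial>lborel)"
    using AE_lborel_snd[OF S.AE_not_\<Omega>, where 'a=real] N1w by (intro integral_nonneg_AE) auto
  then have N1: "0 \<le> integral\<^sup>L lborel N1" using lborel_Fubini(6)[OF iN(1)] by simp
  have "0 \<le> (\<integral>z. (\<integral>w. N2 (z, w) \<partial>lborel) \<partial>lborel)"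
    using AE_lborel_snd[OF S.AE_not_\<Omega>, where 'a=real] N2z by (intro integral_nonneg_AE) auto
  then have N2: "0 \<le> integral\<^sup>L lborel N2" using lborel_Fubini(5)[OF iN(2)] by simp
  have M1q: "M1 q = \<bar>U (fst q) - V (snd q)\<bar> * (pt q * \<kappa> q) + \<Phi> q * (px q * \<kappa> q)" for q
    by (simp add: M1_def pt_def px_def txsy \<Phi>_def algebra_simps)
  have bUV: "\<bar>\<bar>U (fst q) - V (snd q)\<bar>\<bar> \<le> 2 * C" "\<bar>\<bar>U (fst q)\<bar>\<bar> \<le> C" "\<bar>\<bar>V (snd q)\<bar>\<bar> \<le> C" for q
    using S.U_bound[of "fst q"] R.U_bound[of "snd q"] by linarith+
  have mUV: "(\<lambda>q. \<bar>U (fst q) - V (snd q)\<bar>) \<in> borel_measurable borel"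
     "(\<lambda>q. \<bar>U (fst q)\<bar>) \<in> borel_measurable (borel :: ((real \<times> real) \<times> (real \<times> real)) measure)"
     "(\<lambda>q. \<bar>V (snd q)\<bar>) \<in> borel_measurable (borel :: ((real \<times> real) \<times> (real \<times> real)) measure)" by measurable
  show iM1: "integrable lborel M1"
    unfolding M1q[abs_def]
    by (intro Bochner_Integration.integrable_add int_\<Phi> int_bdd[OF _ mUV(1) bUV(1)] goods)
  have [measurable]: "B \<in> sets borel" "B' \<in> sets borel" unfolding B_def B'_def by (rule Icc_Times_borel)+
  have kerq: "ker q = indicator (B \<times> B') q * moll n (x q - y q)" for q
    by (simp add: ker_def txsy indicator_def mem_Times_iff)
  have kernn: "0 \<le> ker q" for q using n by (simp add: ker_def moll_nonneg)
  have [measurable]: "ker \<in> borel_measurable borel" unfolding ker_def by measurable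
  have "good ker"
    unfolding good_def
  proof (intro conjI exI allI impI)
    show "\<bar>ker q\<bar> \<le> Mn" for q using Mn by (auto simp: kerq indicator_def)
  qed (auto simp: kerq)
  then show iker: "integrable lborel ker" by (rule int_good)
  have iG: "integrable lborel (\<lambda>q. G1 q * ker q)" "integrable lborel (\<lambda>q. G2 q * ker q)"
    by (rule int_bdd[OF \<open>good ker\<close>, of _ "2 * C"]; use G_bounds in \<open>simp add: abs_of_nonneg\<close>)+
  \<comment> \<open>The remainders of the subtracted terms once \<open>K\<close> is replaced by
    \<open>V\<close> or \<open>U\<close>. For fixed w, \<open>Z1\<close> is |V w| times a full
    t-derivative; for fixed z, \<open>Z2\<close> is minus |U z| \<open>\<psi>\<close> times a full
    s-derivative. Both integrate to 0 by compact support.\<close>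
  define Z1 where "Z1 q = \<bar>V (snd q)\<bar> * (pt q * \<kappa> q) + \<bar>V (snd q)\<bar> * \<theta> q" for q
  define Z2 where "Z2 q = \<bar>U (fst q)\<bar> * \<theta> q" for q
  have iZ: "integrable lborel Z1" "integrable lborel Z2"
    unfolding Z1_def[abs_def] Z2_def[abs_def]
    by (intro Bochner_Integration.integrable_add int_bdd[OF _ mUV(3) bUV(3)] int_bdd[OF _ mUV(2) bUV(2)] goods)+
  have "(\<integral>z. Z1 (z, w) \<partial>lborel) = 0" for w
  proof -
    define \<tau> where "\<tau> t = moll m (t - fst w)" for t
    define \<sigma> where "\<sigma> x = moll n (x - snd w)" for x
    have st: "smooth1 \<tau>" "smooth1 \<sigma>" unfolding \<tau>_def[abs_def] \<sigma>_def[abs_def] by (rule smooth1_moll_shift)+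
    have s2: "smoothC (\<lambda>t x. \<tau> t * \<sigma> x)" by (intro smoothC_mult smoothC_fst smoothC_snd st)
    have d: "deriv \<tau> t = deriv (moll m) (t - fst w)" for t
      unfolding \<tau>_def[abs_def] by (rule deriv_moll_shift)
    let ?\<phi> = "\<lambda>t x. \<psi> t x * (\<tau> t * \<sigma> x)"
    have "(\<integral>z. pd_t ?\<phi> (fst z) (snd z) \<partial>lborel) = 0"
      by (rule integral_pd_t_eq_0[of _ a b l r]) (auto intro: smoothC_mult s\<psi> s2 simp: supp)
    moreover have "Z1 (z, w) = \<bar>V w\<bar> * pd_t ?\<phi> (fst z) (snd z)" for z
      unfolding pd_mult[OF smoothC_D(1)[OF s\<psi>] smoothC_D(1)[OF s2]] pd_product[OF st] d
      by (simp add: Z1_def pt_def p0_def \<kappa>q \<theta>_def txsy \<tau>_def \<sigma>_def algebra_simps)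
    ultimately show ?thesis by simp
  qed
  then have Z1: "integral\<^sup>L lborel Z1 = 0" using lborel_Fubini(6)[OF iZ(1)] by simp
  have "(\<integral>w. Z2 (z, w) \<partial>lborel) = 0" for z
  proof -
    define \<tau> where "\<tau> s = moll m (fst z - s)" for s
    define \<sigma> where "\<sigma> y = moll n (snd z - y)" for y
    have st: "smooth1 \<tau>" "smooth1 \<sigma>" unfolding \<tau>_def[abs_def] \<sigma>_def[abs_def] by (rule smooth1_moll_shift)+
    have s2: "smoothC (\<lambda>t x. \<tau> t * \<sigma> x)" by (intro smoothC_mult smoothC_fst smoothC_snd st)
    have d: "deriv \<tau> s = - deriv (moll m) (fst z - s)" for s
      unfolding \<tau>_def[abs_def] by (rule deriv_moll_shift)
    have "(\<integral>w. pd_t (\<lambda>t x. \<tau> t * \<sigma> x) (fst w) (snd w) \<partial>lborel) = 0"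
    proof (rule integral_pd_t_eq_0[OF s2, of "fst z - 1 / m" "fst z" "snd z - 1 / n" "snd z"])
      fix s y assume sy: "(s, y) \<notin> {fst z - 1 / m..fst z} \<times> {snd z - 1 / n..snd z}"
      have "s \<notin> {fst z - 1 / m..fst z} \<or> y \<notin> {snd z - 1 / n..snd z}" using sy by blast
      then show "\<tau> s * \<sigma> y = 0"
        using moll_zero_outside[OF m(1), of "fst z - s"] moll_zero_outside[OF n0, of "snd z - y"]
        by (auto simp: \<tau>_def \<sigma>_def)
    qed
    moreover have "Z2 (z, w) = - (\<bar>U z\<bar> * \<psi> (fst z) (snd z)) * pd_t (\<lambda>t x. \<tau> t * \<sigma> x) (fst w) (snd w)" for w
      unfolding pd_product[OF st] d by (simp add: Z2_def p0_def \<theta>_def txsy \<tau>_def \<sigma>_def algebra_simps)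
    ultimately show ?thesis by simp
  qed
  then have Z2: "integral\<^sup>L lborel Z2 = 0" using lborel_Fubini(5)[OF iZ(2)] by simp
  have e\<alpha>: "\<bar>\<alpha> q - (\<bar>U (fst q) - V (snd q)\<bar> - \<bar>V (snd q)\<bar>)\<bar> \<le> G1 q" for q
    unfolding G1_def \<alpha>_def k1_def txsy by (rule renormalized_entropy_diff[OF S.U_bound])
  have e\<beta>: "\<bar>\<beta> q - (\<bar>U (fst q) - V (snd q)\<bar> - \<bar>U (fst q)\<bar>)\<bar> \<le> G2 q" for q
    using renormalized_entropy_diff[OF R.U_bound, of "snd q" "k2 q" "U (fst q)"]
    unfolding G2_def \<beta>_def k2_def txsy by (simp only: abs_minus_commute[of "U (fst q)"])
  have bnd: "\<bar>pt q * \<kappa> q\<bar> \<le> C1 * Mm * ker q" "\<bar>\<theta> q\<bar> \<le> C1 * Mm * ker q" for q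
  proof -
    have "\<bar>pt q * \<kappa> q\<bar> \<le> C1 * Mm * ker q \<and> \<bar>\<theta> q\<bar> \<le> C1 * Mm * ker q"
    proof (cases "q \<in> B \<times> B'")
      case True
      have "\<bar>pt q * \<kappa> q\<bar> = \<bar>pt q\<bar> * \<bar>moll m (t q - s q)\<bar> * moll n (x q - y q)"
        "\<bar>\<theta> q\<bar> = \<bar>p0 q\<bar> * \<bar>deriv (moll m) (t q - s q)\<bar> * moll n (x q - y q)"
        using moll_nonneg[of n "x q - y q"] n by (simp_all add: \<kappa>q \<theta>_def abs_mult)
      moreover have "\<bar>pt q\<bar> * \<bar>moll m (t q - s q)\<bar> * moll n (x q - y q) \<le> C1 * Mm * moll n (x q - y q)"
         "\<bar>p0 q\<bar> * \<bar>deriv (moll m) (t q - s q)\<bar> * moll n (x q - y q) \<le> C1 * Mm * moll n (x q - y q)"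
        using n by (intro mult_right_mono mult_mono bp Mm C1 moll_nonneg; simp)+
      ultimately show ?thesis using True by (simp add: kerq)
    next
      case False
      have "0 \<le> C1 * Mm * ker q" using C1(1) Mm(1) kernn[of q] by simp
      then show ?thesis by (simp only: suppBB[OF False] abs_zero)
    qed
    then show "\<bar>pt q * \<kappa> q\<bar> \<le> C1 * Mm * ker q" "\<bar>\<theta> q\<bar> \<le> C1 * Mm * ker q" by auto
  qed
  have le: "N1 q + N2 q \<le> M1 q - Z1 q + Z2 q + 2 * C1 * Mm * (G1 q * ker q) + C1 * Mm * (G2 q * ker q)" for q
  proof -
    define e1 e2 where "e1 = \<alpha> q - (\<bar>U (fst q) - V (snd q)\<bar> - \<bar>V (snd q)\<bar>)"
      and "e2 = \<beta> q - (\<bar>U (fst q) - V (snd q)\<bar> - \<bar>U (fst q)\<bar>)"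
    have ab': "\<alpha> q = e1 + (\<bar>U (fst q) - V (snd q)\<bar> - \<bar>V (snd q)\<bar>)"
       "\<beta> q = e2 + (\<bar>U (fst q) - V (snd q)\<bar> - \<bar>U (fst q)\<bar>)" by (simp_all add: e1_def e2_def)
    \<comment> \<open>The \<open>\<xi>\<close> terms have cancelled, because both inequalities carry
      the same symmetric \<open>\<Phi>\<close>. In the coefficient of \<open>\<theta>\<close> the
      two copies of |U - V| cancel, leaving \<open>Z1\<close>, \<open>Z2\<close> and the errors
      \<open>e1\<close>, \<open>e2\<close>.\<close>
    have "N1 q + N2 q = M1 q - Z1 q + Z2 q + e1 * (pt q * \<kappa> q) + e1 * \<theta> q - e2 * \<theta> q"
      unfolding N1_def N2_def M1q Z1_def Z2_def ab' by (simp add: algebra_simps)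
    moreover have "\<bar>e1 * (pt q * \<kappa> q)\<bar> \<le> G1 q * (C1 * Mm * ker q)" "\<bar>e1 * \<theta> q\<bar> \<le> G1 q * (C1 * Mm * ker q)"
      "\<bar>e2 * \<theta> q\<bar> \<le> G2 q * (C1 * Mm * ker q)"
    proof -
      have ee: "\<bar>e1\<bar> \<le> G1 q" "\<bar>e2\<bar> \<le> G2 q"
        using e\<alpha>[of q] e\<beta>[of q] by (simp_all only: e1_def e2_def)
      show "\<bar>e1 * (pt q * \<kappa> q)\<bar> \<le> G1 q * (C1 * Mm * ker q)"
        unfolding abs_mult[of e1] by (intro mult_mono ee bnd G_bounds abs_ge_zero)
      show "\<bar>e1 * \<theta> q\<bar> \<le> G1 q * (C1 * Mm * ker q)"
        unfolding abs_mult[of e1] by (intro mult_mono ee bnd G_bounds abs_ge_zero)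
      show "\<bar>e2 * \<theta> q\<bar> \<le> G2 q * (C1 * Mm * ker q)"
        unfolding abs_mult[of e2] by (intro mult_mono ee bnd G_bounds abs_ge_zero)
    qed
    ultimately show ?thesis by (simp add: algebra_simps)
  qed
  have "0 \<le> (\<integral>q. N1 q + N2 q \<partial>lborel)" using N1 N2 iN by simp
  also have "\<dots> \<le> (\<integral>q. M1 q - Z1 q + Z2 q + 2 * C1 * Mm * (G1 q * ker q) + C1 * Mm * (G2 q * ker q) \<partial>lborel)"
    by (intro integral_mono le Bochner_Integration.integrable_add Bochner_Integration.integrable_diff
        integrable_mult_right iN iM1 iZ iG)
  also have "\<dots> = (\<integral>q. M1 q \<partial>lborel) + 2 * C1 * Mm * (\<integral>q. G1 q * ker q \<partial>lborel) + C1 * Mm * (\<integral>q. G2 q * ker q \<partial>lborel)"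
    using iM1 iZ iG Z1 Z2 by simp
  finally show "0 \<le> (\<integral>q. M1 q \<partial>lborel) + 2 * C1 * Mm * (\<integral>q. G1 q * ker q \<partial>lborel) + C1 * Mm * (\<integral>q. G2 q * ker q \<partial>lborel)" .
qed

text \<open>The time width is fixed first, from the L1 moduli of continuity of \<open>V\<close> and
  of its signed flux. With it the derivative of the time kernel is bounded, so refining the space
  kernel removes the \<open>G1\<close> and \<open>G2\<close> errors. The doubled integrand then
  differs from the undoubled one by at most C1 times the shifts of \<open>V\<close> and of its flux,
  by the triangle inequality and \<open>kruzkov_flux_lipschitz\<close>.\<close>

lemma kato_inequality:
  assumes s\<psi>: "smoothC \<psi>" and nn: "\<And>t x. 0 \<le> \<psi> t x"
    and supp: "\<And>t x. (t, x) \<notin> {a..b} \<times> {l..r} \<Longrightarrow> \<psi> t x = 0" and ab: "0 < a" "a \<le> b" "b < T"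
  shows "integrable lborel (\<lambda>z. \<bar>U z - V z\<bar> * pd_t \<psi> (fst z) (snd z) + kruzkov_flux (p z) (p' z) * pd_x \<psi> (fst z) (snd z))"
    and "0 \<le> (\<integral>z. \<bar>U z - V z\<bar> * pd_t \<psi> (fst z) (snd z) + kruzkov_flux (p z) (p' z) * pd_x \<psi> (fst z) (snd z) \<partial>lborel)"
proof -
  let ?t = "\<lambda>z. pd_t \<psi> (fst z) (snd z)" and ?x = "\<lambda>z. pd_x \<psi> (fst z) (snd z)"
  define B where "B = {a..b} \<times> {l..r}"
  define B' where "B' = {a / 2..b} \<times> {l - 1..r + 1}"
  have st: "smoothC (pd_t \<psi>)" and sx: "smoothC (pd_x \<psi>)" by (rule smoothC_D[OF s\<psi>])+
  have z0: "?t z = 0" "?x z = 0" "\<psi> (fst z) (snd z) = 0" if "z \<notin> B" for z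
    using pd_zero_outside[of a b l r \<psi>, OF supp, of "fst z" "snd z"] supp[of "fst z" "snd z"] that
    by (simp_all add: B_def mem_Times_iff)
  have zt: "pd_t \<psi> t x = 0" and zx: "pd_x \<psi> t x = 0" if "(t, x) \<notin> {a..b} \<times> {l..r}" for t x
    using z0[of "(t, x)"] that by (simp_all add: B_def)
  obtain c1 where c1: "0 \<le> c1" "\<And>t x. \<bar>pd_t \<psi> t x\<bar> \<le> c1" using smoothC_bounded[OF st, of a b l r] zt by blast
  obtain c2 where c2: "0 \<le> c2" "\<And>t x. \<bar>pd_x \<psi> t x\<bar> \<le> c2" using smoothC_bounded[OF sx, of a b l r] zx by blast
  obtain c3 where c3: "0 \<le> c3" "\<And>t x. \<bar>\<psi> t x\<bar> \<le> c3" using smoothC_bounded[OF s\<psi>, of a b l r] supp by blast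
  define C1 where "C1 = c1 + c2 + c3"
  have C1: "0 \<le> C1" "\<bar>pd_t \<psi> t x\<bar> \<le> C1" "\<bar>pd_x \<psi> t x\<bar> \<le> C1" "\<bar>\<psi> t x\<bar> \<le> C1" for t x
    using c1(1) c2(1) c3(1) c1(2)[of t x] c2(2)[of t x] c3(2)[of t x] unfolding C1_def by linarith+
  have [measurable]: "?t \<in> borel_measurable borel" "?x \<in> borel_measurable borel"
    by (intro borel_measurable_smoothC st sx)+
  have [measurable]: "B \<in> sets borel" "B' \<in> sets borel" unfolding B_def B'_def by (rule Icc_Times_borel)+
  have [measurable]: "(\<lambda>z. p z) \<in> borel_measurable borel" "(\<lambda>z. p' z) \<in> borel_measurable borel" by measurable
  have BB: "B \<subseteq> B'" using ab unfolding B_def B'_def by (intro Sigma_mono) auto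
  have bB': "bounded B'" unfolding B'_def by (intro bounded_Times) auto
  \<comment> \<open>Continuity of translations needs integrability on the whole plane, hence the
    restriction to \<open>B'\<close>, which contains both points of every pair that counts.\<close>
  define V1 where "V1 z = indicator B' z * V z" for z
  define p1 where "p1 z = indicator B' z * p' z" for z
  have iV1: "integrable lborel V1"
    by (rule integrable_lborel_bounded_support[OF _ _ bB', of _ C])
      (use R.U_bound S.C_nonneg in \<open>auto simp: V1_def[abs_def] indicator_def\<close>)
  have ip1: "integrable lborel p1"
    unfolding p1_def[abs_def] B'_def using ab by (intro R.flux_integrable_on_box) auto
  have ip: "integrable lborel (\<lambda>z. indicator B' z * p z)"
    unfolding B'_def using ab by (intro S.flux_integrable_on_box) auto
  define D where "D z = \<bar>U z - V z\<bar> * ?t z + kruzkov_flux (p z) (p' z) * ?x z" for z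
  have iD: "integrable lborel D"
  proof (rule integrable_dominated)
    show "integrable lborel (\<lambda>z. 2 * C * C1 * indicator B z + C1 * (\<bar>indicator B' z * p z\<bar> + \<bar>p1 z\<bar>))"
      by (intro Bochner_Integration.integrable_add integrable_mult_right integrable_abs ip ip1 integrable_real_indicator
          emeasure_bounded_finite bounded_subset[OF bB' BB]) simp
    show "\<bar>D z\<bar> \<le> 2 * C * C1 * indicator B z + C1 * (\<bar>indicator B' z * p z\<bar> + \<bar>p1 z\<bar>)" for z
    proof (cases "z \<in> B")
      case True
      have "\<bar>U z - V z\<bar> \<le> 2 * C" using S.U_bound[of z] R.U_bound[of z] by linarith
      then have "\<bar>\<bar>U z - V z\<bar> * ?t z\<bar> \<le> (2 * C) * C1"
        unfolding abs_mult by (intro mult_mono C1) (use S.C_nonneg in auto)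
      moreover have "\<bar>kruzkov_flux (p z) (p' z) * ?x z\<bar> \<le> (\<bar>p z\<bar> + \<bar>p' z\<bar>) * C1"
        unfolding abs_mult by (intro mult_mono C1 kruzkov_flux_le) auto
      ultimately have "\<bar>D z\<bar> \<le> 2 * C * C1 + C1 * (\<bar>p z\<bar> + \<bar>p' z\<bar>)"
        unfolding D_def mult.commute[of C1] by linarith
      then show ?thesis using True BB by (auto simp: p1_def)
    next
      case False
      then show ?thesis using z0[OF False] C1(1) by (simp add: D_def)
    qed
    show "D \<in> borel_measurable lborel" unfolding D_def[abs_def] by measurable
  qed
  then show "integrable lborel (\<lambda>z. \<bar>U z - V z\<bar> * ?t z + kruzkov_flux (p z) (p' z) * ?x z)"
    unfolding D_def[abs_def] .
  have "0 \<le> (\<integral>z. D z \<partial>lborel)"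
  proof (rule field_le_epsilon)
    fix \<epsilon> :: real assume \<epsilon>: "0 < \<epsilon>"
    \<comment> \<open>The total error will be 2 C1 e from the two L1 moduli plus e from the
      \<open>G\<close> terms, which makes \<open>\<epsilon> / 2\<close>.\<close>
    define e where "e = \<epsilon> / (2 * C1 + 1) / 2"
    have e: "0 < e" using \<epsilon> C1(1) by (simp add: e_def)
    obtain d1 where d1: "d1 > 0" "\<And>h. norm h < d1 \<Longrightarrow> (\<integral>x. \<bar>V1 (x + h) - V1 x\<bar> \<partial>lborel) < e"
      using integrable_imp_L1_shift_continuous[OF iV1] e unfolding L1_shift_continuous_def by meson
    obtain d2 where d2: "d2 > 0" "\<And>h. norm h < d2 \<Longrightarrow> (\<integral>x. \<bar>p1 (x + h) - p1 x\<bar> \<partial>lborel) < e"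
      using integrable_imp_L1_shift_continuous[OF ip1] e unfolding L1_shift_continuous_def by meson
    \<comment> \<open>Both components of a kernel argument are below \<open>\<delta>\<close>, so its
      norm is below \<open>2 * \<delta>\<close>, within \<open>d1\<close> and \<open>d2\<close>. The
      bound a/2 keeps the second time positive.\<close>
    define \<delta> where "\<delta> = min (min d1 d2 / 2) (a / 2)"
    have \<delta>: "0 < \<delta>" "2 * \<delta> \<le> d1" "2 * \<delta> \<le> d2" "\<delta> \<le> a / 2" using d1 d2 ab by (auto simp: \<delta>_def)
    define m where "m = 1 / \<delta>"
    have m: "0 < m" "1 / m \<le> a / 2" "1 / m = \<delta>" using \<delta> by (auto simp: m_def)
    obtain M1 where M1: "0 \<le> M1" "\<And>r. \<bar>moll m r\<bar> \<le> M1" using moll_bounded[OF m(1)] by blast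
    obtain M2 where M2: "0 \<le> M2" "\<And>r. \<bar>deriv (moll m) r\<bar> \<le> M2" using deriv_moll_bounded[OF m(1)] by blast
    define Mm where "Mm = M1 + M2"
    have Mm: "0 \<le> Mm" "\<bar>moll m r\<bar> \<le> Mm" "\<bar>deriv (moll m) r\<bar> \<le> Mm" for r
      using M1(1) M2(1) M1(2)[of r] M2(2)[of r] unfolding Mm_def by linarith+
    define k where "k n h = moll m (fst h) * moll (real (Suc n)) (snd h)" for n h
    define kap where "kap n q = indicator B (fst q) * indicator B' (snd q) * moll (real (Suc n)) (snd (fst q) - snd (snd q))"
      for n q
    define MM where "MM n q = (\<bar>U (fst q) - V (snd q)\<bar> * ?t (fst q) + kruzkov_flux (p (fst q)) (p' (snd q)) * ?x (fst q))
       * k n (fst q - snd q)" for n q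
    have dbl: "integrable lborel (MM n)" "integrable lborel (kap n)"
      "0 \<le> (\<integral>q. MM n q \<partial>lborel) + 2 * C1 * Mm * (\<integral>q. G1 q * kap n q \<partial>lborel) + C1 * Mm * (\<integral>q. G2 q * kap n q \<partial>lborel)" for n
    proof -
      have n1: "1 \<le> real (Suc n)" by simp
      note dd = doubling_inequality[where \<psi>=\<psi> and a=a and b=b and l=l and r=r,
        OF s\<psi> nn supp ab m(1,2) n1 C1 Mm]
      have e: "MM n = (\<lambda>q. (\<bar>U (fst q) - V (snd q)\<bar> * pd_t \<psi> (fst (fst q)) (snd (fst q)) +
          kruzkov_flux (p (fst q)) (p' (snd q)) * pd_x \<psi> (fst (fst q)) (snd (fst q))) *
          (moll m (fst (fst q) - fst (snd q)) * moll (real (Suc n)) (snd (fst q) - snd (snd q))))"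
        "kap n = (\<lambda>q. indicator ({a..b} \<times> {l..r}) (fst q) * indicator ({a / 2..b} \<times> {l - 1..r + 1}) (snd q) *
          moll (real (Suc n)) (snd (fst q) - snd (snd q)))"
        unfolding MM_def[abs_def] kap_def[abs_def] k_def B_def B'_def fst_diff snd_diff by (rule refl)+
      show "integrable lborel (MM n)" unfolding e(1) by (rule dd(1))
      show "integrable lborel (kap n)" unfolding e(2) by (rule dd(2))
      show "0 \<le> (\<integral>q. MM n q \<partial>lborel) + 2 * C1 * Mm * (\<integral>q. G1 q * kap n q \<partial>lborel) + C1 * Mm * (\<integral>q. G2 q * kap n q \<partial>lborel)"
        unfolding e by (rule dd(3))
    qed
    have k: "0 \<le> k n h" "integrable lborel (k n)" "(\<integral>h. k n h \<partial>lborel) = 1" for n h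
      using m(1) moll_nonneg integral_moll[of m] integral_moll[of "real (Suc n)"]
        integral_lborel_times[of "moll m" "moll (real (Suc n))"] by (simp_all add: k_def[abs_def] moll_nonneg)
    have ksupp: "norm h < 2 * \<delta>" "0 < fst h" "fst h < \<delta>" "0 < snd h" "snd h < 1"
      if "k n h \<noteq> 0" "1 / real (Suc n) \<le> \<delta>" for n h
    proof -
      have *: "0 < fst h" "fst h < 1 / m" "0 < snd h" "snd h < 1 / real (Suc n)"
        using that moll_support[OF m(1), of "fst h"] moll_support[of "real (Suc n)" "snd h"] by (auto simp: k_def)
      have "norm h \<le> norm (fst h) + norm (snd h)" using norm_Pair_le[of "fst h" "snd h"] by simp
      then show "norm h < 2 * \<delta>" using * m(3) that(2) by simp
      have "1 / real (Suc n) \<le> 1" by simp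
      then show "0 < fst h" "fst h < \<delta>" "0 < snd h" "snd h < 1" using * m(3) by linarith+
    qed
    have main: "(\<integral>q. MM n q \<partial>lborel) \<le> (\<integral>z. D z \<partial>lborel) + 2 * C1 * e" if n: "1 / real (Suc n) \<le> \<delta>" for n
    proof -
      have bV: "(\<integral>z. \<bar>V1 (z - h) - V1 z\<bar> \<partial>lborel) \<le> e" "(\<integral>z. \<bar>p1 (z - h) - p1 z\<bar> \<partial>lborel) \<le> e" if "k n h \<noteq> 0" for h
        using d1(2)[of "- h"] d2(2)[of "- h"] ksupp(1)[OF that n] \<delta> by simp_all
      note mV = mollifier_L1_bound[OF iV1 k(2) k(1) bV(1) less_imp_le[OF e]]
      note mp = mollifier_L1_bound[OF ip1 k(2) k(1) bV(2) less_imp_le[OF e]]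
      have km[measurable]: "k n \<in> borel_measurable borel" using k(2)[of n] by simp
      note iDk = integral_times_shift_kernel(1)[OF iD k] and Dk = integral_times_shift_kernel(2)[OF iD k]
      have "MM n q \<le> D (fst q) * k n (fst q - snd q) + C1 * (\<bar>V1 (snd q) - V1 (fst q)\<bar> * k n (fst q - snd q))
          + C1 * (\<bar>p1 (snd q) - p1 (fst q)\<bar> * k n (fst q - snd q))" for q
      proof (cases "fst q \<in> B \<and> k n (fst q - snd q) \<noteq> 0")
        case False
        then show ?thesis using z0[of "fst q"] C1(1) k(1)[of n "fst q - snd q"] by (auto simp: MM_def D_def)
      next
        case True
        obtain z w where q: "q = (z, w)" by (cases q)
        have kn: "k n (z - w) \<noteq> 0" and zB: "z \<in> B" using True q by auto
        have "w \<in> B'"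
          using ksupp(2-5)[OF kn n] zB \<delta>(4) unfolding B_def B'_def mem_Times_iff atLeastAtMost_iff fst_diff snd_diff
          by linarith
        then have eq: "V1 w = V w" "V1 z = V z" "p1 w = p' w" "p1 z = p' z"
          using zB BB by (auto simp: V1_def p1_def)
        have 1: "(\<bar>U z - V w\<bar> - \<bar>U z - V z\<bar>) * ?t z \<le> C1 * \<bar>V1 w - V1 z\<bar>"
        proof -
          have "\<bar>\<bar>U z - V w\<bar> - \<bar>U z - V z\<bar>\<bar> \<le> \<bar>V w - V z\<bar>"
            using abs_triangle_ineq3[of "U z - V w" "U z - V z"] by (simp add: abs_minus_commute)
          then have "\<bar>(\<bar>U z - V w\<bar> - \<bar>U z - V z\<bar>) * ?t z\<bar> \<le> \<bar>V w - V z\<bar> * C1"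
            unfolding abs_mult by (intro mult_mono C1) auto
          then show ?thesis unfolding eq mult.commute[of C1] by linarith
        qed
        have 2: "(kruzkov_flux (p z) (p' w) - kruzkov_flux (p z) (p' z)) * ?x z \<le> C1 * \<bar>p1 w - p1 z\<bar>"
        proof -
          have "\<bar>(kruzkov_flux (p z) (p' w) - kruzkov_flux (p z) (p' z)) * ?x z\<bar> \<le> \<bar>p' w - p' z\<bar> * C1"
            unfolding abs_mult by (intro mult_mono C1 kruzkov_flux_lipschitz) auto
          then show ?thesis unfolding eq mult.commute[of C1] by linarith
        qed
        have "\<bar>U z - V w\<bar> * ?t z + kruzkov_flux (p z) (p' w) * ?x z \<le> D z + C1 * \<bar>V1 w - V1 z\<bar> + C1 * \<bar>p1 w - p1 z\<bar>"
          using 1 2 unfolding D_def left_diff_distrib by linarith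
        from mult_right_mono[OF this k(1)[of n "z - w"]] show ?thesis
          unfolding MM_def q fst_conv snd_conv by (simp only: distrib_right mult.assoc)
      qed
      then have "(\<integral>q. MM n q \<partial>lborel) \<le> (\<integral>q. D (fst q) * k n (fst q - snd q) + C1 * (\<bar>V1 (snd q) - V1 (fst q)\<bar> * k n (fst q - snd q))
          + C1 * (\<bar>p1 (snd q) - p1 (fst q)\<bar> * k n (fst q - snd q)) \<partial>lborel)"
        by (intro integral_mono dbl(1) Bochner_Integration.integrable_add integrable_mult_right iDk mV(1) mp(1))
      also have "\<dots> = (\<integral>z. D z \<partial>lborel) + C1 * (\<integral>q. \<bar>V1 (snd q) - V1 (fst q)\<bar> * k n (fst q - snd q) \<partial>lborel)
          + C1 * (\<integral>q. \<bar>p1 (snd q) - p1 (fst q)\<bar> * k n (fst q - snd q) \<partial>lborel)"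
        using iDk mV(1) mp(1) Dk by simp
      also have "\<dots> \<le> (\<integral>z. D z \<partial>lborel) + C1 * e + C1 * e"
        using mV(2) mp(2) k(3) C1(1) by (intro add_mono mult_left_mono) auto
      finally show ?thesis by simp
    qed
    have mollI: "integrable lborel (\<lambda>x. moll (real (Suc n)) (x - c))" "(\<integral>x. moll (real (Suc n)) (x - c) \<partial>lborel) = 1"
      "integrable lborel (\<lambda>y. moll (real (Suc n)) (c - y))" "(\<integral>y. moll (real (Suc n)) (c - y) \<partial>lborel) = 1" for n c
      using integral_moll_shift[of "real (Suc n)"] by simp_all
    have \<chi>0: "0 \<le> kap n q" for n q by (simp add: kap_def moll_nonneg)
    have \<chi>s: "\<bar>x - y\<bar> \<le> 1 / real (Suc n)" if "moll (real (Suc n)) (x - y) \<noteq> 0" for n x y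
      using moll_support[OF _ that] by simp
    have E1: "(\<lambda>n. \<integral>q. G1 q * kap n q \<partial>lborel) \<longlonglongrightarrow> 0"
    proof (rule concentrating_kernel_tendsto_0(1)[where C="2 * C" and ?C1.0="b - a" and B=B' and \<pi>=snd and \<sigma>=snd])
      fix n w
      have f: "(\<lambda>z. kap n (z, w)) = (\<lambda>z. indicator B' w * (indicator ({a..b} \<times> {l..r}) z * moll (real (Suc n)) (snd z - snd w)))"
        by (auto simp: kap_def B_def)
      note sk = strip_kernel[OF mollI(1)[of n "snd w"] _ mollI(2) ab(2), of l r]
      show "integrable lborel (\<lambda>z. kap n (z, w))"
        unfolding f by (intro integrable_mult_right sk(1)) (simp add: moll_nonneg)
      show "(\<integral>z. kap n (z, w) \<partial>lborel) \<le> (b - a) * indicator B' w"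
      proof -
        have "indicat_real B' w * (\<integral>z. indicator ({a..b} \<times> {l..r}) z * moll (real (Suc n)) (snd z - snd w) \<partial>lborel) \<le> indicator B' w * (b - a)"
          by (intro mult_left_mono sk(2)) (simp_all add: moll_nonneg del: of_nat_Suc)
        then show ?thesis unfolding f by (simp only: integral_mult_right_zero mult.commute)
      qed
    next
      fix n z w assume "kap n (z, w) \<noteq> 0"
      then show "\<bar>snd z - snd w\<bar> \<le> 1 / real (Suc n)" using \<chi>s[of n "snd z" "snd w"] by (auto simp: kap_def)
    next
      show "AE w in lborel. \<forall>e>0. \<exists>d>0. \<forall>z. \<bar>snd z - snd w\<bar> < d \<longrightarrow> G1 (z, w) < e"
        using AE_lborel_snd[OF S.AE_not_\<Omega>, where 'a=real]
      proof eventually_elim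
        case (elim w)
        show ?case
        proof (intro allI impI)
          fix e :: real assume "0 < e"
          then obtain d where "d > 0" "\<And>x. \<bar>x - snd w\<bar> < d \<Longrightarrow> \<bar>S.K x (snd w) (V w) - V w\<bar> < e / 2"
            using S.K_tendsto[OF elim, of "e / 2"] by auto
          then show "\<exists>d>0. \<forall>z. \<bar>snd z - snd w\<bar> < d \<longrightarrow> G1 (z, w) < e"
            by (intro exI[of _ d]) (force simp: G1_def)
        qed
      qed
    qed (use G_bounds \<chi>0 dbl(2) bB' emeasure_bounded_finite[OF bB'] in auto)
    have E2: "(\<lambda>n. \<integral>q. G2 q * kap n q \<partial>lborel) \<longlonglongrightarrow> 0"
    proof -
      define G where "G q = G2 (snd q, fst q)" for q
      define \<kappa> where "\<kappa> n q = kap n (snd q, fst q)" for n q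
      have [measurable]: "kap n \<in> borel_measurable borel" for n using dbl(2)[of n] by simp
      have sw[measurable]: "(\<lambda>q. (snd q, fst q)) \<in> borel \<rightarrow>\<^sub>M (borel :: ((real \<times> real) \<times> (real \<times> real)) measure)"
        by (intro borel_measurable_continuous_onI continuous_intros)
      have [measurable]: "G \<in> borel_measurable borel" unfolding G_def[abs_def] by measurable
      have "(\<lambda>n. \<integral>q. G q * \<kappa> n q \<partial>lborel) \<longlonglongrightarrow> 0"
      proof (rule concentrating_kernel_tendsto_0(1)[where C="2 * C" and ?C1.0="b - a / 2" and B=B and \<pi>=snd and \<sigma>=snd])
        fix n z
        have f: "(\<lambda>w. \<kappa> n (w, z)) = (\<lambda>w. indicator B z * (indicator ({a / 2..b} \<times> {l - 1..r + 1}) w * moll (real (Suc n)) (snd z - snd w)))"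
          by (auto simp: kap_def B'_def \<kappa>_def)
        have "a / 2 \<le> b" using ab by simp
        note sk = strip_kernel[OF mollI(3)[of n "snd z"] _ mollI(4) this, of "l - 1" "r + 1"]
        show "integrable lborel (\<lambda>w. \<kappa> n (w, z))"
          unfolding f by (intro integrable_mult_right sk(1)) (simp add: moll_nonneg)
        show "(\<integral>w. \<kappa> n (w, z) \<partial>lborel) \<le> (b - a / 2) * indicator B z"
        proof -
        have "indicat_real B z * (\<integral>w. indicator ({a / 2..b} \<times> {l - 1..r + 1}) w * moll (real (Suc n)) (snd z - snd w) \<partial>lborel) \<le> indicator B z * (b - a / 2)"
          by (intro mult_left_mono sk(2)) (simp_all add: moll_nonneg del: of_nat_Suc)
        then show ?thesis unfolding f by (simp only: integral_mult_right_zero mult.commute)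
      qed
      next
        fix n w z assume "\<kappa> n (w, z) \<noteq> 0"
        then show "\<bar>snd w - snd z\<bar> \<le> 1 / real (Suc n)"
          using \<chi>s[of n "snd z" "snd w"] by (auto simp: kap_def \<kappa>_def abs_minus_commute)
      next
        show "AE z in lborel. \<forall>e>0. \<exists>d>0. \<forall>w. \<bar>snd w - snd z\<bar> < d \<longrightarrow> G (w, z) < e"
          using AE_lborel_snd[OF S.AE_not_\<Omega>, where 'a=real]
        proof eventually_elim
          case (elim z)
          show ?case
          proof (intro allI impI)
            fix e :: real assume "0 < e"
            then obtain d where "d > 0" "\<And>x. \<bar>x - snd z\<bar> < d \<Longrightarrow> \<bar>S.K x (snd z) (U z) - U z\<bar> < e / 2"
              using S.K_tendsto[OF elim, of "e / 2"] by auto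
            then show "\<exists>d>0. \<forall>w. \<bar>snd w - snd z\<bar> < d \<longrightarrow> G (w, z) < e"
              by (intro exI[of _ d]) (force simp: G_def G2_def)
          qed
        qed
        show "integrable lborel (\<kappa> n)" for n
          unfolding \<kappa>_def[abs_def] using dbl(2)[of n] by (subst integral_lborel_swap(2)) simp_all
      qed (use G_bounds \<chi>0 emeasure_bounded_finite[OF bounded_subset[OF bB' BB]] in \<open>auto simp: G_def \<kappa>_def\<close>)
      moreover have "(\<integral>q. G q * \<kappa> n q \<partial>lborel) = (\<integral>q. G2 q * kap n q \<partial>lborel)" for n
        unfolding G_def \<kappa>_def by (rule integral_lborel_swap(1)) measurable
      ultimately show ?thesis by simp
    qed
    have "(\<lambda>n. 2 * C1 * Mm * (\<integral>q. G1 q * kap n q \<partial>lborel) + C1 * Mm * (\<integral>q. G2 q * kap n q \<partial>lborel))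
       \<longlonglongrightarrow> 2 * C1 * Mm * 0 + C1 * Mm * 0"
      by (intro tendsto_add tendsto_mult tendsto_const E1 E2)
    then have "(\<lambda>n. 2 * C1 * Mm * (\<integral>q. G1 q * kap n q \<partial>lborel) + C1 * Mm * (\<integral>q. G2 q * kap n q \<partial>lborel)) \<longlonglongrightarrow> 0"
      by simp
    then obtain n where n: "2 * C1 * Mm * (\<integral>q. G1 q * kap n q \<partial>lborel) + C1 * Mm * (\<integral>q. G2 q * kap n q \<partial>lborel) < e"
      "1 / real (Suc n) < \<delta>"
      using e \<delta>(1) by (rule ex_small_index)
    have "0 \<le> (\<integral>z. D z \<partial>lborel) + 2 * C1 * e + e"
      using main[of n] dbl(3)[of n] n by linarith
    moreover have "2 * C1 * e + e \<le> \<epsilon>"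
    proof -
      have "2 * C1 * e + e = (2 * C1 + 1) * e" by (simp add: algebra_simps)
      also have "\<dots> = \<epsilon> / 2" 
      proof -
        have "2 * C1 + 1 \<noteq> 0" using C1(1) by linarith
        then have "(2 * C1 + 1) * (\<epsilon> / (2 * C1 + 1)) = \<epsilon>" 
          unfolding times_divide_eq_right by (rule nonzero_mult_div_cancel_left)
        then show ?thesis unfolding e_def times_divide_eq_right by simp
      qed
      finally have "2 * C1 * e + e = \<epsilon> / 2" .
      then show ?thesis using \<epsilon> by simp
    qed
    ultimately show "0 \<le> (\<integral>z. D z \<partial>lborel) + \<epsilon>" by linarith
  qed
  then show "0 \<le> (\<integral>z. \<bar>U z - V z\<bar> * ?t z + kruzkov_flux (p z) (p' z) * ?x z \<partial>lborel)" by (simp add: D_def)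
qed

end

section \<open>Traces in time\<close>

lemma small_multiple:
  fixes G e :: real
  assumes "0 \<le> G" "0 < e"
  shows "\<exists>d>0. G * d \<le> e"
proof (intro exI[of _ "e / (G + 1)"] conjI)
  have "G / (G + 1) \<le> 1" using assms by simp
  then have "e * (G / (G + 1)) \<le> e * 1" using assms by (intro mult_left_mono) auto
  then show "G * (e / (G + 1)) \<le> e" by (simp add: mult.commute)
qed (use assms in auto)

lemma integral_kernel_close:
  fixes I k :: "real \<Rightarrow> real"
  assumes k: "\<And>t. 0 \<le> k t" "integrable lborel k" "(\<integral>t. k t \<partial>lborel) = 1"
    and i: "integrable lborel (\<lambda>t. k t * I t)"
    and close: "AE t in lborel. k t \<noteq> 0 \<longrightarrow> \<bar>I t - F\<bar> \<le> e"
  shows "\<bar>(\<integral>t. k t * I t \<partial>lborel) - F\<bar> \<le> e"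
proof -
  have "(\<integral>t. k t * I t \<partial>lborel) - F = (\<integral>t. k t * I t - k t * F \<partial>lborel)"
    using i k by simp
  also have "\<bar>\<dots>\<bar> \<le> (\<integral>t. \<bar>k t * I t - k t * F\<bar> \<partial>lborel)"
    by (rule integral_abs_bound)
  also have "\<dots> \<le> (\<integral>t. k t * e \<partial>lborel)"
  proof (rule integral_mono_AE)
    show "integrable lborel (\<lambda>t. \<bar>k t * I t - k t * F\<bar>)" using i k by simp
    show "integrable lborel (\<lambda>t. k t * e)" using k by simp
    show "AE t in lborel. \<bar>k t * I t - k t * F\<bar> \<le> k t * e"
      using close
    proof eventually_elim
      case (elim t)
      have "\<bar>k t * I t - k t * F\<bar> = k t * \<bar>I t - F\<bar>"
        using k(1)[of t] by (simp add: abs_mult flip: right_diff_distrib)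
      then show ?case using elim k(1)[of t] by (cases "k t = 0") (auto intro: mult_left_mono)
    qed
  qed
  also have "\<dots> = e" using k by simp
  finally show ?thesis .
qed

lemma AE_ex_in_Icc:
  fixes a b :: real
  assumes "AE t in lborel. Q t" "a < b"
  shows "\<exists>t\<in>{a..b}. Q t"
proof (rule ccontr)
  assume *: "\<not> ?thesis"
  have "AE t in lborel. t \<notin> {a..b}" using assms(1) by eventually_elim (use * in blast)
  then have "{a..b} \<in> null_sets lborel" by (subst AE_iff_null_sets) auto
  then show False using assms(2) by (simp add: null_sets_def)
qed

context adapted_solution
begin

lemma U_slice_AE: "AE t in lborel. AE x in lborel. t \<in> {0..T} \<longrightarrow> U (t, x) = u t x"
proof -
  have "AE z in (lborel \<Otimes>\<^sub>M lborel). z \<in> Q_dom T \<longrightarrow> U z = u (fst z) (snd z)"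
    unfolding lborel_prod by (rule U_AE)
  from lborel_pair.AE_pair[OF this] show ?thesis by simp
qed

lemma U_section_borel[measurable]: "(\<lambda>x. U (t, x)) \<in> borel_measurable borel"
proof -
  have "(\<lambda>x. (t, x)) \<in> borel_measurable (borel :: real measure)"
    by (intro borel_measurable_continuous_onI continuous_intros)
  from measurable_compose[OF this U_borel] show ?thesis .
qed

text \<open>\<open>U\<close> represents \<open>u\<close> only almost everywhere on Q and says
  nothing about an individual time s. \<open>W\<close> represents the slice \<open>u s\<close> on
  [-R,R], is the L1 limit there of the slices of \<open>U\<close> along almost every t, and inherits
  the bound \<open>C\<close>. Clamping makes that bound hold at every point.\<close>

lemma time_slice:
  assumes s: "s \<in> {0..T}"
  shows "\<exists>W. W \<in> borel_measurable borel \<and> (\<forall>x. \<bar>W x\<bar> \<le> C) \<and> (AE x in lborel. x \<in> {-R..R} \<longrightarrow> W x = u s x) \<and>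
     (\<forall>e>0. \<exists>d>0. AE t in lborel. t \<in> {0..T} \<and> \<bar>t - s\<bar> < d \<longrightarrow>
        (\<integral>x. indicator {-R..R} x * \<bar>U (t, x) - W x\<bar> \<partial>lborel) \<le> e)"
proof -
  have cont: "continuous_L1loc T u" using sol by (simp add: adapted_entropy_solution_def)
  have int: "set_integrable lebesgue {-R..R} (u t)" if "t \<in> {0..T}" for t
    using cont that by (simp add: continuous_L1loc_def)
  have lim: "((\<lambda>t. LINT x:{-R..R}|lebesgue. \<bar>u t x - u s x\<bar>) \<longlongrightarrow> 0) (at s within {0..T})"
    using cont s by (simp add: continuous_L1loc_def)
  have fm: "(\<lambda>x. indicator {-R..R} x *\<^sub>R u t x) \<in> borel_measurable lebesgue" if "t \<in> {0..T}" for t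
    using int[OF that] unfolding set_integrable_def by (rule borel_measurable_integrable)
  obtain W0 where W0: "W0 \<in> borel_measurable lborel" "AE x in lborel. indicator {-R..R} x *\<^sub>R u s x = W0 x"
    using completion_ex_borel_measurable_real[OF fm[OF s]] by blast
  have [measurable]: "W0 \<in> borel_measurable borel" using W0(1) by simp
  have if0: "integrable lebesgue (\<lambda>x. indicator {-R..R} x *\<^sub>R u s x)" using int[OF s] by (simp add: set_integrable_def)
  have W0l: "W0 \<in> borel_measurable lebesgue" using W0(1) by (rule measurable_completion)
  have iW0: "integrable lborel W0"
  proof -
    have "integrable lebesgue W0"
      using if0 by (subst (asm) integrable_cong_AE[OF fm[OF s] W0l AE_completion[OF W0(2)]])
    then show ?thesis by (subst (asm) integrable_completion) (use W0(1) in simp_all)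
  qed
  have close: "\<exists>d>0. AE t in lborel. t \<in> {0..T} \<and> \<bar>t - s\<bar> < d \<longrightarrow>
        (\<integral>x. indicator {-R..R} x * \<bar>U (t, x) - W0 x\<bar> \<partial>lborel) \<le> e" if e: "0 < e" for e
  proof -
    have "\<forall>\<^sub>F t in at s within {0..T}. (LINT x:{-R..R}|lebesgue. \<bar>u t x - u s x\<bar>) < e"
      using order_tendstoD(2)[OF lim e] .
    then obtain d where d: "d > 0" "\<And>t. t \<in> {0..T} \<Longrightarrow> t \<noteq> s \<Longrightarrow> \<bar>t - s\<bar> < d \<Longrightarrow>
        (LINT x:{-R..R}|lebesgue. \<bar>u t x - u s x\<bar>) < e"
      unfolding eventually_at dist_real_def by blast
    have "AE t in lborel. t \<in> {0..T} \<and> \<bar>t - s\<bar> < d \<longrightarrow>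
        (\<integral>x. indicator {-R..R} x * \<bar>U (t, x) - W0 x\<bar> \<partial>lborel) \<le> e"
      \<comment> \<open>The limit \<open>at s within {0..T}\<close> excludes t = s itself, which is
        a null set of times.\<close>
      using U_slice_AE AE_lborel_singleton[of s]
    proof eventually_elim
      case (elim t)
      show ?case
      proof
        assume t: "t \<in> {0..T} \<and> \<bar>t - s\<bar> < d"
        have "(\<integral>x. indicator {-R..R} x * \<bar>U (t, x) - W0 x\<bar> \<partial>lborel)
            = (\<integral>x. indicator {-R..R} x * \<bar>U (t, x) - W0 x\<bar> \<partial>lebesgue)"
          by (rule integral_completion[symmetric]) measurable
        also have "\<dots> = (\<integral>x. indicator {-R..R} x *\<^sub>R \<bar>u t x - u s x\<bar> \<partial>lebesgue)"
        proof (rule integral_cong_AE)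
          show "(\<lambda>x. indicator {-R..R} x * \<bar>U (t, x) - W0 x\<bar>) \<in> borel_measurable lebesgue"
            by (intro measurable_completion) measurable
          have "(\<lambda>x. indicator {-R..R} x *\<^sub>R \<bar>u t x - u s x\<bar>)
             = (\<lambda>x. \<bar>indicator {-R..R} x *\<^sub>R u t x - indicator {-R..R} x *\<^sub>R u s x\<bar>)"
            by (auto simp: indicator_def)
          then show "(\<lambda>x. indicator {-R..R} x *\<^sub>R \<bar>u t x - u s x\<bar>) \<in> borel_measurable lebesgue"
            using fm[of t] fm[OF s] t by simp
          have "AE x in lborel. indicator {-R..R} x * \<bar>U (t, x) - W0 x\<bar> = indicator {-R..R} x *\<^sub>R \<bar>u t x - u s x\<bar>"
            using elim(1) W0(2) by eventually_elim (use t in \<open>auto simp: indicator_def\<close>)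
          then show "AE x in lebesgue. indicator {-R..R} x * \<bar>U (t, x) - W0 x\<bar> = indicator {-R..R} x *\<^sub>R \<bar>u t x - u s x\<bar>"
            by (rule AE_completion)
        qed
        also have "\<dots> \<le> e" using d(2)[of t] t elim(2) by (simp add: set_lebesgue_integral_def)
        finally show "(\<integral>x. indicator {-R..R} x * \<bar>U (t, x) - W0 x\<bar> \<partial>lborel) \<le> e" .
      qed
    qed
    then show ?thesis using d(1) by blast
  qed
  let ?ind = "indicat_real {-R..R}"
  have iU: "integrable lborel (\<lambda>x. ?ind x * \<bar>U (t, x) - W x\<bar>)" if "integrable lborel W" for t W
  proof (rule integrable_dominated)
    show "integrable lborel (\<lambda>x. C * ?ind x + \<bar>W x\<bar>)"
      using that by (intro Bochner_Integration.integrable_add integrable_mult_right integrable_real_indicator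
          emeasure_bounded_finite integrable_abs) auto
    show "\<bar>?ind x * \<bar>U (t, x) - W x\<bar>\<bar> \<le> C * ?ind x + \<bar>W x\<bar>" for x
      using U_bound[of "(t, x)"] abs_triangle_ineq4[of "U (t, x)" "W x"] by (simp add: indicator_def)
    show "(\<lambda>x. ?ind x * \<bar>U (t, x) - W x\<bar>) \<in> borel_measurable lborel"
      using borel_measurable_integrable[OF that] by measurable
  qed
  have imax: "integrable lborel (\<lambda>x. ?ind x * max 0 (\<bar>W0 x\<bar> - C))"
  proof (rule Bochner_Integration.integrable_bound[OF integrable_abs[OF iW0]])
    show "AE x in lborel. norm (?ind x * max 0 (\<bar>W0 x\<bar> - C)) \<le> norm \<bar>W0 x\<bar>"
      using C_nonneg by (intro AE_I2) (auto simp: indicator_def)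
  qed measurable
  \<comment> \<open>The excess of |W0| over \<open>C\<close> is at most |U(t,.) - W0| for every t,
    and this distance is arbitrarily small in L1.\<close>
  have "(\<integral>x. ?ind x * max 0 (\<bar>W0 x\<bar> - C) \<partial>lborel) \<le> 0"
  proof (rule field_le_epsilon)
    fix e :: real assume "0 < e"
    then obtain d where d: "d > 0" "AE t in lborel. t \<in> {0..T} \<and> \<bar>t - s\<bar> < d \<longrightarrow>
        (\<integral>x. ?ind x * \<bar>U (t, x) - W0 x\<bar> \<partial>lborel) \<le> e" using close by blast
    \<comment> \<open>The halved distance keeps a closed interval of times strictly within d of s; T
      > 0 makes it nondegenerate even for s = 0 and s = T.\<close>
    have "max 0 (s - d / 2) < min T (s + d / 2)" using s d(1) T by auto
    from AE_ex_in_Icc[OF d(2) this] obtain t where "(\<integral>x. ?ind x * \<bar>U (t, x) - W0 x\<bar> \<partial>lborel) \<le> e"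
      using d(1) s by (auto simp: abs_if split: if_splits)
    moreover have "(\<integral>x. ?ind x * max 0 (\<bar>W0 x\<bar> - C) \<partial>lborel) \<le> (\<integral>x. ?ind x * \<bar>U (t, x) - W0 x\<bar> \<partial>lborel)"
    proof (rule integral_mono[OF imax iU[OF iW0]])
      fix x
      have "max 0 (\<bar>W0 x\<bar> - C) \<le> \<bar>U (t, x) - W0 x\<bar>" using U_bound[of "(t, x)"] by linarith
      then show "?ind x * max 0 (\<bar>W0 x\<bar> - C) \<le> ?ind x * \<bar>U (t, x) - W0 x\<bar>" by (intro mult_left_mono) auto
    qed
    ultimately show "(\<integral>x. ?ind x * max 0 (\<bar>W0 x\<bar> - C) \<partial>lborel) \<le> 0 + e" by linarith
  qed
  then have "(\<integral>x. ?ind x * max 0 (\<bar>W0 x\<bar> - C) \<partial>lborel) = 0"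
    by (intro antisym Bochner_Integration.integral_nonneg) auto
  then have "AE x in lborel. ?ind x * max 0 (\<bar>W0 x\<bar> - C) = 0"
    by (subst (asm) integral_nonneg_eq_0_iff_AE[OF imax]) auto
  then have b: "AE x in lborel. x \<in> {-R..R} \<longrightarrow> \<bar>W0 x\<bar> \<le> C"
    by eventually_elim (auto simp: indicator_def split: if_splits)
  define W where "W x = max (- \<bar>C\<bar>) (min \<bar>C\<bar> (W0 x))" for x
  have WW: "AE x in lborel. ?ind x * \<bar>U (t, x) - W x\<bar> = ?ind x * \<bar>U (t, x) - W0 x\<bar>" for t
    using b by eventually_elim (auto simp: W_def clamp_eq indicator_def)
  have [measurable]: "W \<in> borel_measurable borel" unfolding W_def[abs_def] by measurable
  have "(\<integral>x. ?ind x * \<bar>U (t, x) - W x\<bar> \<partial>lborel) = (\<integral>x. ?ind x * \<bar>U (t, x) - W0 x\<bar> \<partial>lborel)" for t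
    by (rule integral_cong_AE[OF _ _ WW]) measurable
  moreover have "\<bar>W x\<bar> \<le> C" for x using clamp_abs_le[of "\<bar>C\<bar>" "W0 x"] C_nonneg by (simp add: W_def)
  moreover have "AE x in lborel. x \<in> {-R..R} \<longrightarrow> W x = u s x"
    using b W0(2) by eventually_elim (auto simp: W_def clamp_eq indicator_def)
  ultimately show ?thesis using close by (intro exI[of _ W]) simp
qed

text \<open>Testing with functions that decrease from \<open>1\<close> to \<open>0\<close> in time \<open>1/n\<close> compares the trace at
  time \<open>0\<close> with the datum, for one stationary state at a time.\<close>

lemma initial_entropy_inequality:
  assumes u0: "Linf u0" and U0: "U0 \<in> borel_measurable borel" "\<And>x. \<bar>U0 x\<bar> \<le> C0" "AE x in lborel. U0 x = u0 x"
    and W: "W \<in> borel_measurable borel" "\<And>x. \<bar>W x\<bar> \<le> C"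
      "\<And>e. 0 < e \<Longrightarrow> \<exists>d>0. AE t in lborel. t \<in> {0..T} \<and> \<bar>t - 0\<bar> < d \<longrightarrow>
        (\<integral>x. indicator {-R..R} x * \<bar>U (t, x) - W x\<bar> \<partial>lborel) \<le> e"
    and y: "y \<notin> \<Omega>" and g: "smooth1 g" "\<And>x. 0 \<le> g x" "\<And>x. x \<notin> {l..r} \<Longrightarrow> g x = 0" "{l..r} \<subseteq> {-R..R}"
  shows "(\<integral>x. (\<bar>W x - K x y c\<bar> - \<bar>U0 x - K x y c\<bar>) * g x \<partial>lborel) \<le> 0"
proof -
  note [measurable] = U0(1) W(1)
  have gm[measurable]: "g \<in> borel_measurable borel" "deriv g \<in> borel_measurable borel"
    by (intro borel_measurable_smooth1 g smooth1_deriv)+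
  obtain G where G: "0 \<le> G" "\<And>x. \<bar>g x\<bar> \<le> G" using smooth1_bounded[OF g(1), of l r] g(3) by auto
  have dz: "deriv g x = 0" if "x \<notin> {l..r}" for x using deriv_zero_outside[of l r g x] g(3) that by auto
  obtain G' where G': "0 \<le> G'" "\<And>x. \<bar>deriv g x\<bar> \<le> G'"
    using smooth1_bounded[OF smooth1_deriv(2)[OF g(1)], of l r] dz by auto
  have ig: "integrable lborel g"
    by (rule integrable_lborel_bounded_support[OF gm(1) G(2), of "{l..r}"]) (use g(3) in auto)
  have idg: "integrable lborel (deriv g)"
    by (rule integrable_lborel_bounded_support[OF gm(2) G'(2), of "{l..r}"]) (use dz in auto)
  define k where "k x = K x y c" for x
  have [measurable]: "k \<in> borel_measurable borel" unfolding k_def[abs_def] by measurable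
  \<comment> \<open>The first factor only cuts off negative times, to make the support compact. For
    t \<ge> 0 it is 1, and \<open>chi n\<close> falls from 1 to 0 with - chi' = \<open>om n\<close>,
    a kernel of mass 1.\<close>
  define chi where "chi n t = smooth_step (1 * t + 2) * smooth_step (- real (Suc n) * t + 1)" for n t
  define om where "om n t = moll (real (Suc n)) (1 / real (Suc n) - t)" for n t
  have s_chi: "smooth1 (chi n)" for n
    unfolding chi_def[abs_def] by (intro smooth1_mult smooth1_affine smooth1_step)
  have chi0: "chi n 0 = 1" for n by (simp add: chi_def smooth_step_1)
  have chi_nn: "0 \<le> chi n t" and chi_le: "chi n t \<le> 1" for n t
    by (simp_all add: chi_def smooth_step_bounds mult_le_one)
  have chi_z: "chi n t = 0" if tn: "t \<notin> {-2..1 / real (Suc n)}" for n t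
  proof -
    consider "t < -2" | "t > 1 / real (Suc n)" using tn by force
    then show ?thesis
    proof cases
      case 2
      then have "- real (Suc n) * t + 1 \<le> 0" by (simp add: field_simps del: of_nat_Suc)
      then show ?thesis by (simp only: chi_def smooth_step_0 mult_zero_right)
    qed (simp add: chi_def smooth_step_0)
  qed
  have d_chi: "deriv (chi n) t = - om n t" if "0 \<le> t" for n t
  proof (rule DERIV_imp_deriv)
    have "(chi n has_real_derivative (bump (1 * t + 2) * 1) * smooth_step (- real (Suc n) * t + 1)
       + (bump (- real (Suc n) * t + 1) * - real (Suc n)) * smooth_step (1 * t + 2)) (at t)"
      unfolding chi_def[abs_def]
      by (intro DERIV_mult DERIV_chain2[OF DERIV_smooth_step]) (auto intro!: derivative_eq_intros)
    moreover have "- real (Suc n) * t + 1 = real (Suc n) * (1 / real (Suc n) - t)"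
      by (simp add: right_diff_distrib del: of_nat_Suc)
    ultimately show "(chi n has_real_derivative - om n t) (at t)"
      using that by (simp add: bump_1 smooth_step_1 om_def moll_def mult.commute del: of_nat_Suc)
  qed
  have om: "0 \<le> om n t" "integrable lborel (om n)" "(\<integral>t. om n t \<partial>lborel) = 1" for n t
    using integral_moll_shift(3,4)[of "real (Suc n)" "1 / real (Suc n)"]
    by (simp_all add: om_def[abs_def] moll_nonneg)
  have om_supp: "0 < t \<and> t < 1 / real (Suc n)" if "om n t \<noteq> 0" for n t
    using moll_support[of "real (Suc n)" "1 / real (Suc n) - t"] that by (auto simp: om_def)
  have omm[measurable]: "om n \<in> borel_measurable borel" "chi n \<in> borel_measurable borel" for n
    using om(2)[of n] borel_measurable_smooth1[OF s_chi] by auto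
  \<comment> \<open>From this index on the support of \<open>chi n\<close> ends before T, so that a
    test function results; 1 / (N + 1) also serves as the time horizon of the dominating function
    \<open>bd\<close>.\<close>
  obtain N where N: "1 / real (Suc N) < T" using nat_approx_posE[OF T] by blast
  have NT: "1 / real (Suc n) < T" if "n \<ge> N" for n
    using frac_le[of 1 1 "real (Suc N)" "real (Suc n)"] that N by simp
  define b where "b = 1 / real (Suc N)"
  let ?fl = "\<lambda>n z. indicator (Q_dom T) z * (kruzkov_flux (P (snd z) (U z)) (P y c) * (chi n (fst z) * deriv g (snd z)))"
  define bd where "bd z = G' * (\<bar>indicator ({0..b} \<times> {l..r}) z * P (snd z) (U z)\<bar> + \<bar>P y c\<bar> * indicator ({0..b} \<times> {l..r}) z)" for z
  have ibd: "integrable lborel bd"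
    unfolding bd_def[abs_def] using N
    by (intro integrable_mult_right Bochner_Integration.integrable_add integrable_abs flux_locally_integrable
       integrable_real_indicator emeasure_bounded_finite bounded_Times) (auto simp: b_def Icc_Times_borel)
  have fl_le: "\<bar>?fl n z\<bar> \<le> bd z" if n: "n \<ge> N" for n z
  proof (cases "z \<in> {0..b} \<times> {l..r}")
    case True
    have "\<bar>?fl n z\<bar> \<le> 1 * ((\<bar>P (snd z) (U z)\<bar> + \<bar>P y c\<bar>) * (1 * G'))"
      unfolding abs_mult using chi_nn[of n "fst z"] chi_le[of n "fst z"]
      by (intro mult_mono kruzkov_flux_le G') (auto simp: indicator_def)
    then show ?thesis using True by (simp add: bd_def algebra_simps)
  next
    case False
    have nb: "1 / real (Suc n) \<le> b" unfolding b_def using n by (intro frac_le) auto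
    have "z \<notin> Q_dom T \<or> fst z \<notin> {-2..1 / real (Suc n)} \<or> snd z \<notin> {l..r}"
    proof (rule ccontr)
      assume "\<not> ?thesis"
      then have "0 \<le> fst z" "fst z \<le> 1 / real (Suc n)" "snd z \<in> {l..r}" by (auto simp: mem_Times_iff)
      then have "z \<in> {0..b} \<times> {l..r}" using nb by (simp add: mem_Times_iff)
      then show False using False by simp
    qed
    then have "?fl n z = 0" using chi_z[of "fst z" n] dz[of "snd z"] by auto
    then show ?thesis using False by (simp add: bd_def)
  qed
  have flm: "?fl n \<in> borel_measurable borel" for n by measurable
  have ifl: "integrable lborel (?fl n)" if "n \<ge> N" for n
    by (rule Bochner_Integration.integrable_bound[OF ibd])
      (use flm fl_le[OF that] in \<open>auto intro!: AE_I2 order_trans[OF _ abs_ge_self]\<close>)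
  \<comment> \<open>The flux term contains \<open>chi n\<close> undifferentiated, and
    \<open>chi n\<close> vanishes at each fixed positive time for large n. The whole term therefore
    disappears in the limit.\<close>
  have fl_lim: "(\<lambda>n. \<integral>z. ?fl (n + N) z \<partial>lborel) \<longlonglongrightarrow> (\<integral>z. 0 \<partial>(lborel :: (real \<times> real) measure))"
  proof (rule integral_dominated_convergence[where w=bd])
    show "AE z in lborel. (\<lambda>n. ?fl (n + N) z) \<longlonglongrightarrow> 0"
    proof -
      have "AE z in (lborel :: (real \<times> real) measure). fst z \<noteq> 0"
      proof -
        have "emeasure (lborel \<Otimes>\<^sub>M lborel) ({0 :: real} \<times> (UNIV :: real set)) = 0"
          by (subst lborel.emeasure_pair_measure_Times) auto
        then have "{0 :: real} \<times> (UNIV :: real set) \<in> null_sets lborel"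
          unfolding lborel_prod[symmetric] by (auto simp: null_sets_def intro!: pair_measureI)
        then show ?thesis by (rule AE_I') auto
      qed
      then show ?thesis
      proof eventually_elim
        case (elim z)
        show ?case
        proof (cases "fst z > 0")
          case True
          obtain m where m: "1 / real (Suc m) < fst z" using nat_approx_posE[OF True] by blast
          have "?fl (n + N) z = 0" if "n \<ge> m" for n
          proof -
            have "1 / real (Suc (n + N)) \<le> 1 / real (Suc m)" using that by (intro frac_le) auto
            then have "chi (n + N) (fst z) = 0" using m by (intro chi_z) auto
            then show ?thesis by simp
          qed
          then show ?thesis by (intro tendsto_eventually eventually_sequentiallyI[of m])
        next
          case False
          then have "z \<notin> Q_dom T" using elim by (auto simp: mem_Times_iff)
          then show ?thesis by simp
        qed
      qed
    qed
    show "AE z in lborel. norm (?fl (n + N) z) \<le> bd z" for n using fl_le[of "n + N"] by simp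
  qed (use ibd flm in auto)
  \<comment> \<open>\<open>k\<close> may be unbounded. Its integrability against \<open>g\<close> is
    read off from that of |u0 - k| g, which the definition of a solution grants, because the datum
    is bounded.\<close>
  have kg: "integrable lborel (\<lambda>x. k x * g x)" and ent: "\<And>n. n \<ge> N \<Longrightarrow>
     integrable lborel (\<lambda>z. \<bar>U z - k (snd z)\<bar> * (om n (fst z) * g (snd z))) \<and>
     (\<integral>z. \<bar>U z - k (snd z)\<bar> * (om n (fst z) * g (snd z)) \<partial>lborel)
       \<le> (\<integral>z. ?fl n z \<partial>lborel) + (\<integral>x. \<bar>U0 x - k x\<bar> * g x \<partial>lborel)"
  proof -
    have ini: "integrable lebesgue (\<lambda>x. \<bar>u0 x - k x\<bar> * g x) \<and>
       integrable lborel (\<lambda>z. \<bar>U z - k (snd z)\<bar> * (om n (fst z) * g (snd z))) \<and>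
       (\<integral>z. \<bar>U z - k (snd z)\<bar> * (om n (fst z) * g (snd z)) \<partial>lborel)
       \<le> (\<integral>z. ?fl n z \<partial>lborel) + (\<integral>x. \<bar>u0 x - k x\<bar> * g x \<partial>lebesgue)" if n: "n \<ge> N" for n
    proof -
      let ?\<phi> = "\<lambda>t x. chi n t * g x"
      have s: "smoothC ?\<phi>" by (intro smoothC_mult smoothC_fst smoothC_snd s_chi g)
      have t: "test_function T ?\<phi>"
        by (rule test_functionI[OF s, of "-2" "1 / real (Suc n)" l r])
          (use NT[OF n] chi_nn g(2) chi_z[of _ n] g(3) in \<open>auto simp del: of_nat_Suc\<close>)
      have F: "indicator (Q_dom T) z * (\<bar>U z - K (snd z) y c\<bar> * pd_t ?\<phi> (fst z) (snd z)
          + kruzkov_flux (P (snd z) (U z)) (P y c) * pd_x ?\<phi> (fst z) (snd z))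
        = ?fl n z - \<bar>U z - k (snd z)\<bar> * (om n (fst z) * g (snd z))" for z
      proof (cases "z \<in> Q_dom T")
        case True
        then show ?thesis
          unfolding pd_product[OF s_chi g(1)] using d_chi[of "fst z" n] by (simp add: mem_Times_iff k_def algebra_simps)
      next
        case False
        have "om n (fst z) = 0"
        proof (rule ccontr)
          assume "om n (fst z) \<noteq> 0"
          then have "0 < fst z" "fst z < T" using om_supp[of n "fst z"] NT[OF n] by auto
          then show False using False by (simp add: mem_Times_iff)
        qed
        then show ?thesis using False by simp
      qed
      note E = entropy_inequality_borel[OF y t s, of c, unfolded F chi0 mult_1, folded k_def]
      have i: "integrable lborel (\<lambda>z. \<bar>U z - k (snd z)\<bar> * (om n (fst z) * g (snd z)))"
        using Bochner_Integration.integrable_diff[OF ifl[OF n] E(1)] by simp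
      show ?thesis using E(2,3) i ifl[OF n] by simp
    qed
    have U0l: "(\<lambda>x. \<bar>U0 x - k x\<bar> * g x) \<in> borel_measurable lebesgue"
      by (intro measurable_completion) measurable
    have ae: "AE x in lebesgue. \<bar>u0 x - k x\<bar> * g x = \<bar>U0 x - k x\<bar> * g x"
    proof (rule AE_completion)
      show "AE x in lborel. \<bar>u0 x - k x\<bar> * g x = \<bar>U0 x - k x\<bar> * g x"
        using U0(3) by eventually_elim simp
    qed
    have u0l: "(\<lambda>x. \<bar>u0 x - k x\<bar> * g x) \<in> borel_measurable lebesgue"
      using ini[of N] by (auto intro: borel_measurable_integrable)
    have "integrable lebesgue (\<lambda>x. \<bar>U0 x - k x\<bar> * g x)"
      using ini[of N] integrable_cong_AE[OF u0l U0l ae] by simp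
    then have i0: "integrable lborel (\<lambda>x. \<bar>U0 x - k x\<bar> * g x)"
      by (subst (asm) integrable_completion) simp_all
    show "integrable lborel (\<lambda>x. k x * g x)"
    proof (rule integrable_dominated)
      show "integrable lborel (\<lambda>x. \<bar>U0 x - k x\<bar> * g x + C0 * g x)" using i0 ig by simp
      show "\<bar>k x * g x\<bar> \<le> \<bar>U0 x - k x\<bar> * g x + C0 * g x" for x
      proof -
        have "\<bar>k x\<bar> \<le> \<bar>U0 x - k x\<bar> + C0" using U0(2)[of x] by linarith
        from mult_right_mono[OF this g(2)[of x]] show ?thesis using g(2)[of x] by (simp add: abs_mult distrib_right)
      qed
    qed measurable
    have "(\<integral>x. \<bar>u0 x - k x\<bar> * g x \<partial>lebesgue) = (\<integral>x. \<bar>U0 x - k x\<bar> * g x \<partial>lborel)"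
      by (subst integral_cong_AE[OF u0l U0l ae]) (rule integral_completion, measurable)
    then show "\<And>n. n \<ge> N \<Longrightarrow>
     integrable lborel (\<lambda>z. \<bar>U z - k (snd z)\<bar> * (om n (fst z) * g (snd z))) \<and>
     (\<integral>z. \<bar>U z - k (snd z)\<bar> * (om n (fst z) * g (snd z)) \<partial>lborel)
       \<le> (\<integral>z. ?fl n z \<partial>lborel) + (\<integral>x. \<bar>U0 x - k x\<bar> * g x \<partial>lborel)" using ini by simp
  qed
  have ikf: "integrable lborel (\<lambda>x. \<bar>f x - k x\<bar> * g x)"
    if [measurable]: "f \<in> borel_measurable borel" and f: "\<And>x. \<bar>f x\<bar> \<le> B" for f B
  proof (rule integrable_dominated)
    show "integrable lborel (\<lambda>x. B * g x + \<bar>k x * g x\<bar>)" using ig kg by simp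
    show "\<bar>\<bar>f x - k x\<bar> * g x\<bar> \<le> B * g x + \<bar>k x * g x\<bar>" for x
    proof -
      have "\<bar>f x - k x\<bar> \<le> B + \<bar>k x\<bar>" using f[of x] by linarith
      from mult_right_mono[OF this g(2)[of x]] show ?thesis using g(2)[of x] by (simp add: abs_mult distrib_right)
    qed
  qed measurable
  define FW where "FW = (\<integral>x. \<bar>W x - k x\<bar> * g x \<partial>lborel)"
  define F0 where "F0 = (\<integral>x. \<bar>U0 x - k x\<bar> * g x \<partial>lborel)"
  have "FW \<le> F0"
  proof (rule field_le_epsilon)
    fix e :: real assume e: "0 < e"
    obtain e' where e': "0 < e'" "G * e' \<le> e / 2"
      using small_multiple[OF G(1), of "e / 2"] e by auto
    obtain d where d: "d > 0" "AE t in lborel. t \<in> {0..T} \<and> \<bar>t - 0\<bar> < d \<longrightarrow>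
        (\<integral>x. indicator {-R..R} x * \<bar>U (t, x) - W x\<bar> \<partial>lborel) \<le> e'" using W(3)[OF e'(1)] by blast
    have "(\<lambda>n. \<integral>z. ?fl (n + N) z \<partial>lborel) \<longlonglongrightarrow> 0" "0 < e / 2" using fl_lim e by simp_all
    then obtain m where m: "(\<integral>z. ?fl (m + N) z \<partial>lborel) < e / 2" "1 / real (Suc m) < d"
      using d(1) by (rule ex_small_index)
    define n where "n = m + N"
    have n: "n \<ge> N" "1 / real (Suc n) < d"
      using frac_le[of 1 1 "real (Suc m)" "real (Suc n)"] m(2) by (auto simp: n_def)
    have iz: "integrable lborel (\<lambda>z. \<bar>U z - k (snd z)\<bar> * (om n (fst z) * g (snd z)))"
      and le: "(\<integral>z. \<bar>U z - k (snd z)\<bar> * (om n (fst z) * g (snd z)) \<partial>lborel) \<le> (\<integral>z. ?fl n z \<partial>lborel) + F0"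
      using ent[OF n(1)] by (auto simp: F0_def)
    have eq: "(\<integral>x. \<bar>U (t, x) - k x\<bar> * (om n t * g x) \<partial>lborel) = om n t * (\<integral>x. \<bar>U (t, x) - k x\<bar> * g x \<partial>lborel)" for t
      by (subst integral_mult_right_zero[symmetric]) (simp add: mult.left_commute)
    have io: "integrable lborel (\<lambda>t. om n t * (\<integral>x. \<bar>U (t, x) - k x\<bar> * g x \<partial>lborel))"
      using lborel_Fubini(3)[OF iz] by (simp add: eq)
    have "\<bar>(\<integral>t. om n t * (\<integral>x. \<bar>U (t, x) - k x\<bar> * g x \<partial>lborel) \<partial>lborel) - FW\<bar> \<le> G * e'"
    proof (rule integral_kernel_close[OF om io])
      show "AE t in lborel. om n t \<noteq> 0 \<longrightarrow> \<bar>(\<integral>x. \<bar>U (t, x) - k x\<bar> * g x \<partial>lborel) - FW\<bar> \<le> G * e'"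
        using d(2)
      proof eventually_elim
        case (elim t)
        show ?case
        proof
          assume "om n t \<noteq> 0"
          then have "t \<in> {0..T} \<and> \<bar>t - 0\<bar> < d" using om_supp[of n t] n NT[OF n(1)] by auto
          then have small: "(\<integral>x. indicator {-R..R} x * \<bar>U (t, x) - W x\<bar> \<partial>lborel) \<le> e'" using elim by blast
          have i1: "integrable lborel (\<lambda>x. \<bar>U (t, x) - k x\<bar> * g x)"
            by (rule ikf[of _ C]) (use U_bound in auto)
          have i2: "integrable lborel (\<lambda>x. \<bar>W x - k x\<bar> * g x)" by (rule ikf[of _ C]) (use W(2) in auto)
          have iW: "integrable lborel (\<lambda>x. indicator {-R..R} x * \<bar>U (t, x) - W x\<bar>)"
          proof (rule integrable_lborel_bounded_support[of _ "2 * C" "{-R..R}"])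
            fix x show "\<bar>indicator {-R..R} x * \<bar>U (t, x) - W x\<bar>\<bar> \<le> 2 * C"
              using U_bound[of "(t, x)"] W(2)[of x] abs_triangle_ineq4[of "U (t, x)" "W x"] C_nonneg
              by (simp add: indicator_def)
          qed auto
          have "\<bar>(\<integral>x. \<bar>U (t, x) - k x\<bar> * g x \<partial>lborel) - FW\<bar>
             = \<bar>\<integral>x. \<bar>U (t, x) - k x\<bar> * g x - \<bar>W x - k x\<bar> * g x \<partial>lborel\<bar>"
            using i1 i2 by (simp add: FW_def)
          also have "\<dots> \<le> (\<integral>x. \<bar>\<bar>U (t, x) - k x\<bar> * g x - \<bar>W x - k x\<bar> * g x\<bar> \<partial>lborel)"
            by (rule integral_abs_bound)
          also have "\<dots> \<le> (\<integral>x. G * (indicator {-R..R} x * \<bar>U (t, x) - W x\<bar>) \<partial>lborel)"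
          proof (rule integral_mono)
            show "integrable lborel (\<lambda>x. \<bar>\<bar>U (t, x) - k x\<bar> * g x - \<bar>W x - k x\<bar> * g x\<bar>)" using i1 i2 by simp
            show "integrable lborel (\<lambda>x. G * (indicator {-R..R} x * \<bar>U (t, x) - W x\<bar>))" using iW by simp
            fix x
            show "\<bar>\<bar>U (t, x) - k x\<bar> * g x - \<bar>W x - k x\<bar> * g x\<bar> \<le> G * (indicator {-R..R} x * \<bar>U (t, x) - W x\<bar>)"
            proof (cases "x \<in> {l..r}")
              case True
              then have xR: "x \<in> {-R..R}" using g(4) by blast
              have "\<bar>\<bar>U (t, x) - k x\<bar> * g x - \<bar>W x - k x\<bar> * g x\<bar> = \<bar>\<bar>U (t, x) - k x\<bar> - \<bar>W x - k x\<bar>\<bar> * \<bar>g x\<bar>"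
                by (simp add: abs_mult flip: left_diff_distrib)
              also have "\<dots> \<le> \<bar>U (t, x) - W x\<bar> * G"
                using abs_triangle_ineq3[of "U (t, x) - k x" "W x - k x"] G by (intro mult_mono) auto
              finally show ?thesis using xR by (simp add: mult.commute)
            next
              case False
              then show ?thesis using g(3) G(1) by simp
            qed
          qed
          also have "\<dots> = G * (\<integral>x. indicator {-R..R} x * \<bar>U (t, x) - W x\<bar> \<partial>lborel)" by simp
          also have "\<dots> \<le> G * e'" using small G(1) by (rule mult_left_mono)
          finally show "\<bar>(\<integral>x. \<bar>U (t, x) - k x\<bar> * g x \<partial>lborel) - FW\<bar> \<le> G * e'" .
        qed
      qed
    qed
    moreover have "(\<integral>t. om n t * (\<integral>x. \<bar>U (t, x) - k x\<bar> * g x \<partial>lborel) \<partial>lborel)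
        = (\<integral>z. \<bar>U z - k (snd z)\<bar> * (om n (fst z) * g (snd z)) \<partial>lborel)"
      using lborel_Fubini(5)[OF iz] by (simp add: eq)
    ultimately show "FW \<le> F0 + e" using le m(1) e'(2) unfolding n_def[symmetric] by linarith
  qed
  moreover have "(\<integral>x. (\<bar>W x - k x\<bar> - \<bar>U0 x - k x\<bar>) * g x \<partial>lborel) = FW - F0"
  proof -
    have "integrable lborel (\<lambda>x. \<bar>W x - k x\<bar> * g x)" "integrable lborel (\<lambda>x. \<bar>U0 x - k x\<bar> * g x)"
      by (rule ikf[of _ C] ikf[of _ C0]; use W(2) U0(2) in simp)+
    then show ?thesis by (simp add: FW_def F0_def left_diff_distrib)
  qed
  ultimately show ?thesis by (simp add: k_def)
qed

text \<open>Kruzkov's argument in space alone: the state passing through \<open>U0 y\<close> at y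
  makes |U0 x - K| small for x near y, whereas |W x - K| is then close to |W x - U0 x|. Averaging
  the inequalities over y with a shrinking kernel leaves the integral of |W - U0| g at most
  0.\<close>

lemma initial_trace:
  assumes u0: "Linf u0" and U0: "U0 \<in> borel_measurable borel" "\<And>x. \<bar>U0 x\<bar> \<le> C0" "AE x in lborel. U0 x = u0 x"
    and W: "W \<in> borel_measurable borel" "\<And>x. \<bar>W x\<bar> \<le> C"
      "\<And>e. 0 < e \<Longrightarrow> \<exists>d>0. AE t in lborel. t \<in> {0..T} \<and> \<bar>t - 0\<bar> < d \<longrightarrow>
        (\<integral>x. indicator {-R..R} x * \<bar>U (t, x) - W x\<bar> \<partial>lborel) \<le> e"
    and lr: "{l - 1..r + 1} \<subseteq> {-R..R}"
  shows "AE x in lborel. x \<in> {l..r} \<longrightarrow> W x = U0 x"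
proof -
  note [measurable] = U0(1) W(1)
  define g where "g = cutoff (l - 1) l r (r + 1)"
  \<comment> \<open>x ranges over [l - 1, r + 1], the support of \<open>g\<close>, and y lies to the
    left of x by less than 1.\<close>
  define J where "J = {l - 2..r + 1}"
  have g: "smooth1 g" "\<And>x. 0 \<le> g x" "\<And>x. g x \<le> 1" "\<And>x. x \<in> {l..r} \<Longrightarrow> g x = 1"
    "\<And>x. x \<notin> {l - 1..r + 1} \<Longrightarrow> g x = 0"
    unfolding g_def by (auto intro: smooth1_cutoff cutoff_bounds cutoff_eq_1) (auto intro!: cutoff_eq_0)
  have [measurable]: "g \<in> borel_measurable borel" by (rule borel_measurable_smooth1[OF g(1)])
  have [measurable]: "J \<in> sets borel" by (simp add: J_def)
  have C0: "0 \<le> C0" using U0(2)[of 0] by linarith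
  define D where "D x = \<bar>W x - U0 x\<bar> * g x" for x
  have [measurable]: "D \<in> borel_measurable borel" unfolding D_def[abs_def] by measurable
  have bWU: "\<bar>W x - U0 x\<bar> \<le> C + C0" for x using W(2)[of x] U0(2)[of x] by linarith
  have iD: "integrable lborel D"
  proof (rule integrable_lborel_bounded_support[of _ "(C + C0) * 1" "{l - 1..r + 1}"])
    show "\<bar>D x\<bar> \<le> (C + C0) * 1" for x
      unfolding D_def abs_mult using bWU[of x] g(2,3)[of x] by (intro mult_mono) auto
  qed (use g(5) in \<open>auto simp: D_def\<close>)
  define f where "f x = indicator J x * U0 x" for x
  have "\<bar>f x\<bar> \<le> C0" for x using U0(2)[of x] C0 by (simp add: f_def indicator_def)
  then have if0: "integrable lborel f"
    by (intro integrable_lborel_bounded_support[of _ C0 J]) (auto simp: f_def[abs_def] J_def)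
  define Kq where "Kq q = K (fst q) (snd q) (U0 (snd q))" for q :: "real \<times> real"
  define G where "G q = min (2 * \<bar>Kq q - U0 (snd q)\<bar>) (2 * (C + C0))" for q
  have [measurable]: "Kq \<in> borel_measurable borel" unfolding Kq_def[abs_def] by measurable
  have [measurable]: "G \<in> borel_measurable borel" unfolding G_def[abs_def] by measurable
  define k where "k n = moll (real (Suc n))" for n
  have k: "0 \<le> k n h" "integrable lborel (k n)" "(\<integral>h. k n h \<partial>lborel) = 1" for n h
    using integral_moll[of "real (Suc n)"] by (simp_all add: k_def moll_nonneg)
  have [measurable]: "k n \<in> borel_measurable borel" for n using k(2)[of n] by simp
  have ksupp: "0 < h \<and> h < 1 / real (Suc n)" if "k n h \<noteq> 0" for n h
    using moll_support[of "real (Suc n)" h] that by (simp add: k_def)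
  have inJ: "fst q \<in> J" "snd q \<in> J" if "g (fst q) \<noteq> 0" "k n (fst q - snd q) \<noteq> 0" for n q
  proof -
    have "fst q \<in> {l - 1..r + 1}" using g(5)[of "fst q"] that(1) by blast
    moreover have "0 < fst q - snd q" "fst q - snd q < 1"
      using ksupp[OF that(2)] by (auto intro: less_le_trans)
    ultimately show "fst q \<in> J" "snd q \<in> J" by (auto simp: J_def)
  qed
  define \<kappa> where "\<kappa> n q = g (fst q) * k n (fst q - snd q)" for n q
  have \<kappa>nn: "0 \<le> \<kappa> n q" for n q using g(2) k(1) by (simp add: \<kappa>_def)
  have \<kappa>supp: "q \<in> J \<times> J" if "\<kappa> n q \<noteq> 0" for n q
    using inJ[of q n] that by (auto simp: \<kappa>_def mem_Times_iff)
  have bJ: "bounded (J \<times> J)" unfolding J_def by (intro bounded_Times) auto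
  have [measurable]: "\<kappa> n \<in> borel_measurable borel" for n unfolding \<kappa>_def[abs_def] by measurable
  have ib: "integrable lborel (\<lambda>q. h q * \<kappa> n q)"
    if [measurable]: "h \<in> borel_measurable borel" and h: "\<And>q. \<bar>h q\<bar> \<le> B" for h B n
  proof -
    obtain Mn where Mn: "0 \<le> Mn" "\<And>r. \<bar>k n r\<bar> \<le> Mn"
      using moll_bounded[of "real (Suc n)"] unfolding k_def by auto
    show ?thesis
    proof (rule integrable_lborel_bounded_support[of _ "B * (1 * Mn)", OF _ _ bJ])
      have "0 \<le> B" using h[of undefined] by linarith
      then show "\<bar>h q * \<kappa> n q\<bar> \<le> B * (1 * Mn)" for q
        unfolding \<kappa>_def abs_mult using g(2,3)[of "fst q"] by (intro mult_mono h Mn) auto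
      show "h q * \<kappa> n q = 0" if "q \<notin> J \<times> J" for q using \<kappa>supp[of n q] that by auto
    qed measurable
  qed
  \<comment> \<open>The integrand of the initial inequality for the state through
    \<open>U0 y\<close>. It is at most |W - U0| in modulus, hence bounded whatever the size of
    \<open>Kq\<close>.\<close>
  define H where "H q = \<bar>W (fst q) - Kq q\<bar> - \<bar>U0 (fst q) - Kq q\<bar>" for q
  have [measurable]: "H \<in> borel_measurable borel" unfolding H_def[abs_def] by measurable
  have bH: "\<bar>H q\<bar> \<le> C + C0" for q
    using abs_triangle_ineq3[of "W (fst q) - Kq q" "U0 (fst q) - Kq q"] bWU[of "fst q"] by (simp add: H_def)
  have iH: "integrable lborel (\<lambda>q. H q * \<kappa> n q)" for n by (rule ib[OF _ bH]) measurable
  have bG: "0 \<le> G q" "G q \<le> 2 * (C + C0)" for q using C0 C_nonneg by (auto simp: G_def)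
  have iG: "integrable lborel (\<lambda>q. G q * \<kappa> n q)" for n
    by (rule ib[of _ "2 * (C + C0)"]) (use bG in \<open>auto simp: abs_of_nonneg\<close>)
  have H0: "(\<integral>q. H q * \<kappa> n q \<partial>lborel) \<le> 0" for n
  proof -
    have "(\<integral>x. H (x, y) * \<kappa> n (x, y) \<partial>lborel) \<le> 0" if y: "y \<notin> \<Omega>" for y
    proof -
      have "(\<integral>x. (\<bar>W x - K x y (U0 y)\<bar> - \<bar>U0 x - K x y (U0 y)\<bar>) * (g x * k n (x - y)) \<partial>lborel) \<le> 0"
        by (rule initial_entropy_inequality[OF u0 U0 W y _ _ _ lr])
          (use g k(1) smooth1_moll_shift in \<open>auto intro!: smooth1_mult simp: k_def\<close>)
      then show ?thesis by (simp add: H_def Kq_def \<kappa>_def)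
    qed
    then have "AE y in lborel. (\<integral>x. H (x, y) * \<kappa> n (x, y) \<partial>lborel) \<le> 0"
      using AE_not_\<Omega> by (auto elim: eventually_mono)
    then have "(\<integral>y. (\<integral>x. H (x, y) * \<kappa> n (x, y) \<partial>lborel) \<partial>lborel) \<le> (\<integral>y. 0 \<partial>(lborel :: real measure))"
      by (intro integral_mono_AE lborel_Fubini(4)[OF iH]) auto
    then show ?thesis using lborel_Fubini(6)[OF iH[of n]] by simp
  qed
  have E: "(\<lambda>n. \<integral>q. G q * \<kappa> n q \<partial>lborel) \<longlonglongrightarrow> 0"
  proof (rule concentrating_kernel_tendsto_0(1)[where C="2 * (C + C0)" and ?C1.0=1 and B=J and \<pi>="\<lambda>x. x" and \<sigma>="\<lambda>x. x"])
    fix n y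
    have iK: "integrable lborel (\<lambda>x. k n (x - y))" "(\<integral>x. k n (x - y) \<partial>lborel) = 1"
      using integral_moll_shift(1,2)[of "real (Suc n)" y] by (simp_all add: k_def)
    have le: "\<kappa> n (x, y) \<le> k n (x - y) * indicator J y" for x
      using \<kappa>supp[of n "(x, y)"] g(2,3)[of x] k(1)[of n "x - y"] mult_right_mono[of "g x" 1 "k n (x - y)"]
      by (cases "\<kappa> n (x, y) = 0") (auto simp: \<kappa>_def)
    show i: "integrable lborel (\<lambda>x. \<kappa> n (x, y))"
    proof (rule Bochner_Integration.integrable_bound[OF iK(1)])
      have "\<kappa> n (x, y) \<le> k n (x - y)" for x
        using le[of x] k(1)[of n "x - y"] by (auto simp: indicator_def split: if_splits intro: order_trans)
      then show "AE x in lborel. norm (\<kappa> n (x, y)) \<le> norm (k n (x - y))"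
        using \<kappa>nn k(1) by (intro AE_I2) (simp add: abs_of_nonneg)
      show "(\<lambda>x. \<kappa> n (x, y)) \<in> borel_measurable lborel" unfolding \<kappa>_def fst_conv snd_conv by measurable
    qed
    have "(\<integral>x. \<kappa> n (x, y) \<partial>lborel) \<le> (\<integral>x. k n (x - y) * indicator J y \<partial>lborel)"
      by (intro integral_mono i integrable_mult_left iK le)
    then show "(\<integral>x. \<kappa> n (x, y) \<partial>lborel) \<le> 1 * indicator J y" using iK by simp
  next
    fix n x y assume "\<kappa> n (x, y) \<noteq> 0"
    then show "\<bar>x - y\<bar> \<le> 1 / real (Suc n)" using ksupp[of n "x - y"] by (auto simp: \<kappa>_def)
  next
    show "integrable lborel (\<kappa> n)" for n using ib[of "\<lambda>q. 1" 1 n] by simp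
    show "AE y in lborel. \<forall>e>0. \<exists>d>0. \<forall>x. \<bar>x - y\<bar> < d \<longrightarrow> G (x, y) < e"
      using AE_not_\<Omega>
    proof eventually_elim
      case (elim y)
      show ?case
      proof (intro allI impI)
        fix e :: real assume "0 < e"
        then obtain d where "d > 0" "\<And>x. \<bar>x - y\<bar> < d \<Longrightarrow> \<bar>K x y (U0 y) - U0 y\<bar> < e / 2"
          using K_tendsto[OF elim, of "e / 2"] by auto
        then show "\<exists>d>0. \<forall>x. \<bar>x - y\<bar> < d \<longrightarrow> G (x, y) < e"
          by (intro exI[of _ d]) (force simp: G_def Kq_def)
      qed
    qed
    show "emeasure lborel J < \<infinity>" unfolding J_def by (intro emeasure_bounded_finite) auto
  qed (use bG \<kappa>nn in auto)
  have "(\<integral>x. D x \<partial>lborel) \<le> 0"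
  proof (rule field_le_epsilon)
    fix e :: real assume "0 < e"
    then have e: "0 < e / 4" by simp
    obtain d where d: "d > 0" "\<And>h. norm h < d \<Longrightarrow> (\<integral>x. \<bar>f (x + h) - f x\<bar> \<partial>lborel) < e / 4"
      using integrable_imp_L1_shift_continuous[OF if0] e unfolding L1_shift_continuous_def by meson
    obtain n where n: "(\<integral>q. G q * \<kappa> n q \<partial>lborel) < e / 4" "1 / real (Suc n) < d"
      by (rule ex_small_index[OF E e d(1)])
    have bV: "(\<integral>z. \<bar>f (z - h) - f z\<bar> \<partial>lborel) \<le> e / 4" if "k n h \<noteq> 0" for h
      using d(2)[of "- h"] ksupp[OF that] n(2) by simp
    note mf = mollifier_L1_bound[OF if0 k(2)[of n] k(1)[of n] bV less_imp_le[OF e], unfolded k(3) mult_1_right]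
    note iDk = integral_times_shift_kernel(1)[OF iD k(1)[of n] k(2)[of n] k(3)[of n]]
      and Dk = integral_times_shift_kernel(2)[OF iD k(1)[of n] k(2)[of n] k(3)[of n]]
    have le: "D (fst q) * k n (fst q - snd q) \<le> H q * \<kappa> n q + 2 * (\<bar>f (snd q) - f (fst q)\<bar> * k n (fst q - snd q)) + G q * \<kappa> n q" for q
    proof (cases "\<kappa> n q = 0")
      case True
      then have "D (fst q) * k n (fst q - snd q) = 0" by (auto simp: D_def \<kappa>_def)
      moreover have "H q * \<kappa> n q = 0" "G q * \<kappa> n q = 0" using True by simp_all
      moreover have "0 \<le> \<bar>f (snd q) - f (fst q)\<bar> * k n (fst q - snd q)" using k(1) by simp
      ultimately show ?thesis by linarith
    next
      case False
      have J: "fst q \<in> J" "snd q \<in> J" using \<kappa>supp[OF False] by (auto simp: mem_Times_iff)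
      let ?a = "\<bar>U0 (snd q) - U0 (fst q)\<bar>"
      \<comment> \<open>With x = \<open>fst q\<close> and y = \<open>snd q\<close>, the triangle
        inequality bounds the left side by 2 |Kq - U0 x|, and a detour through U0 y separates the
        shift of \<open>U0\<close> from the error of \<open>Kq\<close>. The uniform bound 2 (C + C0)
        that follows justifies the truncation in \<open>G\<close>.\<close>
      have 1: "\<bar>W (fst q) - U0 (fst q)\<bar> - H q \<le> 2 * ?a + 2 * \<bar>Kq q - U0 (snd q)\<bar>"
        using abs_triangle_ineq[of "W (fst q) - Kq q" "Kq q - U0 (fst q)"]
          abs_triangle_ineq[of "Kq q - U0 (snd q)" "U0 (snd q) - U0 (fst q)"]
          abs_minus_commute[of "Kq q" "U0 (fst q)"]
        unfolding H_def by simp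
      have "\<bar>W (fst q) - U0 (fst q)\<bar> - H q \<le> 2 * (C + C0)"
        using order_trans[OF abs_ge_minus_self bH[of q]] bWU[of "fst q"] by (smt (verit))
      then have "\<bar>W (fst q) - U0 (fst q)\<bar> - H q \<le> 2 * ?a + G q"
        using 1 unfolding G_def by (smt (verit))
      then have "\<bar>W (fst q) - U0 (fst q)\<bar> \<le> H q + 2 * ?a + G q" by linarith
      from mult_right_mono[OF this \<kappa>nn[of n q]]
      have "D (fst q) * k n (fst q - snd q) \<le> H q * \<kappa> n q + 2 * (?a * \<kappa> n q) + G q * \<kappa> n q"
        by (simp add: D_def \<kappa>_def algebra_simps)
      moreover have "?a * \<kappa> n q \<le> ?a * k n (fst q - snd q)"
        unfolding \<kappa>_def using g(2,3)[of "fst q"] k(1)[of n "fst q - snd q"]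
        by (intro mult_left_mono mult_left_le_one_le) auto
      moreover have "?a = \<bar>f (snd q) - f (fst q)\<bar>" using J by (simp add: f_def)
      ultimately show ?thesis by (smt (verit))
    qed
    have "(\<integral>x. D x \<partial>lborel) \<le> (\<integral>q. H q * \<kappa> n q + 2 * (\<bar>f (snd q) - f (fst q)\<bar> * k n (fst q - snd q)) + G q * \<kappa> n q \<partial>lborel)"
      unfolding Dk[symmetric]
      by (intro integral_mono iDk Bochner_Integration.integrable_add integrable_mult_right iH iG mf(1) le)
    also have "\<dots> = (\<integral>q. H q * \<kappa> n q \<partial>lborel) + 2 * (\<integral>q. \<bar>f (snd q) - f (fst q)\<bar> * k n (fst q - snd q) \<partial>lborel)
        + (\<integral>q. G q * \<kappa> n q \<partial>lborel)"
      using iH[of n] iG[of n] mf(1) by simp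
    also have "\<dots> \<le> e" 
      using H0[of n] mf(2)[OF asm_rl] n(1) e by linarith
    finally show "(\<integral>x. D x \<partial>lborel) \<le> 0 + e" by simp
  qed
  then have "(\<integral>x. D x \<partial>lborel) = 0"
    using g(2) by (intro antisym Bochner_Integration.integral_nonneg) (auto simp: D_def)
  then have "AE x in lborel. D x = 0"
    by (subst (asm) integral_nonneg_eq_0_iff_AE[OF iD]) (use g(2) in \<open>auto simp: D_def\<close>)
  then show ?thesis
    by eventually_elim (use g(4) in \<open>force simp: D_def\<close>)
qed

end

section \<open>Finite speed of propagation\<close>

lemma abs_derivative_le_lipschitz:
  fixes f :: "real \<Rightarrow> real"
  assumes d: "(f has_real_derivative d) (at w)"
    and L: "\<And>z. \<bar>z - w\<bar> < 1 \<Longrightarrow> \<bar>f z - f w\<bar> \<le> L * \<bar>z - w\<bar>"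
  shows "\<bar>d\<bar> \<le> L"
proof (rule tendsto_upperbound)
  show "((\<lambda>h. \<bar>(f (w + h) - f w) / h\<bar>) \<longlongrightarrow> \<bar>d\<bar>) (at 0)"
    using d unfolding DERIV_def by (rule tendsto_rabs)
  have "\<forall>\<^sub>F h in at 0. h \<noteq> 0 \<and> \<bar>h\<bar> < (1::real)"
    by (auto simp: eventually_at intro!: exI[of _ 1])
  then show "\<forall>\<^sub>F h in at 0. \<bar>(f (w + h) - f w) / h\<bar> \<le> L"
  proof eventually_elim
    case (elim h)
    then show ?case using L[of "w + h"] by (simp add: abs_divide field_simps)
  qed
qed simp

section \<open>The maximal speed and the trapezoid\<close>

context adapted_pair
begin

abbreviation "M \<equiv> max_speed A T u v"

text \<open>The radius C + 1 leaves a margin 1 around every state of modulus at most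
  \<open>C\<close>, so that difference quotients at such a state stay in range.\<close>

lemma AE_lipschitz: "AE z in lborel. \<forall>w\<in>{-(C + 1)..C + 1}. \<forall>w'\<in>{-(C + 1)..C + 1}.
    \<bar>A (snd (z :: real \<times> real)) w - A (snd z) w'\<bar> \<le> lip (C + 1) * \<bar>w - w'\<bar>"
proof (rule AE_lborel_snd)
  have "AE x in lborel. \<forall>R>0. \<forall>w\<in>{-R..R}. \<forall>z\<in>{-R..R}. \<bar>A x w - A x z\<bar> \<le> lip R * \<bar>w - z\<bar>"
    using S.A2 by (simp add: flux_A2_def AE_completion_iff)
  moreover have "0 < C + 1" using S.C_nonneg by simp
  ultimately show "AE x in lborel. \<forall>w\<in>{-(C + 1)..C + 1}. \<forall>w'\<in>{-(C + 1)..C + 1}.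
    \<bar>A x w - A x w'\<bar> \<le> lip (C + 1) * \<bar>w - w'\<bar>"
    by (auto elim!: eventually_mono)
qed

lemma segment_bound:
  assumes "w \<in> closed_segment (U z) (V z)" shows "\<bar>w\<bar> \<le> C"
  using assms S.U_bound[of z] R.U_bound[of z] by (auto simp: closed_segment_eq_real_ivl abs_le_iff split: if_splits)

text \<open>The set under \<open>Inf\<close> contains |lip (C + 1)| and is bounded below by 0, so
  its infimum is meaningful. It satisfies the almost everywhere bound itself, as the limit of
  countably many members whose exceptional null sets have a null union.\<close>

lemma max_speed_attained:
  shows "0 \<le> M" and "AE z in lborel. z \<in> Q_dom T \<longrightarrow> (\<forall>w\<in>closed_segment (U z) (V z).
      \<forall>d. (A (snd z) has_real_derivative d) (at w) \<longrightarrow> \<bar>d\<bar> \<le> M)"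
proof -
  define bnd where "bnd m z \<longleftrightarrow> (\<forall>w\<in>closed_segment (U z) (V z).
      \<forall>d. (A (snd z) has_real_derivative d) (at w) \<longrightarrow> \<bar>d\<bar> \<le> m)" for m :: real and z
  have Q: "Q_dom T \<inter> space lebesgue \<in> sets lebesgue"
    using Q_dom_sets by (auto intro: sets_completionI_sets)
  have iff: "(AE (t, x) in lebesgue_on (Q_dom T). \<forall>w\<in>closed_segment (u t x) (v t x).
        \<forall>d. (A x has_real_derivative d) (at w) \<longrightarrow> \<bar>d\<bar> \<le> m) \<longleftrightarrow> (AE z in lborel. z \<in> Q_dom T \<longrightarrow> bnd m z)" for m
  proof -
    have "(AE (t, x) in lebesgue_on (Q_dom T). \<forall>w\<in>closed_segment (u t x) (v t x).
        \<forall>d. (A x has_real_derivative d) (at w) \<longrightarrow> \<bar>d\<bar> \<le> m) \<longleftrightarrow>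
      (AE z in lborel. z \<in> Q_dom T \<longrightarrow> (\<forall>w\<in>closed_segment (u (fst z) (snd z)) (v (fst z) (snd z)).
        \<forall>d. (A (snd z) has_real_derivative d) (at w) \<longrightarrow> \<bar>d\<bar> \<le> m))"
      by (subst AE_restrict_space_iff[OF Q]) (simp add: AE_completion_iff case_prod_unfold)
    also have "\<dots> \<longleftrightarrow> (AE z in lborel. z \<in> Q_dom T \<longrightarrow> bnd m z)"
      using S.U_AE R.U_AE
    proof (intro iffI, goal_cases)
      case 1
      from 1(3,1,2) show ?case by eventually_elim (simp add: bnd_def)
    next
      case 2
      from 2(3,1,2) show ?case by eventually_elim (simp add: bnd_def)
    qed
    finally show ?thesis .
  qed
  define X where "X = {m. 0 \<le> m \<and> (AE z in lborel. z \<in> Q_dom T \<longrightarrow> bnd m z)}"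
  have M: "M = Inf X" unfolding max_speed_def X_def iff ..
  have "\<bar>lip (C + 1)\<bar> \<in> X"
  proof -
    have "AE z in lborel. z \<in> Q_dom T \<longrightarrow> bnd \<bar>lip (C + 1)\<bar> z"
      using AE_lipschitz
    proof eventually_elim
      case (elim z)
      show ?case
        unfolding bnd_def
      proof (intro impI ballI allI)
        fix w d assume w: "w \<in> closed_segment (U z) (V z)" and d: "(A (snd z) has_real_derivative d) (at w)"
        have wC: "\<bar>w\<bar> \<le> C" by (rule segment_bound[OF w])
        have "\<bar>d\<bar> \<le> lip (C + 1)"
        proof (rule abs_derivative_le_lipschitz[OF d])
          fix w' assume "\<bar>w' - w\<bar> < 1"
          then have "w' \<in> {-(C + 1)..C + 1}" "w \<in> {-(C + 1)..C + 1}"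
            using wC by (auto simp: abs_le_iff abs_less_iff)
          then show "\<bar>A (snd z) w' - A (snd z) w\<bar> \<le> lip (C + 1) * \<bar>w' - w\<bar>" using elim by blast
        qed
        then show "\<bar>d\<bar> \<le> \<bar>lip (C + 1)\<bar>" by simp
      qed
    qed
    then show ?thesis by (simp add: X_def)
  qed
  then have ne: "X \<noteq> {}" by auto
  show "0 \<le> M" unfolding M by (rule cInf_greatest[OF ne]) (simp add: X_def)
  have "\<exists>m\<in>X. m < M + 1 / real (Suc n)" for n
    unfolding M using cInf_lessD[OF ne, of "Inf X + 1 / real (Suc n)"] by auto
  then obtain m where m: "\<And>n. m n \<in> X" "\<And>n. m n < M + 1 / real (Suc n)" by metis
  have "AE z in lborel. \<forall>n. z \<in> Q_dom T \<longrightarrow> bnd (m n) z"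
    unfolding AE_all_countable using m(1) by (simp add: X_def)
  then have "AE z in lborel. z \<in> Q_dom T \<longrightarrow> bnd M z"
  proof eventually_elim
    case (elim z)
    show ?case
      unfolding bnd_def
    proof (intro impI ballI allI)
      fix w d assume z: "z \<in> Q_dom T" and w: "w \<in> closed_segment (U z) (V z)"
        and d: "(A (snd z) has_real_derivative d) (at w)"
      show "\<bar>d\<bar> \<le> M"
      proof (rule field_le_epsilon)
        fix e :: real assume "0 < e"
        then obtain n where "1 / real (Suc n) < e" using nat_approx_posE by blast
        moreover have "\<bar>d\<bar> \<le> m n" using elim z w d unfolding bnd_def by blast
        ultimately show "\<bar>d\<bar> \<le> M + e" using m(2)[of n] by linarith
      qed
    qed
  qed
  then show "AE z in lborel. z \<in> Q_dom T \<longrightarrow> (\<forall>w\<in>closed_segment (U z) (V z).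
      \<forall>d. (A (snd z) has_real_derivative d) (at w) \<longrightarrow> \<bar>d\<bar> \<le> M)" by (simp add: bnd_def)
qed

lemma flux_le_speed:
  "AE z in lborel. z \<in> Q_dom T \<longrightarrow> \<bar>kruzkov_flux (p z) (p' z)\<bar> \<le> M * \<bar>U z - V z\<bar>"
proof -
  have "AE z in lborel. snd (z :: real \<times> real) \<notin> \<Omega>" by (rule AE_lborel_snd[OF S.AE_not_\<Omega>])
  with max_speed_attained(2) AE_lipschitz show ?thesis
  proof eventually_elim
    case (elim z)
    show ?case
    proof
      assume z: "z \<in> Q_dom T"
      have seg: "w \<in> {-(C + 1)..C + 1}" if "w \<in> closed_segment (U z) (V z)" for w
        using segment_bound[OF that] by (auto simp: abs_le_iff)
      show "\<bar>kruzkov_flux (p z) (p' z)\<bar> \<le> M * \<bar>U z - V z\<bar>"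
      proof (rule S.kruzkov_flux_speed[OF elim(3) max_speed_attained(1)])
        show "\<bar>d\<bar> \<le> M" if "w \<in> closed_segment (U z) (V z)" "(A (snd z) has_real_derivative d) (at w)" for w d
          using elim(1) z that by blast
        show "\<bar>A (snd z) w - A (snd z) w'\<bar> \<le> lip (C + 1) * \<bar>w - w'\<bar>"
          if "w \<in> closed_segment (U z) (V z)" "w' \<in> closed_segment (U z) (V z)" for w w'
          using elim(2) seg[OF that(1)] seg[OF that(2)] by blast
      qed
    qed
  qed
qed

text \<open>Used at time 0 and at time t with kernels that approach these times from inside (0,T).
  The error against the slice is at most |U - Wu| + |V - Wv| plus a term from the variation of
  \<open>\<Theta>\<close> in time, which its Lipschitz constant controls.\<close>

lemma weighted_slice_limit:
  assumes s: "s \<in> {0..T}" and R: "0 \<le> R"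
    and Wu: "Wu \<in> borel_measurable borel" "\<And>x. \<bar>Wu x\<bar> \<le> C"
      "\<And>e. 0 < e \<Longrightarrow> \<exists>d>0. AE t in lborel. t \<in> {0..T} \<and> \<bar>t - s\<bar> < d \<longrightarrow>
        (\<integral>x. indicator {-R..R} x * \<bar>U (t, x) - Wu x\<bar> \<partial>lborel) \<le> e"
    and Wv: "Wv \<in> borel_measurable borel" "\<And>x. \<bar>Wv x\<bar> \<le> C"
      "\<And>e. 0 < e \<Longrightarrow> \<exists>d>0. AE t in lborel. t \<in> {0..T} \<and> \<bar>t - s\<bar> < d \<longrightarrow>
        (\<integral>x. indicator {-R..R} x * \<bar>V (t, x) - Wv x\<bar> \<partial>lborel) \<le> e"
    and \<Theta>: "smoothC \<Theta>" "\<And>t x. 0 \<le> \<Theta> t x" "\<And>t x. \<Theta> t x \<le> 1"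
      "\<And>t x. t \<in> {0..T} \<Longrightarrow> x \<notin> {-R..R} \<Longrightarrow> \<Theta> t x = 0"
    and L: "0 \<le> L" "\<And>t x. \<bar>\<Theta> t x - \<Theta> s x\<bar> \<le> L * \<bar>t - s\<bar>"
    and om: "\<And>n t. 0 \<le> om n t" "\<And>n. integrable lborel (om n)" "\<And>n. (\<integral>t. om n t \<partial>lborel) = 1"
    and supp: "\<And>n t. n0 \<le> n \<Longrightarrow> om n t \<noteq> 0 \<Longrightarrow> t \<in> {0..T} \<and> \<bar>t - s\<bar> < 2 / real (Suc n)"
  shows "n0 \<le> n \<Longrightarrow> integrable lborel (\<lambda>z. om n (fst z) * (\<bar>U z - V z\<bar> * \<Theta> (fst z) (snd z)))"
    and "(\<lambda>n. \<integral>z. om n (fst z) * (\<bar>U z - V z\<bar> * \<Theta> (fst z) (snd z)) \<partial>lborel)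
      \<longlonglongrightarrow> (\<integral>x. \<bar>Wu x - Wv x\<bar> * \<Theta> s x \<partial>lborel)"
proof -
  note [measurable] = Wu(1) Wv(1) S.U_section_borel R.U_section_borel
  let ?ind = "indicat_real {-R..R}"
  have [measurable]: "(\<lambda>z. \<Theta> (fst z) (snd z)) \<in> borel_measurable borel" by (rule borel_measurable_smoothC[OF \<Theta>(1)])
  have \<Theta>m[measurable]: "\<Theta> t \<in> borel_measurable borel" for t
  proof -
    have "(\<lambda>x. (t, x)) \<in> borel_measurable (borel :: real measure)"
      by (intro borel_measurable_continuous_onI continuous_intros)
    from measurable_compose[OF this borel_measurable_smoothC[OF \<Theta>(1)]] show ?thesis by simp
  qed
  have [measurable]: "om n \<in> borel_measurable borel" for n using om(2)[of n] by simp
  have iind: "integrable lborel ?ind" by (intro integrable_real_indicator emeasure_bounded_finite) auto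
  have UV: "\<bar>U z - V z\<bar> \<le> 2 * C" for z
    using S.U_bound[of z] R.U_bound[of z] abs_triangle_ineq4[of "U z" "V z"] by linarith
  have C0: "0 \<le> C" by (rule S.C_nonneg)
  have inti: "integrable lborel (\<lambda>z. om n (fst z) * (\<bar>U z - V z\<bar> * \<Theta> (fst z) (snd z)))" if n: "n0 \<le> n" for n
  proof (rule integrable_dominated)
    show "integrable lborel (\<lambda>z. 2 * C * (om n (fst z) * ?ind (snd z)))"
      by (intro integrable_mult_right integral_lborel_times(1) om iind)
    show "\<bar>om n (fst z) * (\<bar>U z - V z\<bar> * \<Theta> (fst z) (snd z))\<bar> \<le> 2 * C * (om n (fst z) * ?ind (snd z))" for z
    proof (cases "om n (fst z) = 0 \<or> snd z \<notin> {-R..R}")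
      case True
      then have 0: "om n (fst z) * (\<bar>U z - V z\<bar> * \<Theta> (fst z) (snd z)) = 0"
        using supp[OF n, of "fst z"] \<Theta>(4)[of "fst z" "snd z"] by (cases "om n (fst z) = 0") auto
      have "0 \<le> 2 * C * (om n (fst z) * ?ind (snd z))" using om(1)[of n "fst z"] C0 by simp
      then show ?thesis by (simp only: 0 abs_zero)
    next
      case False
      have "\<bar>om n (fst z) * (\<bar>U z - V z\<bar> * \<Theta> (fst z) (snd z))\<bar> \<le> om n (fst z) * (2 * C * 1)"
        unfolding abs_mult using om(1)[of n "fst z"] UV[of z] \<Theta>(2,3)[of "fst z" "snd z"] C0
        by (intro mult_mono) auto
      then show ?thesis using False by (simp add: mult.commute mult.left_commute)
    qed
  qed measurable
  then show "n0 \<le> n \<Longrightarrow> integrable lborel (\<lambda>z. om n (fst z) * (\<bar>U z - V z\<bar> * \<Theta> (fst z) (snd z)))" .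
  define F where "F = (\<integral>x. \<bar>Wu x - Wv x\<bar> * \<Theta> s x \<partial>lborel)"
  have sl: "integrable lborel (\<lambda>x. \<bar>f x - g x\<bar> * \<Theta> t x)"
    if [measurable]: "f \<in> borel_measurable borel" "g \<in> borel_measurable borel"
      and b: "\<And>x. \<bar>f x\<bar> \<le> C" "\<And>x. \<bar>g x\<bar> \<le> C" and t: "t \<in> {0..T}" for f g t
  proof (rule integrable_lborel_bounded_support[of _ "2 * C * 1" "{-R..R}"])
    have "\<bar>f x - g x\<bar> \<le> 2 * C" for x using b[of x] abs_triangle_ineq4[of "f x" "g x"] by linarith
    then show "\<bar>\<bar>f x - g x\<bar> * \<Theta> t x\<bar> \<le> 2 * C * 1" for x
      unfolding abs_mult using \<Theta>(2,3)[of t x] C0 by (intro mult_mono) auto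
  qed (use \<Theta>(4)[OF t] in auto)
  have iW: "integrable lborel (\<lambda>x. ?ind x * \<bar>f x - g x\<bar>)"
    if [measurable]: "f \<in> borel_measurable borel" "g \<in> borel_measurable borel"
      and b: "\<And>x. \<bar>f x\<bar> \<le> C" "\<And>x. \<bar>g x\<bar> \<le> C" for f g
  proof (rule integrable_lborel_bounded_support[of _ "2 * C" "{-R..R}"])
    show "\<bar>?ind x * \<bar>f x - g x\<bar>\<bar> \<le> 2 * C" for x
      using b[of x] abs_triangle_ineq4[of "f x" "g x"] C0 by (simp add: indicator_def)
  qed auto
  show "(\<lambda>n. \<integral>z. om n (fst z) * (\<bar>U z - V z\<bar> * \<Theta> (fst z) (snd z)) \<partial>lborel)
      \<longlonglongrightarrow> (\<integral>x. \<bar>Wu x - Wv x\<bar> * \<Theta> s x \<partial>lborel)"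
    unfolding F_def[symmetric]
  proof (rule LIMSEQ_I)
    fix r :: real assume r: "0 < r"
    have r4: "0 < r / 4" using r by simp
    obtain d1 where d1: "d1 > 0" "AE t in lborel. t \<in> {0..T} \<and> \<bar>t - s\<bar> < d1 \<longrightarrow>
        (\<integral>x. ?ind x * \<bar>U (t, x) - Wu x\<bar> \<partial>lborel) \<le> r / 4" using Wu(3)[OF r4] by blast
    obtain d2 where d2: "d2 > 0" "AE t in lborel. t \<in> {0..T} \<and> \<bar>t - s\<bar> < d2 \<longrightarrow>
        (\<integral>x. ?ind x * \<bar>V (t, x) - Wv x\<bar> \<partial>lborel) \<le> r / 4" using Wv(3)[OF r4] by blast
    \<comment> \<open>On [-R,R], of length 2 R, the variation of \<open>\<Theta>\<close> costs at
      most 2 C L d3; the three errors are given r/4 each.\<close>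
    obtain d3 where d3: "d3 > 0" "(2 * C * L * (2 * R)) * d3 \<le> r / 4"
      using small_multiple[of "2 * C * L * (2 * R)" "r / 4"] r4 C0 L(1) R by auto
    define d where "d = min d1 (min d2 d3)"
    have d: "0 < d / 2" "d \<le> d1" "d \<le> d2" "d \<le> d3" using d1 d2 d3 by (auto simp: d_def)
    obtain N where N: "1 / real (Suc N) < d / 2" using nat_approx_posE[OF d(1)] by blast
    show "\<exists>no. \<forall>n\<ge>no. norm ((\<integral>z. om n (fst z) * (\<bar>U z - V z\<bar> * \<Theta> (fst z) (snd z)) \<partial>lborel) - F) < r"
    proof (intro exI allI impI)
      fix n assume n: "max n0 N \<le> n"
      have nd: "2 / real (Suc n) < d"
        using frac_le[of 1 1 "real (Suc N)" "real (Suc n)"] n N by simp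
      have nn0: "n0 \<le> n" using n by simp
      let ?I = "\<lambda>t. \<integral>x. \<bar>U (t, x) - V (t, x)\<bar> * \<Theta> t x \<partial>lborel"
      have "\<bar>(\<integral>t. om n t * ?I t \<partial>lborel) - F\<bar> \<le> 3 * (r / 4)"
      proof (rule integral_kernel_close[OF om])
        show "integrable lborel (\<lambda>t. om n t * ?I t)" using lborel_Fubini(3)[OF inti[OF nn0]] by simp
        show "AE t in lborel. om n t \<noteq> 0 \<longrightarrow> \<bar>?I t - F\<bar> \<le> 3 * (r / 4)"
          using d1(2) d2(2)
        proof eventually_elim
          case (elim t)
          show ?case
          proof
            assume "om n t \<noteq> 0"
            then have t: "t \<in> {0..T}" "\<bar>t - s\<bar> < d" using supp[OF nn0, of t] nd by auto
            then have sm: "(\<integral>x. ?ind x * \<bar>U (t, x) - Wu x\<bar> \<partial>lborel) \<le> r / 4" "(\<integral>x. ?ind x * \<bar>V (t, x) - Wv x\<bar> \<partial>lborel) \<le> r / 4"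
              using elim d by auto
            have i1: "integrable lborel (\<lambda>x. \<bar>U (t, x) - V (t, x)\<bar> * \<Theta> t x)"
              by (rule sl[OF _ _ _ _ t(1)]) (use S.U_bound R.U_bound in auto)
            have i2: "integrable lborel (\<lambda>x. \<bar>Wu x - Wv x\<bar> * \<Theta> s x)"
              by (rule sl[OF _ _ _ _ s]) (use Wu Wv in auto)
            have i3: "integrable lborel (\<lambda>x. ?ind x * \<bar>U (t, x) - Wu x\<bar>)" "integrable lborel (\<lambda>x. ?ind x * \<bar>V (t, x) - Wv x\<bar>)"
              by (rule iW; use S.U_bound R.U_bound Wu Wv in simp)+
            have "\<bar>?I t - F\<bar> = \<bar>\<integral>x. \<bar>U (t, x) - V (t, x)\<bar> * \<Theta> t x - \<bar>Wu x - Wv x\<bar> * \<Theta> s x \<partial>lborel\<bar>"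
              using i1 i2 by (simp add: F_def)
            also have "\<dots> \<le> (\<integral>x. \<bar>\<bar>U (t, x) - V (t, x)\<bar> * \<Theta> t x - \<bar>Wu x - Wv x\<bar> * \<Theta> s x\<bar> \<partial>lborel)"
              by (rule integral_abs_bound)
            also have "\<dots> \<le> (\<integral>x. ?ind x * \<bar>U (t, x) - Wu x\<bar> + ?ind x * \<bar>V (t, x) - Wv x\<bar> + 2 * C * (L * d3) * ?ind x \<partial>lborel)"
            proof (rule integral_mono)
              show "integrable lborel (\<lambda>x. \<bar>\<bar>U (t, x) - V (t, x)\<bar> * \<Theta> t x - \<bar>Wu x - Wv x\<bar> * \<Theta> s x\<bar>)" using i1 i2 by simp
              show "integrable lborel (\<lambda>x. ?ind x * \<bar>U (t, x) - Wu x\<bar> + ?ind x * \<bar>V (t, x) - Wv x\<bar> + 2 * C * (L * d3) * ?ind x)"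
                using i3 iind by simp
              fix x
              show "\<bar>\<bar>U (t, x) - V (t, x)\<bar> * \<Theta> t x - \<bar>Wu x - Wv x\<bar> * \<Theta> s x\<bar>
                 \<le> ?ind x * \<bar>U (t, x) - Wu x\<bar> + ?ind x * \<bar>V (t, x) - Wv x\<bar> + 2 * C * (L * d3) * ?ind x"
              proof (cases "x \<in> {-R..R}")
                case False
                then show ?thesis using \<Theta>(4)[OF t(1) False] \<Theta>(4)[OF s False] by simp
              next
                case True
                let ?D = "\<bar>U (t, x) - V (t, x)\<bar>" and ?E = "\<bar>Wu x - Wv x\<bar>"
                have 1: "\<bar>(?D - ?E) * \<Theta> t x\<bar> \<le> (\<bar>U (t, x) - Wu x\<bar> + \<bar>V (t, x) - Wv x\<bar>) * 1"
                proof -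
                  have "\<bar>?D - ?E\<bar> \<le> \<bar>(U (t, x) - V (t, x)) - (Wu x - Wv x)\<bar>" by (rule abs_triangle_ineq3)
                  also have "\<dots> = \<bar>(U (t, x) - Wu x) - (V (t, x) - Wv x)\<bar>" by (simp add: algebra_simps)
                  also have "\<dots> \<le> \<bar>U (t, x) - Wu x\<bar> + \<bar>V (t, x) - Wv x\<bar>" by (rule abs_triangle_ineq4)
                  finally show ?thesis unfolding abs_mult using \<Theta>(2,3)[of t x] by (intro mult_mono) auto
                qed
                have 2: "\<bar>?E * (\<Theta> t x - \<Theta> s x)\<bar> \<le> 2 * C * (L * d3)"
                proof -
                  have "\<bar>\<Theta> t x - \<Theta> s x\<bar> \<le> L * d3"
                    using L(2)[of t x] mult_left_mono[of "\<bar>t - s\<bar>" d3 L] t(2) d(4) L(1) by linarith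
                  moreover have "?E \<le> 2 * C" using Wu(2)[of x] Wv(2)[of x] abs_triangle_ineq4[of "Wu x" "Wv x"] by linarith
                  ultimately show ?thesis unfolding abs_mult using C0 by (intro mult_mono) auto
                qed
                have "?D * \<Theta> t x - ?E * \<Theta> s x = (?D - ?E) * \<Theta> t x + ?E * (\<Theta> t x - \<Theta> s x)" by (simp add: algebra_simps)
                then have "\<bar>?D * \<Theta> t x - ?E * \<Theta> s x\<bar> \<le> \<bar>(?D - ?E) * \<Theta> t x\<bar> + \<bar>?E * (\<Theta> t x - \<Theta> s x)\<bar>"
                  by (simp only: abs_triangle_ineq)
                then show ?thesis using 1 2 True by simp
              qed
            qed
            also have "\<dots> = (\<integral>x. ?ind x * \<bar>U (t, x) - Wu x\<bar> \<partial>lborel) + (\<integral>x. ?ind x * \<bar>V (t, x) - Wv x\<bar> \<partial>lborel) + 2 * C * (L * d3) * (2 * R)"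
              using i3 iind R by simp
            also have "\<dots> \<le> 3 * (r / 4)"
              using sm d3(2) by (simp add: mult.assoc mult.commute mult.left_commute)
            finally show "\<bar>?I t - F\<bar> \<le> 3 * (r / 4)" .
          qed
        qed
      qed
      moreover have "(\<integral>t. om n t * ?I t \<partial>lborel) = (\<integral>z. om n (fst z) * (\<bar>U z - V z\<bar> * \<Theta> (fst z) (snd z)) \<partial>lborel)"
        using lborel_Fubini(5)[OF inti[OF nn0]] by simp
      ultimately show "norm ((\<integral>z. om n (fst z) * (\<bar>U z - V z\<bar> * \<Theta> (fst z) (snd z)) \<partial>lborel) - F) < r" using r by simp
    qed
  qed
qed

text \<open>\<open>\<Theta>\<close> is a smoothed indicator of the trapezoid whose sides move
  inwards with speed \<open>M\<close> as time increases, so that its time derivative dominates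
  \<open>M\<close> times the modulus of its space derivative with the favourable sign. It equals 1
  on [c,d] at time t. The gaps between c' and c and between d and d' leave room for the smooth
  transition.\<close>

lemma trapezoid_comparison:
  assumes u0: "Linf u0" and v0: "Linf v0" and t: "t \<in> {0..T}" and c: "c' < c" "c \<le> d" "d < d'"
  shows "(\<integral>\<^sup>+x\<in>{c..d}. ennreal \<bar>u t x - v t x\<bar> \<partial>lebesgue)
    \<le> (\<integral>\<^sup>+x\<in>{c' - M * t<..<d' + M * t}. ennreal \<bar>u0 x - v0 x\<bar> \<partial>lebesgue)"
proof -
  have M0: "0 \<le> M" by (rule max_speed_attained)
  have Mt: "0 \<le> M * t" using M0 t by simp
  define l where "l = c' - M * t"
  define r where "r = d' + M * t"
  \<comment> \<open>The final 1 covers the enlarged interval [l - 1, r + 1] that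
    \<open>initial_trace\<close> requires.\<close>
  define R where "R = \<bar>c'\<bar> + \<bar>d'\<bar> + M * t + 1"
  have R0: "0 \<le> R" using Mt by (simp add: R_def)
  have lr: "{l - 1..r + 1} \<subseteq> {-R..R}" using Mt unfolding l_def r_def R_def by auto
  define a1 where "a1 = 1 / (c - c')"
  define a2 where "a2 = 1 / (d' - d)"
  have a: "0 < a1" "0 < a2" using c by (auto simp: a1_def a2_def)
  \<comment> \<open>The arguments are (x - c' + M (t - s)) / (c - c') here and (d' - x + M (t - s))
    / (d' - d) in \<open>\<theta>2\<close>, expanded into the linear form of
    \<open>smoothC_comp\<close>.\<close>
  define \<theta>1 where "\<theta>1 s x = smooth_step (- M * a1 * s + a1 * x + a1 * (M * t - c'))" for s x
  define \<theta>2 where "\<theta>2 s x = smooth_step (- M * a2 * s + - a2 * x + a2 * (M * t + d'))" for s x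
  define \<Theta> where "\<Theta> s x = \<theta>1 s x * \<theta>2 s x" for s x
  define \<beta>1 where "\<beta>1 s x = bump (- M * a1 * s + a1 * x + a1 * (M * t - c'))" for s x
  define \<beta>2 where "\<beta>2 s x = bump (- M * a2 * s + - a2 * x + a2 * (M * t + d'))" for s x
  have s\<theta>: "smoothC \<theta>1" "smoothC \<theta>2"
    unfolding \<theta>1_def[abs_def] \<theta>2_def[abs_def] by (intro smoothC_comp smooth1_step)+
  have s\<Theta>: "smoothC \<Theta>" unfolding \<Theta>_def[abs_def] by (intro smoothC_mult s\<theta>)
  have \<theta>b: "0 \<le> \<theta>1 s x" "\<theta>1 s x \<le> 1" "0 \<le> \<theta>2 s x" "\<theta>2 s x \<le> 1" "0 \<le> \<beta>1 s x" "0 \<le> \<beta>2 s x" for s x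
    by (simp_all add: \<theta>1_def \<theta>2_def \<beta>1_def \<beta>2_def smooth_step_bounds bump_nonneg)
  have \<Theta>b: "0 \<le> \<Theta> s x" "\<Theta> s x \<le> 1" for s x
    using \<theta>b[of s x] by (simp_all add: \<Theta>_def mult_le_one)
  have pd: "pd_t \<theta>1 s x = \<beta>1 s x * (- M * a1)" "pd_x \<theta>1 s x = \<beta>1 s x * a1"
    "pd_t \<theta>2 s x = \<beta>2 s x * (- M * a2)" "pd_x \<theta>2 s x = \<beta>2 s x * - a2" for s x
    unfolding pd_t_def pd_x_def \<theta>1_def[abs_def] \<theta>2_def[abs_def] \<beta>1_def \<beta>2_def
    by (intro DERIV_imp_deriv DERIV_chain2[OF DERIV_smooth_step]; auto intro!: derivative_eq_intros)+
  have pd\<Theta>: "pd_t \<Theta> s x = pd_t \<theta>1 s x * \<theta>2 s x + pd_t \<theta>2 s x * \<theta>1 s x"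
    "pd_x \<Theta> s x = pd_x \<theta>1 s x * \<theta>2 s x + pd_x \<theta>2 s x * \<theta>1 s x" for s x
    unfolding \<Theta>_def[abs_def] pd_mult[OF smoothC_D(1)[OF s\<theta>(1)] smoothC_D(1)[OF s\<theta>(2)]] by (rule refl)+
  have speed: "pd_t \<Theta> s x + M * \<bar>pd_x \<Theta> s x\<bar> \<le> 0" for s x
  proof -
    have "\<bar>pd_x \<Theta> s x\<bar> \<le> a1 * (\<beta>1 s x * \<theta>2 s x) + a2 * (\<beta>2 s x * \<theta>1 s x)"
    proof -
      have "0 \<le> a1 * (\<beta>1 s x * \<theta>2 s x)" "0 \<le> a2 * (\<beta>2 s x * \<theta>1 s x)" using a \<theta>b by auto
      moreover have "pd_x \<Theta> s x = a1 * (\<beta>1 s x * \<theta>2 s x) - a2 * (\<beta>2 s x * \<theta>1 s x)"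
        unfolding pd\<Theta> pd by (simp add: algebra_simps)
      ultimately show ?thesis by linarith
    qed
    from mult_left_mono[OF this M0] show ?thesis unfolding pd\<Theta>(1) pd by (simp add: algebra_simps)
  qed
  have out: "\<Theta> s x = 0" if s: "0 \<le> s" and x: "x \<notin> {l<..<r}" for s x
  proof -
    have Ms: "0 \<le> M * s" using M0 s by simp
    consider "x \<le> l" | "r \<le> x" using x by fastforce
    then show ?thesis
    proof cases
      case 1
      then have "a1 * (x + M * t - c' - M * s) \<le> 0"
        using Ms a by (intro mult_nonneg_nonpos) (auto simp: l_def)
      then have "- M * a1 * s + a1 * x + a1 * (M * t - c') \<le> 0" by (simp add: algebra_simps)
      then have "\<theta>1 s x = 0" unfolding \<theta>1_def by (rule smooth_step_0)
      then show ?thesis by (simp add: \<Theta>_def)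
    next
      case 2
      then have "a2 * (d' + M * t - x - M * s) \<le> 0"
        using Ms a by (intro mult_nonneg_nonpos) (auto simp: r_def)
      then have "- M * a2 * s + - a2 * x + a2 * (M * t + d') \<le> 0" by (simp add: algebra_simps)
      then have "\<theta>2 s x = 0" unfolding \<theta>2_def by (rule smooth_step_0)
      then show ?thesis by (simp add: \<Theta>_def)
    qed
  qed
  have one: "\<Theta> t x = 1" if x: "x \<in> {c..d}" for x
  proof -
    have "- M * a1 * t + a1 * x + a1 * (M * t - c') = a1 * (x - c')"
      "- M * a2 * t + - a2 * x + a2 * (M * t + d') = a2 * (d' - x)"
      by (simp_all add: algebra_simps)
    moreover have "a1 * (x - c') = (x - c') / (c - c')" "a2 * (d' - x) = (d' - x) / (d' - d)"
      by (simp_all add: a1_def a2_def)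
    moreover have "1 \<le> (x - c') / (c - c')" "1 \<le> (d' - x) / (d' - d)" using x c by (simp_all add: field_simps)
    ultimately show ?thesis by (simp add: \<Theta>_def \<theta>1_def \<theta>2_def smooth_step_1)
  qed
  obtain Mb where Mb: "0 \<le> Mb" "\<And>x. \<bar>bump x\<bar> \<le> Mb"
    using smooth1_bounded[OF smooth1_bump, of 0 1] bump_0 bump_1 by force
  define L where "L = Mb * (M * a1) * 1 + Mb * (M * a2) * 1"
  have L0: "0 \<le> L" unfolding L_def using Mb M0 a by simp
  have Lb: "\<bar>pd_t \<Theta> s x\<bar> \<le> L" for s x
  proof -
    have "\<bar>\<beta>1 s x * (- M * a1) * \<theta>2 s x\<bar> \<le> Mb * (M * a1) * 1" "\<bar>\<beta>2 s x * (- M * a2) * \<theta>1 s x\<bar> \<le> Mb * (M * a2) * 1"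
    proof -
      have b: "\<beta>1 s x \<le> Mb" "\<beta>2 s x \<le> Mb"
        using order_trans[OF abs_ge_self Mb(2)] by (simp_all add: \<beta>1_def \<beta>2_def)
      have "\<bar>\<beta>1 s x * (- M * a1) * \<theta>2 s x\<bar> = \<beta>1 s x * (M * a1) * \<theta>2 s x"
        "\<bar>\<beta>2 s x * (- M * a2) * \<theta>1 s x\<bar> = \<beta>2 s x * (M * a2) * \<theta>1 s x"
        using \<theta>b[of s x] M0 a by (simp_all add: abs_mult)
      moreover have "\<beta>1 s x * (M * a1) * \<theta>2 s x \<le> Mb * (M * a1) * 1"
        "\<beta>2 s x * (M * a2) * \<theta>1 s x \<le> Mb * (M * a2) * 1"
        by (intro mult_mono b \<theta>b mult_nonneg_nonneg order_refl Mb M0 less_imp_le[OF a(1)] less_imp_le[OF a(2)])+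
      ultimately show "\<bar>\<beta>1 s x * (- M * a1) * \<theta>2 s x\<bar> \<le> Mb * (M * a1) * 1"
        "\<bar>\<beta>2 s x * (- M * a2) * \<theta>1 s x\<bar> \<le> Mb * (M * a2) * 1" by simp_all
    qed
    then show ?thesis unfolding pd\<Theta> pd L_def by linarith
  qed
  have Lip: "\<bar>\<Theta> s' x - \<Theta> s x\<bar> \<le> L * \<bar>s' - s\<bar>" for s s' x
    using field_differentiable_bound[of UNIV "\<lambda>s. \<Theta> s x" "\<lambda>s. pd_t \<Theta> s x" L s' s] smoothC_pd(1)[OF s\<Theta>] Lb by simp
  obtain Wu0 where Wu0: "Wu0 \<in> borel_measurable borel" "\<And>x. \<bar>Wu0 x\<bar> \<le> C"
      "\<And>e. 0 < e \<Longrightarrow> \<exists>d>0. AE t in lborel. t \<in> {0..T} \<and> \<bar>t - 0\<bar> < d \<longrightarrow>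
        (\<integral>x. indicator {-R..R} x * \<bar>U (t, x) - Wu0 x\<bar> \<partial>lborel) \<le> e"
      "AE x in lborel. x \<in> {-R..R} \<longrightarrow> Wu0 x = u 0 x"
    using S.time_slice[of 0 R] S.T by auto
  obtain Wv0 where Wv0: "Wv0 \<in> borel_measurable borel" "\<And>x. \<bar>Wv0 x\<bar> \<le> C"
      "\<And>e. 0 < e \<Longrightarrow> \<exists>d>0. AE t in lborel. t \<in> {0..T} \<and> \<bar>t - 0\<bar> < d \<longrightarrow>
        (\<integral>x. indicator {-R..R} x * \<bar>V (t, x) - Wv0 x\<bar> \<partial>lborel) \<le> e"
      "AE x in lborel. x \<in> {-R..R} \<longrightarrow> Wv0 x = v 0 x"
    using R.time_slice[of 0 R] S.T by auto
  define F where "F Wu Wv s = (\<integral>x. \<bar>Wu x - Wv x\<bar> * \<Theta> s x \<partial>lborel)" for Wu Wv :: "real \<Rightarrow> real" and s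
  have "\<exists>Wu Wv. Wu \<in> borel_measurable borel \<and> Wv \<in> borel_measurable borel \<and> (\<forall>x. \<bar>Wu x\<bar> \<le> C) \<and> (\<forall>x. \<bar>Wv x\<bar> \<le> C) \<and>
     (AE x in lborel. x \<in> {-R..R} \<longrightarrow> Wu x = u t x) \<and> (AE x in lborel. x \<in> {-R..R} \<longrightarrow> Wv x = v t x) \<and>
     F Wu Wv t \<le> F Wu0 Wv0 0"
  \<comment> \<open>At t = 0 no time cutoff fits between the two times, but both sides are then the
    same functional of the same slices.\<close>
  proof (cases "t = 0")
    case True
    then show ?thesis using Wu0 Wv0 by (intro exI[of _ Wu0] exI[of _ Wv0]) auto
  next
    case False
    then have t0: "0 < t" "t \<le> T" using t by auto
    obtain Wu where Wu: "Wu \<in> borel_measurable borel" "\<And>x. \<bar>Wu x\<bar> \<le> C"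
      "\<And>e. 0 < e \<Longrightarrow> \<exists>d>0. AE s in lborel. s \<in> {0..T} \<and> \<bar>s - t\<bar> < d \<longrightarrow>
        (\<integral>x. indicator {-R..R} x * \<bar>U (s, x) - Wu x\<bar> \<partial>lborel) \<le> e"
      "AE x in lborel. x \<in> {-R..R} \<longrightarrow> Wu x = u t x"
      using S.time_slice[OF t, of R] by auto
    obtain Wv where Wv: "Wv \<in> borel_measurable borel" "\<And>x. \<bar>Wv x\<bar> \<le> C"
      "\<And>e. 0 < e \<Longrightarrow> \<exists>d>0. AE s in lborel. s \<in> {0..T} \<and> \<bar>s - t\<bar> < d \<longrightarrow>
        (\<integral>x. indicator {-R..R} x * \<bar>V (s, x) - Wv x\<bar> \<partial>lborel) \<le> e"
      "AE x in lborel. x \<in> {-R..R} \<longrightarrow> Wv x = v t x"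
      using R.time_slice[OF t, of R] by auto
    define om0 where "om0 n s = moll (real (Suc n)) (s - 1 / real (Suc n))" for n s
    define om1 where "om1 n s = moll (real (Suc n)) ((t - 1 / real (Suc n)) - s)" for n s
    have om: "0 \<le> om0 n s" "integrable lborel (om0 n)" "(\<integral>s. om0 n s \<partial>lborel) = 1"
       "0 \<le> om1 n s" "integrable lborel (om1 n)" "(\<integral>s. om1 n s \<partial>lborel) = 1" for n s
      using integral_moll_shift[of "real (Suc n)"] by (simp_all add: om0_def[abs_def] om1_def[abs_def] moll_nonneg)
    \<comment> \<open>With N = n + 1, the time cutoff below rises on [1/N, 2/N] and falls on
      [t - 2/N, t - 1/N]; the condition 4/N < t separates the two ramps.\<close>
    obtain n0 where "1 / real (Suc n0) < t / 4" using nat_approx_posE[of "t / 4"] t0 by auto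
    then have big: "4 / real (Suc n) < t" if "n0 \<le> n" for n
      using frac_le[of 1 1 "real (Suc n0)" "real (Suc n)"] that by simp
    have supp0: "1 / real (Suc n) < s \<and> s < 2 / real (Suc n)" if "om0 n s \<noteq> 0" for n s
    proof -
      have "2 / real (Suc n) = 1 / real (Suc n) + 1 / real (Suc n)" by (simp only: add_divide_distrib[symmetric] one_add_one)
      moreover have "0 < s - 1 / real (Suc n) \<and> s - 1 / real (Suc n) < 1 / real (Suc n)"
        using that unfolding om0_def by (intro moll_support) simp_all
      ultimately show ?thesis by linarith
    qed
    have supp1: "1 / real (Suc n) < t - s \<and> t - s < 2 / real (Suc n)" if "om1 n s \<noteq> 0" for n s
    proof -
      have "2 / real (Suc n) = 1 / real (Suc n) + 1 / real (Suc n)" by (simp only: add_divide_distrib[symmetric] one_add_one)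
      moreover have "0 < (t - 1 / real (Suc n)) - s \<and> (t - 1 / real (Suc n)) - s < 1 / real (Suc n)"
        using that unfolding om1_def by (intro moll_support) simp_all
      ultimately show ?thesis by linarith
    qed
    have in0: "s \<in> {0..T} \<and> \<bar>s - 0\<bar> < 2 / real (Suc n)" if "n0 \<le> n" "om0 n s \<noteq> 0" for n s
    proof -
      have "0 < 1 / real (Suc n)" "2 / real (Suc n) < 4 / real (Suc n)" by (simp_all add: divide_strict_right_mono del: of_nat_Suc)
      then show ?thesis using supp0[OF that(2)] big[OF that(1)] t0 by auto
    qed
    have in1: "s \<in> {0..T} \<and> \<bar>s - t\<bar> < 2 / real (Suc n)" if "n0 \<le> n" "om1 n s \<noteq> 0" for n s
    proof -
      have "0 < 1 / real (Suc n)" "2 / real (Suc n) < 4 / real (Suc n)" by (simp_all add: divide_strict_right_mono del: of_nat_Suc)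
      then show ?thesis using supp1[OF that(2)] big[OF that(1)] t0 by auto
    qed
    have \<Theta>R: "\<Theta> s x = 0" if "s \<in> {0..T}" "x \<notin> {-R..R}" for s x
    proof (rule out)
      show "x \<notin> {l<..<r}" using that(2) lr by auto
    qed (use that in auto)
    have z0: "(0::real) \<in> {0..T}" using S.T by simp
    have w0i: "integrable lborel (\<lambda>z. om0 n (fst z) * (\<bar>U z - V z\<bar> * \<Theta> (fst z) (snd z)))" if "n0 \<le> n" for n
      by (rule weighted_slice_limit(1)[OF z0 R0 Wu0(1,2,3) Wv0(1,2,3) s\<Theta> \<Theta>b \<Theta>R L0 Lip om(1,2,3) in0 that])
    have w0l: "(\<lambda>n. \<integral>z. om0 n (fst z) * (\<bar>U z - V z\<bar> * \<Theta> (fst z) (snd z)) \<partial>lborel) \<longlonglongrightarrow> F Wu0 Wv0 0"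
      unfolding F_def by (rule weighted_slice_limit(2)[OF z0 R0 Wu0(1,2,3) Wv0(1,2,3) s\<Theta> \<Theta>b \<Theta>R L0 Lip om(1,2,3) in0])
    have w1i: "integrable lborel (\<lambda>z. om1 n (fst z) * (\<bar>U z - V z\<bar> * \<Theta> (fst z) (snd z)))" if "n0 \<le> n" for n
      by (rule weighted_slice_limit(1)[OF t R0 Wu(1,2,3) Wv(1,2,3) s\<Theta> \<Theta>b \<Theta>R L0 Lip om(4,5,6) in1 that])
    have w1l: "(\<lambda>n. \<integral>z. om1 n (fst z) * (\<bar>U z - V z\<bar> * \<Theta> (fst z) (snd z)) \<partial>lborel) \<longlonglongrightarrow> F Wu Wv t"
      unfolding F_def by (rule weighted_slice_limit(2)[OF t R0 Wu(1,2,3) Wv(1,2,3) s\<Theta> \<Theta>b \<Theta>R L0 Lip om(4,5,6) in1])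
    have "(\<integral>z. om1 n (fst z) * (\<bar>U z - V z\<bar> * \<Theta> (fst z) (snd z)) \<partial>lborel)
       \<le> (\<integral>z. om0 n (fst z) * (\<bar>U z - V z\<bar> * \<Theta> (fst z) (snd z)) \<partial>lborel)" if n: "n0 \<le> n" for n
    proof -
      define N where "N = real (Suc n)"
      have N: "0 < N" "4 < N * t" "4 / N < t"
        using big[OF n] by (simp_all add: N_def field_simps)
      have N0: "0 < 1 / N" using N(1) by simp
      have "4 / N = 4 * (1 / N)" by simp
      then have N1: "1 / N < t - 1 / N" using N(3) N0 by linarith
      \<comment> \<open>Both ramps are kept away from 0 and t by 1/N, so the support lies in the
        open interval (0,T), where Kato's inequality is available even for t = T.\<close>
      define chi where "chi s = smooth_step (N * s + - 1) * smooth_step (- N * s + (N * t - 1))" for s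
      have s_chi: "smooth1 chi" unfolding chi_def[abs_def] by (intro smooth1_mult smooth1_affine smooth1_step)
      have chi_nn: "0 \<le> chi s" for s by (simp add: chi_def smooth_step_bounds)
      have chi_z: "chi s = 0" if sn: "s \<notin> {1 / N..t - 1 / N}" for s
      proof -
        consider "s < 1 / N" | "s > t - 1 / N" using sn by fastforce
        then show ?thesis
        proof cases
          case 1
          then have "N * s + - 1 \<le> 0" using N(1) by (simp add: field_simps)
          then show ?thesis by (simp add: chi_def smooth_step_0)
        next
          case 2
          then have "- N * s + (N * t - 1) \<le> 0" using N(1) by (simp add: field_simps)
          then show ?thesis unfolding chi_def by (simp only: smooth_step_0 mult_zero_right)
        qed
      qed
      have dchi: "deriv chi s = om0 n s - om1 n s" for s
      proof (rule DERIV_imp_deriv)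
        have d: "(chi has_real_derivative (bump (N * s + - 1) * N) * smooth_step (- N * s + (N * t - 1))
           + (bump (- N * s + (N * t - 1)) * - N) * smooth_step (N * s + - 1)) (at s)"
          unfolding chi_def[abs_def]
          by (intro DERIV_mult DERIV_chain2[OF DERIV_smooth_step]) (auto intro!: derivative_eq_intros)
        have e: "om0 n s = bump (N * s + - 1) * N" "om1 n s = bump (- N * s + (N * t - 1)) * N"
          unfolding om0_def om1_def moll_def N_def[symmetric] using N(1) by (simp_all add: right_diff_distrib)
        \<comment> \<open>Where one ramp varies, the other factor of \<open>chi\<close> is already
          1: s < 2/N and N t > 4 give N t - 1 - N s \<ge> 1, and symmetrically at the other
          end.\<close>
        have "om0 n s * smooth_step (- N * s + (N * t - 1)) = om0 n s"
        proof (cases "om0 n s = 0")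
          case False
          then have "s < 2 / N" using supp0 by (simp add: N_def)
          then have "N * s < 2" using N(1) by (simp add: field_simps)
          then have "1 \<le> - N * s + (N * t - 1)" using N(2) by simp
          then show ?thesis by (simp only: smooth_step_1 mult_1_right)
        qed simp
        moreover have "om1 n s * smooth_step (N * s + - 1) = om1 n s"
        proof (cases "om1 n s = 0")
          case False
          then have "t - s < 2 / N" using supp1 by (simp add: N_def)
          then have "N * (t - s) < 2" using N(1) by (simp add: field_simps)
          then have "1 \<le> N * s + - 1" using N(2) by (simp add: right_diff_distrib)
          then show ?thesis by (simp only: smooth_step_1 mult_1_right)
        qed simp
        moreover have "(bump (N * s + - 1) * N) * smooth_step (- N * s + (N * t - 1))
           + (bump (- N * s + (N * t - 1)) * - N) * smooth_step (N * s + - 1)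
           = om0 n s * smooth_step (- N * s + (N * t - 1)) - om1 n s * smooth_step (N * s + - 1)"
          unfolding e by simp
        ultimately show "(chi has_real_derivative om0 n s - om1 n s) (at s)"
          using d by (simp only:)
      qed
      define \<psi> where "\<psi> s x = chi s * \<Theta> s x" for s x
      have sc: "smoothC (\<lambda>s x. chi s)" by (rule smoothC_fst[OF s_chi])
      have s\<psi>: "smoothC \<psi>" unfolding \<psi>_def[abs_def] by (intro smoothC_mult sc s\<Theta>)
      have \<psi>nn: "0 \<le> \<psi> s x" for s x by (simp add: \<psi>_def chi_nn \<Theta>b)
      have \<psi>z: "\<psi> s x = 0" if sx: "(s, x) \<notin> {1 / N..t - 1 / N} \<times> {l..r}" for s x
      proof (cases "s \<in> {1 / N..t - 1 / N}")
        case True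
        have "0 < 1 / N" using N(1) by simp
        then have "0 \<le> s" using True unfolding atLeastAtMost_iff by linarith
        moreover have "x \<notin> {l<..<r}" using True sx by auto
        ultimately show ?thesis using out by (simp add: \<psi>_def)
      next
        case False
        then show ?thesis by (simp add: \<psi>_def chi_z)
      qed
      have ab: "0 < 1 / N" "1 / N \<le> t - 1 / N" "t - 1 / N < T"
        using N0 N1 t0 by linarith+
      have ki: "integrable lborel (\<lambda>z. \<bar>U z - V z\<bar> * pd_t \<psi> (fst z) (snd z) + kruzkov_flux (p z) (p' z) * pd_x \<psi> (fst z) (snd z))"
        by (rule kato_inequality(1)[OF s\<psi> \<psi>nn \<psi>z ab])
      have k0: "0 \<le> (\<integral>z. \<bar>U z - V z\<bar> * pd_t \<psi> (fst z) (snd z) + kruzkov_flux (p z) (p' z) * pd_x \<psi> (fst z) (snd z) \<partial>lborel)"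
        by (rule kato_inequality(2)[OF s\<psi> \<psi>nn \<psi>z ab])
      have pd\<psi>: "pd_t \<psi> s x = (om0 n s - om1 n s) * \<Theta> s x + pd_t \<Theta> s x * chi s" "pd_x \<psi> s x = pd_x \<Theta> s x * chi s" for s x
      proof -
        have "pd_t (\<lambda>s x. chi s) = (\<lambda>s x. deriv chi s)" "pd_x (\<lambda>s x. chi s) = (\<lambda>s x. 0)"
          by (simp_all add: pd_t_def pd_x_def)
        then show "pd_t \<psi> s x = (om0 n s - om1 n s) * \<Theta> s x + pd_t \<Theta> s x * chi s" "pd_x \<psi> s x = pd_x \<Theta> s x * chi s"
          unfolding \<psi>_def[abs_def] pd_mult[OF smoothC_D(1)[OF sc] smoothC_D(1)[OF s\<Theta>]] by (simp_all add: dchi)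
      qed
      have "AE z in lborel. \<bar>U z - V z\<bar> * pd_t \<psi> (fst z) (snd z) + kruzkov_flux (p z) (p' z) * pd_x \<psi> (fst z) (snd z)
         \<le> om0 n (fst z) * (\<bar>U z - V z\<bar> * \<Theta> (fst z) (snd z)) - om1 n (fst z) * (\<bar>U z - V z\<bar> * \<Theta> (fst z) (snd z))"
        using flux_le_speed
      proof eventually_elim
        case (elim z)
        let ?D = "\<bar>U z - V z\<bar>" and ?x = "pd_x \<Theta> (fst z) (snd z)" and ?t = "pd_t \<Theta> (fst z) (snd z)"
        \<comment> \<open>The flux is at most M |U - V|, so the space derivative of
          \<open>\<Theta>\<close> is absorbed by its time derivative through \<open>speed\<close>;
          only the two ramps of \<open>chi\<close> survive.\<close>
        have "(?D * ?t + kruzkov_flux (p z) (p' z) * ?x) * chi (fst z) \<le> 0"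
        proof (cases "fst z \<in> {1 / N..t - 1 / N}")
          case True
          then have "0 \<le> fst z" "fst z \<le> T" using N0 ab(3) unfolding atLeastAtMost_iff by linarith+
          then have "z \<in> Q_dom T" by (simp add: mem_Times_iff)
          then have "\<bar>kruzkov_flux (p z) (p' z) * ?x\<bar> \<le> (M * ?D) * \<bar>?x\<bar>"
            unfolding abs_mult using elim by (intro mult_right_mono) auto
          then have "?D * ?t + kruzkov_flux (p z) (p' z) * ?x \<le> ?D * (?t + M * \<bar>?x\<bar>)"
            by (simp add: algebra_simps abs_le_iff)
          also have "\<dots> \<le> 0" using speed by (intro mult_nonneg_nonpos) auto
          finally show ?thesis using chi_nn by (simp add: mult_nonpos_nonneg)
        next
          case False
          then show ?thesis by (simp add: chi_z)
        qed
        then show ?case unfolding pd\<psi> by (simp add: algebra_simps)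
      qed
      then have "(\<integral>z. \<bar>U z - V z\<bar> * pd_t \<psi> (fst z) (snd z) + kruzkov_flux (p z) (p' z) * pd_x \<psi> (fst z) (snd z) \<partial>lborel)
         \<le> (\<integral>z. om0 n (fst z) * (\<bar>U z - V z\<bar> * \<Theta> (fst z) (snd z)) - om1 n (fst z) * (\<bar>U z - V z\<bar> * \<Theta> (fst z) (snd z)) \<partial>lborel)"
        by (intro integral_mono_AE ki Bochner_Integration.integrable_diff w0i[OF n] w1i[OF n])
      then show ?thesis using k0 w0i[OF n] w1i[OF n] by simp
    qed
    then have "F Wu Wv t \<le> F Wu0 Wv0 0"
      by (intro LIMSEQ_le[OF w1l w0l] exI[of _ n0]) blast
    then show ?thesis using Wu Wv by blast
  qed
  then obtain Wu Wv where W: "Wu \<in> borel_measurable borel" "Wv \<in> borel_measurable borel" "\<And>x. \<bar>Wu x\<bar> \<le> C" "\<And>x. \<bar>Wv x\<bar> \<le> C"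
     "AE x in lborel. x \<in> {-R..R} \<longrightarrow> Wu x = u t x" "AE x in lborel. x \<in> {-R..R} \<longrightarrow> Wv x = v t x"
     "F Wu Wv t \<le> F Wu0 Wv0 0" by blast
  have cv: "(\<integral>\<^sup>+x. ennreal (\<bar>f x - g x\<bar> * \<Theta> s x) \<partial>lborel) = ennreal (F f g s)"
    if [measurable]: "f \<in> borel_measurable borel" "g \<in> borel_measurable borel"
      and b: "\<And>x. \<bar>f x\<bar> \<le> C" "\<And>x. \<bar>g x\<bar> \<le> C" and s: "0 \<le> s" for f g s
    unfolding F_def
  proof (rule nn_integral_eq_integral)
    have "(\<lambda>x. (s, x)) \<in> borel_measurable (borel :: real measure)"
      by (intro borel_measurable_continuous_onI continuous_intros)
    from measurable_compose[OF this borel_measurable_smoothC[OF s\<Theta>]]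
    have [measurable]: "\<Theta> s \<in> borel_measurable borel" by simp
    show "integrable lborel (\<lambda>x. \<bar>f x - g x\<bar> * \<Theta> s x)"
    proof (rule integrable_lborel_bounded_support[of _ "2 * C * 1" "{l<..<r}"])
      have "\<bar>f x - g x\<bar> \<le> 2 * C" for x using b[of x] abs_triangle_ineq4[of "f x" "g x"] by linarith
      then show "\<bar>\<bar>f x - g x\<bar> * \<Theta> s x\<bar> \<le> 2 * C * 1" for x
        unfolding abs_mult using \<Theta>b[of s x] S.C_nonneg by (intro mult_mono) auto
    qed (use out[OF s] in auto)
    show "AE x in lborel. 0 \<le> \<bar>f x - g x\<bar> * \<Theta> s x" using \<Theta>b by simp
  qed
  obtain U0 CU where U0: "U0 \<in> borel_measurable borel" "\<And>x. \<bar>U0 x\<bar> \<le> CU" "AE x in lborel. U0 x = u0 x"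
    using Linf_borel_representative[OF u0] by auto
  obtain V0 CV where V0: "V0 \<in> borel_measurable borel" "\<And>x. \<bar>V0 x\<bar> \<le> CV" "AE x in lborel. V0 x = v0 x"
    using Linf_borel_representative[OF v0] by auto
  have tu: "AE x in lborel. x \<in> {l..r} \<longrightarrow> Wu0 x = U0 x"
    by (rule S.initial_trace[OF u0 U0 Wu0(1,2,3) lr])
  have tv: "AE x in lborel. x \<in> {l..r} \<longrightarrow> Wv0 x = V0 x"
    by (rule R.initial_trace[OF v0 V0 Wv0(1,2,3) lr])
  have cd: "{c..d} \<subseteq> {-R..R}" using c Mt by (auto simp: R_def)
  have "(\<integral>\<^sup>+x\<in>{c..d}. ennreal \<bar>u t x - v t x\<bar> \<partial>lebesgue) = (\<integral>\<^sup>+x. ennreal \<bar>u t x - v t x\<bar> * indicator {c..d} x \<partial>lborel)"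
    by (rule nn_integral_completion)
  also have "\<dots> \<le> (\<integral>\<^sup>+x. ennreal (\<bar>Wu x - Wv x\<bar> * \<Theta> t x) \<partial>lborel)"
  proof (rule nn_integral_mono_AE)
    show "AE x in lborel. ennreal \<bar>u t x - v t x\<bar> * indicator {c..d} x \<le> ennreal (\<bar>Wu x - Wv x\<bar> * \<Theta> t x)"
      using W(5,6)
    proof eventually_elim
      case (elim x)
      then show ?case using one[of x] cd by (cases "x \<in> {c..d}") auto
    qed
  qed
  also have "\<dots> = ennreal (F Wu Wv t)" using W t by (intro cv) auto
  also have "\<dots> \<le> ennreal (F Wu0 Wv0 0)" by (rule ennreal_leI[OF W(7)])
  also have "\<dots> = (\<integral>\<^sup>+x. ennreal (\<bar>Wu0 x - Wv0 x\<bar> * \<Theta> 0 x) \<partial>lborel)" using Wu0 Wv0 by (intro cv[symmetric]) auto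
  also have "\<dots> \<le> (\<integral>\<^sup>+x. ennreal \<bar>u0 x - v0 x\<bar> * indicator {l<..<r} x \<partial>lborel)"
  proof (rule nn_integral_mono_AE)
    show "AE x in lborel. ennreal (\<bar>Wu0 x - Wv0 x\<bar> * \<Theta> 0 x) \<le> ennreal \<bar>u0 x - v0 x\<bar> * indicator {l<..<r} x"
      using tu tv U0(3) V0(3)
    proof eventually_elim
      case (elim x)
      show ?case
      proof (cases "x \<in> {l<..<r}")
        case True
        then have "\<bar>Wu0 x - Wv0 x\<bar> = \<bar>u0 x - v0 x\<bar>" using elim by simp
        moreover have "\<bar>Wu0 x - Wv0 x\<bar> * \<Theta> 0 x \<le> \<bar>Wu0 x - Wv0 x\<bar>"
          using \<Theta>b[of 0 x] by (simp add: mult_left_le)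
        ultimately show ?thesis using True by (simp add: ennreal_leI)
      next
        case False
        then show ?thesis using out[of 0 x] by simp
      qed
    qed
  qed
  also have "\<dots> = (\<integral>\<^sup>+x\<in>{l<..<r}. ennreal \<bar>u0 x - v0 x\<bar> \<partial>lebesgue)"
    by (rule nn_integral_completion[symmetric])
  finally show ?thesis by (simp add: l_def r_def)
qed

end

text \<open>Monotone convergence along compact intervals that exhaust the open one. Measurability is
  asked on bounded intervals, which is the form in which local integrability of a slice provides
  it.\<close>

lemma nn_integral_Icc_exhaust_le:
  fixes f :: "real \<Rightarrow> ennreal"
  assumes m: "\<And>l u. (\<lambda>x. f x * indicator {l..u} x) \<in> borel_measurable N"
    and ab: "a < b" and le: "\<And>l u. a < ereal l \<Longrightarrow> l \<le> u \<Longrightarrow> ereal u < b \<Longrightarrow> (\<integral>\<^sup>+x\<in>{l..u}. f x \<partial>N) \<le> B"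
  shows "(\<integral>\<^sup>+x\<in>einterval a b. f x \<partial>N) \<le> B"
proof -
  obtain u l where lu: "einterval a b = (\<Union>i. {l i .. u i})" "incseq u" "decseq l" "\<And>i. l i < u i"
    "\<And>i. a < ereal (l i)" "\<And>i. ereal (u i) < b" "(\<lambda>i. ereal (l i)) \<longlonglongrightarrow> a" "(\<lambda>i. ereal (u i)) \<longlonglongrightarrow> b"
    by (rule einterval_Icc_approximation[OF ab], rule that)
  let ?g = "\<lambda>i x. f x * indicator {l i..u i} x"
  have sub: "{l i..u i} \<subseteq> {l j..u j}" if "i \<le> j" for i j
    using incseqD[OF lu(2) that] decseqD[OF lu(3) that] by auto
  have "f x * indicator (einterval a b) x = (SUP i. ?g i x)" for x
  proof (cases "x \<in> einterval a b")
    case True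
    then obtain i where i: "x \<in> {l i..u i}" using lu(1) by auto
    show ?thesis
    proof (rule antisym)
      have "f x * indicator (einterval a b) x = ?g i x" using True i by simp
      also have "\<dots> \<le> (SUP i. ?g i x)" by (rule SUP_upper) simp
      finally show "f x * indicator (einterval a b) x \<le> (SUP i. ?g i x)" .
      show "(SUP i. ?g i x) \<le> f x * indicator (einterval a b) x"
        using True by (intro SUP_least) (simp add: indicator_def)
    qed
  next
    case False
    then have "(SUP i. ?g i x) = (SUP i :: nat. 0)" using lu(1) by (intro SUP_cong refl) auto
    then show ?thesis using False by simp
  qed
  then have "(\<integral>\<^sup>+x\<in>einterval a b. f x \<partial>N) = (\<integral>\<^sup>+x. (SUP i. ?g i x) \<partial>N)" by simp
  also have "\<dots> = (SUP i. \<integral>\<^sup>+x. ?g i x \<partial>N)"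
  proof (rule nn_integral_monotone_convergence_SUP[OF _ m])
    show "incseq ?g"
      unfolding incseq_def le_fun_def
    proof (intro allI impI mult_left_mono)
      fix i j :: nat and x assume "i \<le> j"
      then show "indicator {l i..u i} x \<le> (indicator {l j..u j} x :: ennreal)"
        by (intro indicator_leI) (use sub in blast)
    qed simp
  qed
  also have "\<dots> \<le> B" using le lu(4-6) by (intro SUP_least) (simp add: less_imp_le)
  finally show ?thesis .
qed

theorem theorem2p1:
  fixes A :: "real \<Rightarrow> real \<Rightarrow> real" and \<Omega> :: "real set" and q um up :: "real \<Rightarrow> real"
    and T :: real and u v :: "real \<Rightarrow> real \<Rightarrow> real" and u0 v0 :: "real \<Rightarrow> real"
    and t :: real and a b :: ereal
  assumes "0 < T"
    and "flux_A1 A \<Omega>" and "flux_A2 A q" and "flux_A3 A \<Omega> um up"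
    and "stationary_states_exist A \<Omega> um up"
    and "Linf u0" and "Linf v0"
    and "adapted_entropy_solution A \<Omega> um up T u0 u"
    and "adapted_entropy_solution A \<Omega> um up T v0 v"
    and "t \<in> {0..T}" and "a < b"
  defines "M \<equiv> max_speed A T u v"
  shows "(\<integral>\<^sup>+x\<in>einterval a b. ennreal \<bar>u t x - v t x\<bar> \<partial>lebesgue)
           \<le> (\<integral>\<^sup>+x\<in>einterval (a - ereal (M * t)) (b + ereal (M * t)). ennreal \<bar>u0 x - v0 x\<bar> \<partial>lebesgue)"
proof (rule nn_integral_Icc_exhaust_le[OF _ \<open>a < b\<close>])
  have cu: "continuous_L1loc T u" "Linf_Q T u" and cv: "continuous_L1loc T v" "Linf_Q T v"
    using assms(8,9) by (auto simp: adapted_entropy_solution_def)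
  obtain U CU where U: "U \<in> borel_measurable borel" "\<And>z. \<bar>U z\<bar> \<le> CU"
    "AE z in lborel. z \<in> Q_dom T \<longrightarrow> U z = u (fst z) (snd z)"
    using Linf_Q_borel_representative[OF cu(2)] by auto
  obtain V CV where V: "V \<in> borel_measurable borel" "\<And>z. \<bar>V z\<bar> \<le> CV"
    "AE z in lborel. z \<in> Q_dom T \<longrightarrow> V z = v (fst z) (snd z)"
    using Linf_Q_borel_representative[OF cv(2)] by auto
  have b: "\<bar>U z\<bar> \<le> max CU CV" "\<bar>V z\<bar> \<le> max CU CV" for z
    using U(2)[of z] V(2)[of z] by auto
  interpret adapted_pair A \<Omega> q um up T u0 u U "max CU CV" v0 v V
    by unfold_locales (use assms U V b in auto)
  show "(\<integral>\<^sup>+x\<in>{l..r}. ennreal \<bar>u t x - v t x\<bar> \<partial>lebesgue)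
      \<le> (\<integral>\<^sup>+x\<in>einterval (a - ereal (M * t)) (b + ereal (M * t)). ennreal \<bar>u0 x - v0 x\<bar> \<partial>lebesgue)"
    if lr: "a < ereal l" "l \<le> r" "ereal r < b" for l r
  proof -
    \<comment> \<open>Since a < l and r < b are strict, the transition zones of the smoothed
      trapezoid fit between [l,r] and the ends of (a,b). The enlarged base therefore stays inside
      the interval on the right, also for infinite ends.\<close>
    obtain c' where c': "a < ereal c'" "c' < l" using ereal_dense2[OF lr(1)] by auto
    obtain d' where d': "r < d'" "ereal d' < b" using ereal_dense2[OF lr(3)] by auto
    have "{c' - M * t<..<d' + M * t} \<subseteq> einterval (a - ereal (M * t)) (b + ereal (M * t))"
    proof
      fix x assume x: "x \<in> {c' - M * t<..<d' + M * t}"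
      have "a - ereal (M * t) < ereal x" using c'(1) x by (cases a) auto
      moreover have "ereal x < b + ereal (M * t)" using d'(2) x by (cases b) auto
      ultimately show "x \<in> einterval (a - ereal (M * t)) (b + ereal (M * t))" by (simp add: einterval_def)
    qed
    then have "(\<integral>\<^sup>+x\<in>{c' - M * t<..<d' + M * t}. ennreal \<bar>u0 x - v0 x\<bar> \<partial>lebesgue)
      \<le> (\<integral>\<^sup>+x\<in>einterval (a - ereal (M * t)) (b + ereal (M * t)). ennreal \<bar>u0 x - v0 x\<bar> \<partial>lebesgue)"
      by (intro nn_integral_mono) (auto simp: indicator_def)
    with trapezoid_comparison[OF assms(6,7,10) c'(2) lr(2) d'(1)] show ?thesis
      unfolding M_def by (rule order_trans)
  qed
  show "(\<lambda>x. ennreal \<bar>u t x - v t x\<bar> * indicator {l..r} x) \<in> borel_measurable lebesgue" for l r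
  proof -
    define R where "R = \<bar>l\<bar> + \<bar>r\<bar>"
    have "set_integrable lebesgue {-R..R} (u t)" "set_integrable lebesgue {-R..R} (v t)"
      using cu(1) cv(1) \<open>t \<in> {0..T}\<close> by (simp_all add: continuous_L1loc_def)
    then have m: "(\<lambda>x. indicator {-R..R} x *\<^sub>R u t x) \<in> borel_measurable lebesgue"
      "(\<lambda>x. indicator {-R..R} x *\<^sub>R v t x) \<in> borel_measurable lebesgue"
      unfolding set_integrable_def by (auto intro: borel_measurable_integrable)
    have "(\<lambda>x. ennreal \<bar>u t x - v t x\<bar> * indicator {l..r} x)
      = (\<lambda>x. ennreal \<bar>indicator {-R..R} x *\<^sub>R u t x - indicator {-R..R} x *\<^sub>R v t x\<bar> * indicator {l..r} x)"
    proof
      fix x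
      have "x \<in> {-R..R}" if "x \<in> {l..r}" using that by (auto simp: R_def)
      then show "ennreal \<bar>u t x - v t x\<bar> * indicator {l..r} x
        = ennreal \<bar>indicator {-R..R} x *\<^sub>R u t x - indicator {-R..R} x *\<^sub>R v t x\<bar> * indicator {l..r} x"
        by (cases "x \<in> {l..r}") auto
    qed
    also have "\<dots> \<in> borel_measurable lebesgue"
      by (intro borel_measurable_times_ennreal measurable_compose[OF _ measurable_ennreal]
          borel_measurable_abs borel_measurable_diff m borel_measurable_indicator) simp
    finally show ?thesis .
  qed
qed

end
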